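(* Let $a,b$ be positive real numbers with $b>1$. There is a positive real constant $c_{a,b}$, depending only on $a,b$ and effectively computable from them, with the following property. Let $S$ be a subset of the open unit disk containing the interval $(0,1)$, and let $f$ be analytic on the open unit disk with $|f(z)|\le 1$ there and $$|f(z)|< a\,b^{-\phi(z)}\quad\text{for all } z\in S .$$ Then for $d\ge 2$ and $H\ge e$ the number of algebraic $\alpha\in S$ such that $f(\alpha)$ is algebraic and non-zero with $[\mathbb{Q}(\alpha,f(\alpha)):\mathbb{Q}]\le d$ and $H(\alpha),H(f(\alpha))\le H$ is at most $$c_{a,b}\,d^9(\log d)^2(\log H)^9 .$$ Moreover, if for some $0<r<1$ we only consider $\alpha$ such that $|\alpha|\le r$, then the bound can be improved to $c_{a,b,r}\,d^4(\log d)^2(\log H)^4$, where $c_{a,b,r}$ is effectively computable from $a$, $b$ and $r$.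
   Context: For $z$ in the open unit disk of $\mathbb{C}$, $\phi(z)=\frac{1}{1-|z|}$. For an algebraic number $\alpha$, $H(\alpha)$ denotes its absolute multiplicative height: if the minimal polynomial of $\alpha$ over $\mathbb{Z}$ has degree $\delta$, positive leading coefficient $a_0$ and complex roots $z_1,\dots,z_\delta$, then $H(\alpha)=\left(a_0\prod_i\max\{1,|z_i|\}\right)^{1/\delta}$. The letter $H$ alone denotes a real bound on heights. *)

theory Defs
  imports "HOL-Analysis.Analysis" "HOL-Computational_Algebra.Polynomial_Factorial"
begin

definition disk_phi :: "complex \<Rightarrow> real" where
  "disk_phi z = 1 / (1 - cmod z)"


section \<open>Algebraic numbers\<close>

text \<open>An irreducible element of \<open>int poly\<close> with a root in the complex numbers is nonconstant,
  hence automatically primitive; together with the sign of its leading coefficient it is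
  determined by the root.\<close>

definition min_int_poly :: "complex \<Rightarrow> int poly" where
  "min_int_poly \<alpha> =
     (THE p. irreducible p \<and> lead_coeff p > 0 \<and> poly (map_poly of_int p) \<alpha> = 0)"

lemma min_int_poly_ex1:
  fixes \<alpha> :: complex
  assumes "algebraic \<alpha>"
  shows "\<exists>!p. irreducible p \<and> lead_coeff p > 0 \<and> poly (map_poly of_int p) \<alpha> = 0"
proof -
  let ?ev = "\<lambda>p :: int poly. poly (map_poly of_int p) \<alpha>"
  have ev_mult: "?ev (p * q) = ?ev p * ?ev q" for p q
  proof -
    have "map_poly of_int (p * q) = (map_poly of_int p * map_poly of_int q :: complex poly)"
      by (rule poly_eqI) (simp add: coeff_map_poly coeff_mult)
    thus ?thesis by simp
  qed
  have ev_add: "?ev (p + q) = ?ev p + ?ev q" for p q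
  proof -
    have "map_poly of_int (p + q) = (map_poly of_int p + map_poly of_int q :: complex poly)"
      by (rule poly_eqI) (simp add: coeff_map_poly)
    thus ?thesis by simp
  qed
  have ev_minus: "?ev (- p) = - ?ev p" for p
    using ev_add[of p "-p"] by (simp add: eq_neg_iff_add_eq_0 add.commute)
  have ev_const: "?ev [:c:] = of_int c" for c
    by (cases "c = 0") (simp_all add: map_poly_pCons)
  define P where "P p \<longleftrightarrow> p \<noteq> 0 \<and> ?ev p = 0" for p
  obtain p0 where "P p0"
    using algebraicE'[OF assms] unfolding P_def by metis
  then obtain r where r: "P r" and r_min: "\<And>s. P s \<Longrightarrow> degree r \<le> degree s"
    using ex_has_least_nat[of P p0 degree] by blast
  have factor: "\<exists>q. q dvd p \<and> prime_elem q \<and> ?ev q = 0" if "P p" for p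
  proof -
    have "p \<noteq> 0 \<Longrightarrow> ?ev p = 0 \<longrightarrow> (\<exists>q. q dvd p \<and> prime_elem q \<and> ?ev q = 0)"
    proof (induction p rule: prime_divisors_induct)
      case (unit x)
      then obtain y where "1 = x * y" by (elim dvdE)
      hence "?ev x * ?ev y = 1" using ev_mult[of x y] by simp
      thus ?case by auto
    next
      case (factor q x)
      thus ?case using ev_mult[of q x] by (metis dvd_mult dvd_triv_left mult_eq_0_iff prime_def)
    qed simp
    thus ?thesis using that by (auto simp: P_def)
  qed
  obtain q where q: "q dvd r" "prime_elem q" "?ev q = 0" using factor[OF r] by blast
  have "P q" using q by (auto simp: P_def)
  have deg_q: "degree q \<le> degree s" if "P s" for s
    using r_min[OF that] q(1) r dvd_imp_degree_le[of q r] by (auto simp: P_def)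
  have "degree q \<noteq> 0"
  proof
    assume "degree q = 0"
    then obtain c where "q = [:c:]" by (metis degree_eq_zeroE)
    thus False using q(3) \<open>P q\<close> ev_const[of c] by (auto simp: P_def)
  qed
  have q_dvd: "q dvd p" if "?ev p = 0" for p
  proof -
    obtain g s where gs: "pseudo_divmod p q = (g, s)" by force
    define c where "c = coeff q (degree q) ^ (Suc (degree p) - degree q)"
    from pseudo_divmod[OF _ gs] \<open>P q\<close> have *: "smult c p = q * g + s" "s = 0 \<or> degree s < degree q"
      by (auto simp: P_def c_def)
    have "?ev ([:c:] * p) = ?ev (q * g + s)" using *(1) by simp
    hence "?ev s = 0" using that q(3) by (simp only: ev_mult ev_add) simp
    with *(2) deg_q[of s] have "s = 0" unfolding P_def by force
    with *(1) have "q dvd [:c:] * p" by simp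
    moreover have "\<not> q dvd [:c:]"
    proof
      assume "q dvd [:c:]"
      moreover have "c \<noteq> 0" using \<open>P q\<close> by (simp add: c_def P_def)
      ultimately show False using dvd_imp_degree_le[of q "[:c:]"] \<open>degree q \<noteq> 0\<close> by simp
    qed
    ultimately show ?thesis using q(2) by (metis prime_elem_dvd_mult_iff)
  qed
  define m where "m = (if lead_coeff q > 0 then q else - q)"
  have irr: "irreducible q" using q(2) by (rule prime_elem_imp_irreducible)
  hence irr': "irreducible (- q)"
    using irreducible_mult_unit_left[of "-1" q] by simp
  have m: "irreducible m \<and> lead_coeff m > 0 \<and> ?ev m = 0"
    using irr irr' q(3) \<open>P q\<close> ev_minus[of q] leading_coeff_neq_0[of q]
    by (auto simp: m_def P_def not_less order_le_less)
  show ?thesis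
  proof (rule ex1I[of _ m])
    fix p assume p: "irreducible p \<and> lead_coeff p > 0 \<and> ?ev p = 0"
    have "m dvd p" using q_dvd[of p] p by (auto simp: m_def)
    then obtain u where u: "p = m * u" by (elim dvdE)
    have "u dvd 1" using p m u irreducible_not_unit irreducibleD by blast
    then obtain c where c: "u = [:c:]" "c dvd 1" by (auto simp: is_unit_poly_iff)
    hence "c = 1 \<or> c = -1" by auto
    thus "p = m" using u c p m by auto
  qed (rule m)
qed

definition height :: "complex \<Rightarrow> real" where
  "height \<alpha> = (let p = min_int_poly \<alpha> in
     root (degree p)
       (of_int (lead_coeff p) *
        (\<Prod>z\<in>#proots (map_poly of_int p :: complex poly). max 1 (cmod z))))"

text \<open>The subfield of the complex numbers generated by a set.\<close>

inductive_set rat_adjoin :: "complex set \<Rightarrow> complex set" for X where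
  rat: "of_rat q \<in> rat_adjoin X"
| incl: "x \<in> X \<Longrightarrow> x \<in> rat_adjoin X"
| add: "x \<in> rat_adjoin X \<Longrightarrow> y \<in> rat_adjoin X \<Longrightarrow> x + y \<in> rat_adjoin X"
| minus: "x \<in> rat_adjoin X \<Longrightarrow> - x \<in> rat_adjoin X"
| mult: "x \<in> rat_adjoin X \<Longrightarrow> y \<in> rat_adjoin X \<Longrightarrow> x * y \<in> rat_adjoin X"
| inv: "x \<in> rat_adjoin X \<Longrightarrow> inverse x \<in> rat_adjoin X"

text \<open>The degree over the rationals. As \<open>dim\<close> is 0 on spaces of infinite dimension, this is
  meaningful only for finite extensions.\<close>

definition degree_over_rat :: "complex set \<Rightarrow> nat" where
  "degree_over_rat K = vector_space.dim (\<lambda>(q::rat) (x::complex). of_rat q * x) K"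

lemma vector_space_rat_complex: "vector_space (\<lambda>(q::rat) (x::complex). of_rat q * x)"
  by unfold_locales (auto simp: algebra_simps of_rat_add of_rat_mult)

definition alg_points :: "(complex \<Rightarrow> complex) \<Rightarrow> complex set \<Rightarrow> nat \<Rightarrow> real \<Rightarrow> complex set" where
  "alg_points f S d H =
     {\<alpha> \<in> S. algebraic \<alpha> \<and> algebraic (f \<alpha>) \<and> f \<alpha> \<noteq> 0 \<and>
        degree_over_rat (rat_adjoin {\<alpha>, f \<alpha>}) \<le> d \<and> height \<alpha> \<le> H \<and> height (f \<alpha>) \<le> H}"


section \<open>Computable functions of nonnegative real arguments\<close>

text \<open>Partial recursive functions (zero, successor, projections, composition, primitive recursion,
  minimisation) relative to a finite list of oracles. \<open>computes os p xs y\<close>: the program \<open>p\<close>, given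
  the oracles \<open>os\<close> and the input \<open>xs\<close>, halts with the output \<open>y\<close>.\<close>

datatype prog =
    Zero
  | Succ
  | Proj nat
  | Query nat
  | Comp prog "prog list"
  | PrimRec prog prog
  | Mini prog

inductive computes :: "(nat \<Rightarrow> nat) list \<Rightarrow> prog \<Rightarrow> nat list \<Rightarrow> nat \<Rightarrow> bool"
  for os :: "(nat \<Rightarrow> nat) list" where
  zero: "computes os Zero xs 0"
| succ: "computes os Succ (x # xs) (Suc x)"
| proj: "i < length xs \<Longrightarrow> computes os (Proj i) xs (xs ! i)"
| query: "i < length os \<Longrightarrow> computes os (Query i) (x # xs) ((os ! i) x)"
| comp: "list_all2 (\<lambda>g y. computes os g xs y) gs ys \<Longrightarrow> computes os f ys z \<Longrightarrow>
    computes os (Comp f gs) xs z"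
| primrec_0: "computes os f xs y \<Longrightarrow> computes os (PrimRec f g) (0 # xs) y"
| primrec_Suc: "computes os (PrimRec f g) (n # xs) y \<Longrightarrow> computes os g (n # y # xs) z \<Longrightarrow>
    computes os (PrimRec f g) (Suc n # xs) z"
| mini: "computes os f (n # xs) 0 \<Longrightarrow> (\<forall>m<n. \<exists>k. computes os f (m # xs) (Suc k)) \<Longrightarrow>
    computes os (Mini f) xs n"

lemma computes_unique: "computes os p xs y \<Longrightarrow> computes os p xs y' \<Longrightarrow> y = y'"
proof (induction arbitrary: y' rule: computes.induct)
  case (zero xs)
  thus ?case by cases auto
next
  case (succ x xs)
  thus ?case by cases auto
next
  case (proj i xs)
  from proj.prems show ?case by cases auto
next
  case (query i x xs)
  from query.prems show ?case by cases auto
next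
  case (comp xs gs ys f z)
  from comp.prems obtain ys' where
    1: "list_all2 (\<lambda>g y. computes os g xs y) gs ys'" "computes os f ys' y'"
    by cases auto
  have "ys = ys'"
  proof (rule nth_equalityI)
    show "length ys = length ys'"
      using comp.IH(1) 1(1) by (simp add: list_all2_conv_all_nth)
  next
    fix i assume "i < length ys"
    thus "ys ! i = ys' ! i"
      using comp.IH(1) 1(1) by (simp add: list_all2_conv_all_nth)
  qed
  with 1 comp.IH(2) show ?case by simp
next
  case (primrec_0 f xs y g)
  from primrec_0.prems have "computes os f xs y'" by cases auto
  thus ?case by (rule primrec_0.IH)
next
  case (primrec_Suc f g n xs y z)
  from primrec_Suc.prems obtain v where
    v: "computes os (PrimRec f g) (n # xs) v" "computes os g (n # v # xs) y'"
    by cases auto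
  with primrec_Suc.IH(1)[OF v(1)] show ?case by (simp add: primrec_Suc.IH(2))
next
  case (mini f n xs)
  from mini.prems have y': "computes os f (y' # xs) 0" "\<forall>m<y'. \<exists>k. computes os f (m # xs) (Suc k)"
    by (cases; simp)+
  show ?case
  proof (rule linorder_cases[of n y'])
    assume "n < y'"
    then obtain k where "computes os f (n # xs) (Suc k)" using y'(2) by blast
    from mini.IH(1)[OF this] show ?thesis by simp
  next
    assume "y' < n"
    then obtain k where "\<forall>z. computes os f (y' # xs) z \<longrightarrow> Suc k = z" using mini.IH(2) by blast
    with y'(1) show ?thesis by blast
  qed simp
qed

text \<open>A nonnegative real is presented by dyadic approximations with error at most \<open>1/2^n\<close>.\<close>

definition dyadic_name :: "(nat \<Rightarrow> nat) \<Rightarrow> real \<Rightarrow> bool" where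
  "dyadic_name g x \<longleftrightarrow> (\<forall>n. \<bar>x - real (g n) / 2 ^ n\<bar> \<le> 1 / 2 ^ n)"

text \<open>Computability in the sense of computable analysis: one program turns arbitrary names of the
  arguments, used as oracles, into a name of the value.\<close>

definition computable_real_fun :: "real list set \<Rightarrow> (real list \<Rightarrow> real) \<Rightarrow> bool" where
  "computable_real_fun D F \<longleftrightarrow>
     (\<exists>p. \<forall>xs\<in>D. \<forall>os. list_all2 dyadic_name os xs \<longrightarrow>
        (\<exists>h. dyadic_name h (F xs) \<and> (\<forall>n. computes os p [n] (h n))))"

end

theory Submission
  imports Defs "HOL-Complex_Analysis.Conformal_Mappings"
    "HOL-Computational_Algebra.Fundamental_Theorem_Algebra"
begin

text \<open>Write \<open>l = ln H\<close>. By Liouville's inequality \<open>f \<alpha>\<close> is at least \<open>H\<close> to the power \<open>- 2 d\<close>, so the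
  growth condition keeps the points at distance \<open>\<theta> >> 1 / (d l)\<close> from the unit circle. A pigeonhole
  argument over all conjugates gives an integer polynomial \<open>P\<close> of degree \<open>T\<close> in each variable, with
  coefficients bounded by \<open>exp (O(T l))\<close>, such that \<open>P(\<alpha>, f \<alpha>) = 0\<close> at about \<open>T\<^sup>2 / (4 d)\<close> of the
  points. Dividing by the Blaschke product of these zeros makes \<open>P(z, f z)\<close> so small at the other
  points that it vanishes there too, by Liouville again, once \<open>T\<close> is a large multiple of
  \<open>d\<^sup>2 l / \<theta>\<^sup>2\<close>.

  It remains to count the zeros of \<open>P(z, f z)\<close>. Since \<open>f \<alpha>\<close> is non-zero, one may assume that
  \<open>P(X, 0)\<close> is not the zero polynomial. At a suitable real \<open>s\<close> with \<open>1 - s\<close> of order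
  \<open>1 / (T l ln d)\<close>, the value \<open>P(s, 0)\<close> is not too small whereas \<open>f s\<close> is negligible. This bounds
  \<open>P(s, f s)\<close> from below, and the Blaschke product at \<open>s\<close> bounds the number of zeros by a multiple of
  \<open>(T l ln d)\<^sup>2 / \<theta>\<close>.\<close>

section \<open>Arithmetic of computable real functions\<close>

text \<open>Both bounds come from one estimate. If 1 - |\<alpha>| \<ge> 1/\<Theta> for the points
  considered, the degree T is of order d^2 l \<Theta>^2 and the zero count of order \<Theta> (T l ln
  d)^2, that is \<Theta>^5 d^4 (ln d)^2 l^4, up to constants. With \<Theta> of order d l this has
  the exponents 9; with \<Theta> = 1/(1 - r) it has the exponents 4. The obstacle is that nothing
  bounds f from below, so counting the zeros of P(z, f z) needs a place where this function is
  visibly not small. The radial interval provides it: there f falls below any prescribed exp(-N)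
  once 1 - s is a small multiple of 1/N, while a non-zero integer polynomial in z alone cannot be
  that small throughout a short interval. Effectivity is kept elementary: the constants are rational
  functions of a, b and r, with ln b replaced by its lower bound (b - 1)/b. Hence only field
  operations on names of reals have to be programmed.\<close>

definition rel_computable :: "(nat \<Rightarrow> nat) list set \<Rightarrow> nat \<Rightarrow> ((nat \<Rightarrow> nat) list \<Rightarrow> nat list \<Rightarrow> nat) \<Rightarrow> bool" where
  "rel_computable X k F \<longleftrightarrow> (\<exists>p. \<forall>os\<in>X. \<forall>xs. length xs = k \<longrightarrow> computes os p xs (F os xs))"

lemma rel_computable_cong:
  "rel_computable X k F \<Longrightarrow> (\<And>os xs. os \<in> X \<Longrightarrow> length xs = k \<Longrightarrow> F os xs = G os xs) \<Longrightarrow> rel_computable X k G"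
  unfolding rel_computable_def by metis

lemma rel_computable_proj: "i < k \<Longrightarrow> rel_computable X k (\<lambda>os xs. xs ! i)"
  unfolding rel_computable_def by (metis computes.proj)

lemma rel_computable_comp:
  assumes "rel_computable X (length Gs) F" and "\<And>G. G \<in> set Gs \<Longrightarrow> rel_computable X k G"
  shows "rel_computable X k (\<lambda>os xs. F os (map (\<lambda>G. G os xs) Gs))"
proof -
  obtain p where p: "\<And>os xs. os \<in> X \<Longrightarrow> length xs = length Gs \<Longrightarrow> computes os p xs (F os xs)"
    using assms(1) unfolding rel_computable_def by blast
  have "\<forall>G\<in>set Gs. \<exists>q. \<forall>os\<in>X. \<forall>xs. length xs = k \<longrightarrow> computes os q xs (G os xs)"
    using assms(2) unfolding rel_computable_def by blast
  then obtain q where q: "\<And>G os xs. G \<in> set Gs \<Longrightarrow> os \<in> X \<Longrightarrow> length xs = k \<Longrightarrow> computes os (q G) xs (G os xs)"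
    by metis
  have "computes os (Comp p (map q Gs)) xs (F os (map (\<lambda>G. G os xs) Gs))"
    if "os \<in> X" "length xs = k" for os xs
    using that by (intro computes.comp[where ys = "map (\<lambda>G. G os xs) Gs"] p)
      (auto simp: list_all2_conv_all_nth intro!: q)
  thus ?thesis unfolding rel_computable_def by blast
qed

lemma rel_computable_comp1:
  assumes "rel_computable X 1 F" "rel_computable X k N"
  shows "rel_computable X k (\<lambda>os xs. F os [N os xs])"
  using rel_computable_comp[of X "[N]" F k] assms by simp

lemma rel_computable_zero: "rel_computable X k (\<lambda>os xs. 0)"
  unfolding rel_computable_def by (metis computes.zero)

lemma rel_computable_Suc:
  assumes "rel_computable X k F" shows "rel_computable X k (\<lambda>os xs. Suc (F os xs))"
proof -
  have "rel_computable X 1 (\<lambda>os xs. Suc (hd xs))"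
    unfolding rel_computable_def
    by (intro exI[of _ Succ]) (auto simp: length_Suc_conv intro: computes.succ)
  from rel_computable_comp1[OF this assms(1)] show ?thesis by simp
qed

lemma rel_computable_query:
  assumes "rel_computable X k F" "\<And>os. os \<in> X \<Longrightarrow> i < length os"
  shows "rel_computable X k (\<lambda>os xs. (os ! i) (F os xs))"
proof -
  have "rel_computable X 1 (\<lambda>os xs. (os ! i) (hd xs))"
    unfolding rel_computable_def
    by (intro exI[of _ "Query i"]) (auto simp: length_Suc_conv intro!: computes.query assms(2))
  from rel_computable_comp1[OF this assms(1)] show ?thesis by simp
qed

text \<open>\<open>PrimRec\<close> and \<open>Mini\<close> prepend their own variables to the
  argument list. This lets a function of the original parameters be used inside such a recursion or
  search.\<close>

lemma rel_computable_drop: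
  assumes "rel_computable X k F"
  shows "rel_computable X (m + k) (\<lambda>os xs. F os (drop m xs))"
proof -
  define Gs where "Gs = map (\<lambda>i. \<lambda>(os :: (nat \<Rightarrow> nat) list) xs :: nat list. xs ! (m + i)) [0..<k]"
  have "rel_computable X (m + k) (\<lambda>os xs. F os (map (\<lambda>G. G os xs) Gs))"
    by (rule rel_computable_comp) (auto simp: Gs_def assms intro: rel_computable_proj)
  thus ?thesis
  proof (rule rel_computable_cong)
    fix os :: "(nat \<Rightarrow> nat) list" and xs :: "nat list" assume "length xs = m + k"
    hence "map (\<lambda>G. G os xs) Gs = drop m xs"
      by (intro nth_equalityI) (auto simp: Gs_def)
    thus "F os (map (\<lambda>G. G os xs) Gs) = F os (drop m xs)" by simp
  qed
qed

lemma rel_computable_subst: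
  assumes "rel_computable X (Suc k) F" "rel_computable X k N"
  shows "rel_computable X k (\<lambda>os xs. F os (N os xs # xs))"
proof -
  define Gs where "Gs = N # map (\<lambda>i. \<lambda>(os :: (nat \<Rightarrow> nat) list) xs :: nat list. xs ! i) [0..<k]"
  have "rel_computable X k (\<lambda>os xs. F os (map (\<lambda>G. G os xs) Gs))"
    by (rule rel_computable_comp) (auto simp: Gs_def assms intro: rel_computable_proj)
  thus ?thesis
  proof (rule rel_computable_cong)
    fix os :: "(nat \<Rightarrow> nat) list" and xs :: "nat list" assume "length xs = k"
    hence "map (\<lambda>G. G os xs) Gs = N os xs # xs"
      by (intro nth_equalityI) (auto simp: Gs_def nth_Cons split: nat.splits)
    thus "F os (map (\<lambda>G. G os xs) Gs) = F os (N os xs # xs)" by simp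
  qed
qed

lemma rel_computable_primrec:
  assumes "rel_computable X k F" "rel_computable X (Suc (Suc k)) G" "rel_computable X k N"
  shows "rel_computable X k (\<lambda>os xs. rec_nat (F os xs) (\<lambda>n y. G os (n # y # xs)) (N os xs))"
proof -
  obtain p where p: "\<And>os xs. os \<in> X \<Longrightarrow> length xs = k \<Longrightarrow> computes os p xs (F os xs)"
    using assms(1) unfolding rel_computable_def by blast
  obtain q where q: "\<And>os xs. os \<in> X \<Longrightarrow> length xs = Suc (Suc k) \<Longrightarrow> computes os q xs (G os xs)"
    using assms(2) unfolding rel_computable_def by blast
  have "computes os (PrimRec p q) (n # xs) (rec_nat (F os xs) (\<lambda>n y. G os (n # y # xs)) n)"
    if "os \<in> X" "length xs = k" for os xs n
    using that by (induction n) (auto intro!: computes.intros p q)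
  hence "rel_computable X (Suc k) (\<lambda>os xs. rec_nat (F os (tl xs)) (\<lambda>n y. G os (n # y # tl xs)) (hd xs))"
    unfolding rel_computable_def by (intro exI[of _ "PrimRec p q"]) (auto simp: length_Suc_conv)
  from rel_computable_subst[OF this assms(3)] show ?thesis by simp
qed

text \<open>Unbounded search halts only where a zero exists, and existence is asked only for oracles
  in \<open>X\<close>. This is why computability is relative to a set of oracles: the search used
  for inverting a real stops only because the oracle names a positive number.\<close>

lemma rel_computable_Least:
  assumes "rel_computable X (Suc k) F"
    and "\<And>os xs. os \<in> X \<Longrightarrow> length xs = k \<Longrightarrow> \<exists>n. F os (n # xs) = 0"
  shows "rel_computable X k (\<lambda>os xs. LEAST n. F os (n # xs) = 0)"
proof -
  obtain p where p: "\<And>os xs. os \<in> X \<Longrightarrow> length xs = Suc k \<Longrightarrow> computes os p xs (F os xs)"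
    using assms(1) unfolding rel_computable_def by blast
  have "computes os (Mini p) xs (LEAST n. F os (n # xs) = 0)" if *: "os \<in> X" "length xs = k" for os xs
  proof (rule computes.mini)
    let ?n = "LEAST n. F os (n # xs) = 0"
    have "F os (?n # xs) = 0" using assms(2)[OF *] by (rule LeastI_ex)
    thus "computes os p (?n # xs) 0" using p[of os "?n # xs"] * by simp
    show "\<forall>m<?n. \<exists>j. computes os p (m # xs) (Suc j)"
    proof (intro allI impI)
      fix m assume "m < ?n"
      hence "F os (m # xs) \<noteq> 0" by (rule not_less_Least)
      then obtain j where "F os (m # xs) = Suc j" using not0_implies_Suc by blast
      thus "\<exists>j. computes os p (m # xs) (Suc j)" using p[of os "m # xs"] * by auto
    qed
  qed
  thus ?thesis unfolding rel_computable_def by blast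
qed

lemma rel_computable_drop2:
  "rel_computable X k F \<Longrightarrow> rel_computable X (Suc (Suc k)) (\<lambda>os xs. F os (drop 2 xs))"
  using rel_computable_drop[of X k F 2] by simp

lemma rel_computable_add:
  assumes "rel_computable X k F" "rel_computable X k G"
  shows "rel_computable X k (\<lambda>os xs. F os xs + G os xs)"
proof -
  have "rec_nat a (\<lambda>n. Suc) b = a + b" for a b :: nat by (induction b) auto
  thus ?thesis
    using rel_computable_primrec[OF assms(1) rel_computable_Suc[OF rel_computable_proj[of 1]] assms(2)]
    by simp
qed

lemma rel_computable_mult:
  assumes "rel_computable X k F" "rel_computable X k G"
  shows "rel_computable X k (\<lambda>os xs. F os xs * G os xs)"
proof -
  have "rec_nat 0 (\<lambda>n y. y + a) b = a * b" for a b :: nat by (induction b) auto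
  thus ?thesis
    using rel_computable_primrec[OF rel_computable_zero
        rel_computable_add[OF rel_computable_proj[of 1] rel_computable_drop2[OF assms(1)]] assms(2)]
    by simp
qed

lemma rel_computable_diff:
  assumes "rel_computable X k F" "rel_computable X k G"
  shows "rel_computable X k (\<lambda>os xs. F os xs - G os xs)"
proof -
  have pred: "rel_computable X k (\<lambda>os xs. H os xs - 1)" if "rel_computable X k H" for H k
  proof -
    have "rec_nat 0 (\<lambda>n y. n) a = a - 1" for a :: nat by (cases a) auto
    thus ?thesis
      using rel_computable_primrec[OF rel_computable_zero rel_computable_proj[of 0] that] by simp
  qed
  have "rec_nat a (\<lambda>n y. y - 1) b = a - b" for a b :: nat by (induction b) auto
  thus ?thesis
    using rel_computable_primrec[OF assms(1) pred[OF rel_computable_proj[of 1]] assms(2)]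
    by simp
qed

lemma rel_computable_const: "rel_computable X k (\<lambda>os xs. c)"
  by (induction c) (auto intro: rel_computable_zero rel_computable_Suc)

lemma rel_computable_pow2:
  assumes "rel_computable X k F"
  shows "rel_computable X k (\<lambda>os xs. 2 ^ F os xs)"
proof -
  have "rec_nat 1 (\<lambda>n y. y + y) b = (2 ^ b :: nat)" for b :: nat by (induction b) auto
  thus ?thesis
    using rel_computable_primrec[OF rel_computable_const[of X k 1]
        rel_computable_add[OF rel_computable_proj[of 1] rel_computable_proj[of 1]] assms]
    by simp
qed

lemma rel_computable_drop1:
  "rel_computable X k F \<Longrightarrow> rel_computable X (Suc k) (\<lambda>os xs. F os (drop 1 xs))"
  using rel_computable_drop[of X k F 1] by simp

text \<open>The quotient is the least \<open>q\<close> with \<open>F < (q + 1) * G\<close>, and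
  truncated subtraction turns this inequality into a zero test, so the search operator
  applies.\<close>

lemma rel_computable_div:
  assumes "rel_computable X k F" "rel_computable X k G"
    and pos: "\<And>os xs. os \<in> X \<Longrightarrow> length xs = k \<Longrightarrow> G os xs > 0"
  shows "rel_computable X k (\<lambda>os xs. F os xs div G os xs)"
proof (rule rel_computable_cong)
  let ?T = "\<lambda>os (xs :: nat list). Suc (F os (drop 1 xs)) - Suc (xs ! 0) * G os (drop 1 xs)"
  have least: "Suc (a div b) * b \<ge> Suc a" "q \<ge> a div b" if "b > 0" "Suc a \<le> Suc q * b \<or> q = a div b" for a b q :: nat
  proof -
    show "Suc (a div b) * b \<ge> Suc a"
      using that by (metis Suc_leI dividend_less_div_times mult_Suc add.commute)
    show "q \<ge> a div b"
      using that by (metis Suc_le_eq less_Suc_eq_le less_mult_imp_div_less le_refl)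
  qed
  show "rel_computable X k (\<lambda>os xs. LEAST q. ?T os (q # xs) = 0)"
  proof (rule rel_computable_Least)
    show "rel_computable X (Suc k) ?T"
      by (intro rel_computable_diff rel_computable_mult rel_computable_Suc rel_computable_drop1
          assms rel_computable_proj) auto
    show "\<exists>n. ?T os (n # xs) = 0" if "os \<in> X" "length xs = k" for os xs
      using least(1)[OF pos[OF that], of "F os xs" "F os xs div G os xs"]
      by (intro exI[of _ "F os xs div G os xs"]) simp
  qed
  fix os :: "(nat \<Rightarrow> nat) list" and xs :: "nat list" assume *: "os \<in> X" "length xs = k"
  show "(LEAST q. ?T os (q # xs) = 0) = F os xs div G os xs"
    using least[OF pos[OF *]] by (intro Least_equality) (auto simp del: mult_Suc)
qed

text \<open>The oracle set consists of the genuine names of points of \<open>D\<close>; on all other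
  oracles the program may behave arbitrarily.\<close>

lemma computable_real_funI:
  assumes "rel_computable {os. \<exists>xs\<in>D. list_all2 dyadic_name os xs} 1 H"
    and "\<And>xs os. xs \<in> D \<Longrightarrow> list_all2 dyadic_name os xs \<Longrightarrow> dyadic_name (\<lambda>n. H os [n]) (F xs)"
  shows "computable_real_fun D F"
proof -
  obtain p where "\<forall>os\<in>{os. \<exists>xs\<in>D. list_all2 dyadic_name os xs}. \<forall>ns. length ns = 1 \<longrightarrow> computes os p ns (H os ns)"
    using assms(1) unfolding rel_computable_def by blast
  thus ?thesis
    unfolding computable_real_fun_def using assms(2) by (intro exI[of _ p]) force
qed

text \<open>Since \<open>computes\<close> is deterministic, the outputs of the program form one
  function \<open>H\<close> of the oracles. The arithmetic can then be done with functions instead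
  of programs.\<close>

lemma computable_real_funD:
  assumes "computable_real_fun D F"
  shows "\<exists>H. rel_computable {os. \<exists>xs\<in>D. list_all2 dyadic_name os xs} 1 H \<and>
    (\<forall>xs\<in>D. \<forall>os. list_all2 dyadic_name os xs \<longrightarrow> dyadic_name (\<lambda>n. H os [n]) (F xs))"
proof -
  obtain p where p: "\<And>xs os. xs \<in> D \<Longrightarrow> list_all2 dyadic_name os xs \<Longrightarrow>
      (\<exists>h. dyadic_name h (F xs) \<and> (\<forall>n. computes os p [n] (h n)))"
    using assms unfolding computable_real_fun_def by blast
  define H where "H os ns = (THE y. computes os p ns y)" for os ns
  have H: "H os ns = y" if "computes os p ns y" for os ns y
    unfolding H_def using that computes_unique by blast
  show ?thesis
  proof (intro exI[of _ H] conjI ballI allI impI)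
    show "rel_computable {os. \<exists>xs\<in>D. list_all2 dyadic_name os xs} 1 H"
      unfolding rel_computable_def
    proof (intro exI[of _ p] ballI allI impI)
      fix os and ns :: "nat list" assume "os \<in> {os. \<exists>xs\<in>D. list_all2 dyadic_name os xs}" "length ns = 1"
      then obtain xs n where "xs \<in> D" "list_all2 dyadic_name os xs" "ns = [n]" by (auto simp: length_Suc_conv)
      thus "computes os p ns (H os ns)" using p H by metis
    qed
    fix xs os assume "xs \<in> D" "list_all2 dyadic_name os xs"
    then obtain h where h: "dyadic_name h (F xs)" "\<forall>n. computes os p [n] (h n)" using p by blast
    have "(\<lambda>n. H os [n]) = h" using h(2) H by blast
    thus "dyadic_name (\<lambda>n. H os [n]) (F xs)" using h by simp
  qed
qed

section \<open>Dyadic names and the field operations\<close>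

lemma round_div:
  fixes w e :: nat
  assumes "\<bar>y - real w / real e\<bar> \<le> 1 / 2" "e > 0"
  shows "\<bar>y - real ((2 * w + e) div (2 * e))\<bar> \<le> 1"
proof -
  define q where "q = (2 * w + e) div (2 * e)"
  have "q * (2 * e) \<le> 2 * w + e" unfolding q_def by simp
  hence 1: "real q * (2 * real e) \<le> 2 * real w + real e" 
    by (metis (mono_tags, opaque_lifting) of_nat_add of_nat_le_iff of_nat_mult of_nat_numeral)
  have "2 * w + e < Suc q * (2 * e)" unfolding q_def using assms(2)
    by (metis dividend_less_div_times mult_Suc add.commute nat_0_less_mult_iff zero_less_numeral)
  hence 2: "2 * real w + real e < (real q + 1) * (2 * real e)"
    by (metis (mono_tags, opaque_lifting) of_nat_Suc of_nat_add of_nat_less_iff of_nat_mult of_nat_numeral add.commute)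
  have "real q - 1/2 \<le> real w / real e" "real w / real e < real q + 1/2"
    using 1 2 assms(2) by (auto simp: field_simps)
  thus ?thesis using assms(1) unfolding q_def by linarith
qed

lemma dyadic_name_iff: "dyadic_name g x \<longleftrightarrow> (\<forall>n. \<bar>x * 2 ^ n - real (g n)\<bar> \<le> 1)"
proof -
  have "\<bar>x - real (g n) / 2 ^ n\<bar> \<le> 1 / 2 ^ n \<longleftrightarrow> \<bar>x * 2 ^ n - real (g n)\<bar> \<le> 1" for n
    by (simp add: abs_le_iff field_simps)
  thus ?thesis unfolding dyadic_name_def by simp
qed

text \<open>At precision \<open>n\<close> the scaled value may be missed by 1. Half of this is
  granted to the approximation \<open>w / e\<close>, the other half to rounding it to the nearest
  integer, which is what \<open>(2 * w + e) div (2 * e)\<close> computes.\<close>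

lemma dyadic_nameI:
  assumes "\<And>n. \<bar>x * 2 ^ n - real (w n) / real (e n)\<bar> \<le> 1 / 2" "\<And>n. e n > 0"
  shows "dyadic_name (\<lambda>n. (2 * w n + e n) div (2 * e n)) x"
  unfolding dyadic_name_iff using round_div[OF assms] by blast

lemma computable_real_fun_proj:
  assumes "\<And>xs. xs \<in> D \<Longrightarrow> i < length xs"
  shows "computable_real_fun D (\<lambda>xs. xs ! i)"
proof (rule computable_real_funI)
  show "rel_computable {os. \<exists>xs\<in>D. list_all2 dyadic_name os xs} 1 (\<lambda>os ns. (os ! i) (ns ! 0))"
    using assms by (intro rel_computable_query rel_computable_proj) (auto simp: list_all2_lengthD)
qed (use assms in \<open>auto simp: list_all2_conv_all_nth\<close>)

lemma computable_real_fun_const: "computable_real_fun D (\<lambda>xs. real c)"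
proof (rule computable_real_funI)
  show "rel_computable {os. \<exists>xs\<in>D. list_all2 dyadic_name os xs} 1 (\<lambda>os ns. c * 2 ^ (ns ! 0))"
    by (intro rel_computable_mult rel_computable_const rel_computable_pow2 rel_computable_proj) simp
qed (auto simp: dyadic_name_iff)

text \<open>Two extra binary digits in each argument suffice: two errors of at most 1 at scale 4 add
  up to 1/2. The \<open>max 0\<close> models truncated subtraction of naturals, which does not
  increase the error when the true difference is non-negative.\<close>

lemma quarter_approx:
  fixes x y u v :: real
  assumes "\<bar>x * 4 - u\<bar> \<le> 1" "\<bar>y * 4 - v\<bar> \<le> 1"
  shows "\<bar>x + y - (u + v) / 4\<bar> \<le> 1 / 2" and "y \<le> x \<Longrightarrow> \<bar>x - y - max 0 (u - v) / 4\<bar> \<le> 1 / 2"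
  using assms by (auto simp: abs_le_iff max_def field_simps)

lemma computable_real_fun_add:
  assumes "computable_real_fun D F" "computable_real_fun D G"
  shows "computable_real_fun D (\<lambda>xs. F xs + G xs)"
proof -
  let ?X = "{os. \<exists>xs\<in>D. list_all2 dyadic_name os xs}"
  obtain f where f: "rel_computable ?X 1 f"
    "\<forall>xs\<in>D. \<forall>os. list_all2 dyadic_name os xs \<longrightarrow> dyadic_name (\<lambda>n. f os [n]) (F xs)"
    using computable_real_funD[OF assms(1)] by blast
  obtain g where g: "rel_computable ?X 1 g"
    "\<forall>xs\<in>D. \<forall>os. list_all2 dyadic_name os xs \<longrightarrow> dyadic_name (\<lambda>n. g os [n]) (G xs)"
    using computable_real_funD[OF assms(2)] by blast
  define w where "w = (\<lambda>os ns. f os [ns ! 0 + 2] + g os [ns ! 0 + 2])"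
  show ?thesis
  proof (rule computable_real_funI)
    have shift: "rel_computable ?X 1 (\<lambda>os ns. h os [ns ! 0 + 2])" if "rel_computable ?X 1 h" for h
      by (intro rel_computable_comp1[OF that] rel_computable_add rel_computable_proj rel_computable_const) simp
    show "rel_computable ?X 1 (\<lambda>os ns. (2 * w os ns + 4) div (2 * 4))"
      unfolding w_def
      by (intro rel_computable_div rel_computable_add rel_computable_mult rel_computable_const shift f g) auto
    fix xs os assume *: "xs \<in> D" "list_all2 dyadic_name os xs"
    show "dyadic_name (\<lambda>n. (2 * w os [n] + 4) div (2 * 4)) (F xs + G xs)"
    proof (rule dyadic_nameI)
      fix n
      have "\<bar>F xs * 2 ^ (n + 2) - real (f os [n + 2])\<bar> \<le> 1" "\<bar>G xs * 2 ^ (n + 2) - real (g os [n + 2])\<bar> \<le> 1"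
        using f(2)[rule_format, OF *] g(2)[rule_format, OF *] unfolding dyadic_name_iff by blast+
      moreover define x y where "x = F xs * 2 ^ n" and "y = G xs * 2 ^ n"
      ultimately have "\<bar>x * 4 - real (f os [n + 2])\<bar> \<le> 1" "\<bar>y * 4 - real (g os [n + 2])\<bar> \<le> 1"
        by (simp_all add: power_add mult.assoc)
      hence "\<bar>x + y - (real (f os [n + 2]) + real (g os [n + 2])) / 4\<bar> \<le> 1 / 2"
        by (rule quarter_approx)
      thus "\<bar>(F xs + G xs) * 2 ^ n - real (w os [n]) / real 4\<bar> \<le> 1 / 2"
        by (simp add: w_def x_def y_def distrib_right)
    qed simp
  qed
qed

lemma computable_real_fun_diff:
  assumes "computable_real_fun D F" "computable_real_fun D G" "\<And>xs. xs \<in> D \<Longrightarrow> G xs \<le> F xs"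
  shows "computable_real_fun D (\<lambda>xs. F xs - G xs)"
proof -
  let ?X = "{os. \<exists>xs\<in>D. list_all2 dyadic_name os xs}"
  obtain f where f: "rel_computable ?X 1 f"
    "\<forall>xs\<in>D. \<forall>os. list_all2 dyadic_name os xs \<longrightarrow> dyadic_name (\<lambda>n. f os [n]) (F xs)"
    using computable_real_funD[OF assms(1)] by blast
  obtain g where g: "rel_computable ?X 1 g"
    "\<forall>xs\<in>D. \<forall>os. list_all2 dyadic_name os xs \<longrightarrow> dyadic_name (\<lambda>n. g os [n]) (G xs)"
    using computable_real_funD[OF assms(2)] by blast
  define w where "w = (\<lambda>os ns. f os [ns ! 0 + 2] - g os [ns ! 0 + 2])"
  show ?thesis
  proof (rule computable_real_funI)
    have shift: "rel_computable ?X 1 (\<lambda>os ns. h os [ns ! 0 + 2])" if "rel_computable ?X 1 h" for h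
      by (intro rel_computable_comp1[OF that] rel_computable_add rel_computable_proj rel_computable_const) simp
    show "rel_computable ?X 1 (\<lambda>os ns. (2 * w os ns + 4) div (2 * 4))"
      unfolding w_def
      by (intro rel_computable_div rel_computable_add rel_computable_diff rel_computable_mult
          rel_computable_const shift f g) auto
    fix xs os assume *: "xs \<in> D" "list_all2 dyadic_name os xs"
    show "dyadic_name (\<lambda>n. (2 * w os [n] + 4) div (2 * 4)) (F xs - G xs)"
    proof (rule dyadic_nameI)
      fix n
      define x y where "x = F xs * 2 ^ n" and "y = G xs * 2 ^ n"
      have "y \<le> x" unfolding x_def y_def using assms(3)[OF *(1)] by simp
      have "\<bar>F xs * 2 ^ (n + 2) - real (f os [n + 2])\<bar> \<le> 1" "\<bar>G xs * 2 ^ (n + 2) - real (g os [n + 2])\<bar> \<le> 1"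
        using f(2)[rule_format, OF *] g(2)[rule_format, OF *] unfolding dyadic_name_iff by blast+
      hence "\<bar>x * 4 - real (f os [n + 2])\<bar> \<le> 1" "\<bar>y * 4 - real (g os [n + 2])\<bar> \<le> 1"
        unfolding x_def y_def by (simp_all add: power_add mult.assoc)
      hence "\<bar>(x - y) - max 0 (real (f os [n + 2]) - real (g os [n + 2])) / 4\<bar> \<le> 1 / 2"
        using \<open>y \<le> x\<close> by (rule quarter_approx)
      moreover have "real (w os [n]) = max 0 (real (f os [n + 2]) - real (g os [n + 2]))"
        by (simp add: w_def of_nat_diff_if)
      ultimately have "\<bar>(x - y) - real (w os [n]) / 4\<bar> \<le> 1 / 2"
        by simp
      thus "\<bar>(F xs - G xs) * 2 ^ n - real (w os [n]) / real 4\<bar> \<le> 1 / 2"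
        by (simp add: x_def y_def algebra_simps)
    qed simp
  qed
qed

lemma computable_real_fun_mult:
  assumes "computable_real_fun D F" "computable_real_fun D G"
    and nonneg: "\<And>xs. xs \<in> D \<Longrightarrow> 0 \<le> F xs" "\<And>xs. xs \<in> D \<Longrightarrow> 0 \<le> G xs"
  shows "computable_real_fun D (\<lambda>xs. F xs * G xs)"
proof -
  let ?X = "{os. \<exists>xs\<in>D. list_all2 dyadic_name os xs}"
  obtain f where f: "rel_computable ?X 1 f"
    "\<forall>xs\<in>D. \<forall>os. list_all2 dyadic_name os xs \<longrightarrow> dyadic_name (\<lambda>n. f os [n]) (F xs)"
    using computable_real_funD[OF assms(1)] by blast
  obtain g where g: "rel_computable ?X 1 g"
    "\<forall>xs\<in>D. \<forall>os. list_all2 dyadic_name os xs \<longrightarrow> dyadic_name (\<lambda>n. g os [n]) (G xs)"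
    using computable_real_funD[OF assms(2)] by blast
  \<comment> \<open>The approximations at precision 0 bound \<open>F xs + G xs + 3\<close> by
    \<open>K - 1\<close>, once the two errors are counted, minus the 2 they cost; this yields
    \<open>2 * (x + y + 1) \<le> 2 ^ k\<close>. Reading both factors at precision
    \<open>n + K\<close> then makes the error of the product at scale \<open>2 ^ n\<close> at most
    1/2.\<close>
  define K where "K = (\<lambda>os. f os [0] + g os [0] + 4)"
  define w where "w = (\<lambda>os ns. f os [ns ! 0 + K os] * g os [ns ! 0 + K os])"
  define e :: "(nat \<Rightarrow> nat) list \<Rightarrow> nat list \<Rightarrow> nat" where "e = (\<lambda>os ns. 2 ^ (ns ! 0 + (K os + K os)))"
  show ?thesis
  proof (rule computable_real_funI)
    note comp = rel_computable_comp1[OF f(1)] rel_computable_comp1[OF g(1)]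
    have K: "rel_computable ?X 1 (\<lambda>os ns. K os)"
      unfolding K_def by (intro rel_computable_add rel_computable_const comp)
    show "rel_computable ?X 1 (\<lambda>os ns. (2 * w os ns + e os ns) div (2 * e os ns))"
      unfolding w_def e_def
      by (intro rel_computable_div rel_computable_add rel_computable_mult rel_computable_pow2
          rel_computable_const comp K rel_computable_proj) auto
    fix xs os assume *: "xs \<in> D" "list_all2 dyadic_name os xs"
    show "dyadic_name (\<lambda>n. (2 * w os [n] + e os [n]) div (2 * e os [n])) (F xs * G xs)"
    proof (rule dyadic_nameI)
      fix n
      define k N where "k = K os" and "N = n + k"
      define x y u v where "x = F xs" "y = G xs" "u = real (f os [N])" "v = real (g os [N])"
      have name: "\<bar>x * 2 ^ m - real (f os [m])\<bar> \<le> 1" "\<bar>y * 2 ^ m - real (g os [m])\<bar> \<le> 1" for m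
        using f(2)[rule_format, OF *] g(2)[rule_format, OF *] unfolding dyadic_name_iff x_y_u_v_def by blast+
      have xy: "x \<ge> 0" "y \<ge> 0" using nonneg[OF *(1)] by (auto simp: x_y_u_v_def)
      have "k \<ge> 1" by (simp add: k_def K_def)
      have "x + y + 1 \<le> real (k - 1)"
        using name[of 0] unfolding k_def K_def by (auto simp: abs_le_iff)
      also have "\<dots> \<le> 2 ^ (k - 1)" using of_nat_less_two_power[of "k - 1", where 'a=real] by simp
      finally have sum_le: "2 * (x + y + 1) \<le> 2 ^ k"
        using power_Suc[of "2::real" "k - 1"] \<open>k \<ge> 1\<close> by simp
      have u: "\<bar>x * 2 ^ N - u\<bar> \<le> 1" and v: "\<bar>y * 2 ^ N - v\<bar> \<le> 1"
        using name[of N] by (auto simp: x_y_u_v_def)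
      have "v \<ge> 0" by (simp add: x_y_u_v_def)
      have "(x * 2 ^ N) * (y * 2 ^ N) - u * v = (x * 2 ^ N) * (y * 2 ^ N - v) + v * (x * 2 ^ N - u)"
        by (simp add: algebra_simps)
      also have "\<bar>\<dots>\<bar> \<le> (x * 2 ^ N) * 1 + v * 1"
        using u v xy abs_triangle_ineq[of "(x * 2 ^ N) * (y * 2 ^ N - v)" "v * (x * 2 ^ N - u)"]
          mult_left_mono[of "\<bar>y * 2 ^ N - v\<bar>" 1 "x * 2 ^ N"] mult_left_mono[of "\<bar>x * 2 ^ N - u\<bar>" 1 v] \<open>v \<ge> 0\<close>
        by (simp add: abs_mult)
      also have "\<dots> \<le> x * 2 ^ N + (y * 2 ^ N + 1)" using v by simp
      also have "\<dots> \<le> (x + y + 1) * 2 ^ N" by (simp add: algebra_simps)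
      also have "\<dots> \<le> (2 ^ k / 2) * 2 ^ N" using sum_le by (intro mult_right_mono) auto
      finally have main: "\<bar>(x * 2 ^ N) * (y * 2 ^ N) - u * v\<bar> \<le> (2 ^ k / 2) * 2 ^ N" .
      have "\<bar>x * y * 2 ^ n - u * v / 2 ^ (n + (k + k))\<bar> = \<bar>((x * 2 ^ N) * (y * 2 ^ N) - u * v) / 2 ^ (n + (k + k))\<bar>"
        by (rule arg_cong[of _ _ abs]) (simp add: N_def power_add field_simps)
      also have "\<dots> \<le> (2 ^ k / 2) * 2 ^ N / 2 ^ (n + (k + k))"
        by (subst abs_divide, subst abs_of_pos[of "2 ^ (n + (k + k))"]) (rule zero_less_power, simp, rule divide_right_mono[OF main], simp)
      also have "\<dots> \<le> 1 / 2" by (simp add: N_def power_add)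
      finally show "\<bar>F xs * G xs * 2 ^ n - real (w os [n]) / real (e os [n])\<bar> \<le> 1 / 2"
        by (simp add: x_y_u_v_def w_def e_def k_def N_def)
    qed (simp add: e_def)
  qed
qed

text \<open>No fixed precision separates a positive real from 0, so the precision is searched for:
  the first \<open>m\<close> with approximation at least 3 gives
  \<open>F xs * 2 ^ m \<ge> 2\<close>. At precision \<open>n + 2 * m\<close> the error of the
  reciprocal at scale \<open>2 ^ n\<close> is at most \<open>2 / (F xs * 2 ^ m) ^ 2\<close>, hence
  at most 1/2.\<close>

lemma computable_real_fun_inverse:
  assumes "computable_real_fun D F" and pos: "\<And>xs. xs \<in> D \<Longrightarrow> 0 < F xs"
  shows "computable_real_fun D (\<lambda>xs. inverse (F xs))"
proof -
  let ?X = "{os. \<exists>xs\<in>D. list_all2 dyadic_name os xs}"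
  obtain f where f: "rel_computable ?X 1 f"
    "\<forall>xs\<in>D. \<forall>os. list_all2 dyadic_name os xs \<longrightarrow> dyadic_name (\<lambda>n. f os [n]) (F xs)"
    using computable_real_funD[OF assms(1)] by blast
  define m where "m = (\<lambda>os. LEAST m. 3 - f os [m] = 0)"
  define e where "e = (\<lambda>os ns. f os [ns ! 0 + 2 * m os])"
  define w :: "(nat \<Rightarrow> nat) list \<Rightarrow> nat list \<Rightarrow> nat" where "w = (\<lambda>os ns. 2 ^ (ns ! 0 + 2 * m os) * 2 ^ (ns ! 0))"
  have ex_m: "3 - f os [m os] = 0" and ex: "\<exists>m. 3 - f os [m] = 0" if *: "xs \<in> D" "list_all2 dyadic_name os xs" for os xs
  proof -
    have "\<exists>m. 4 < F xs * 2 ^ m"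
      using real_arch_pow[of 2 "4 / F xs"] pos[OF *(1)] by (auto simp: field_simps)
    then obtain m' where "4 < F xs * 2 ^ m'" by blast
    moreover have "\<bar>F xs * 2 ^ m' - real (f os [m'])\<bar> \<le> 1" using f(2)[rule_format, OF *] unfolding dyadic_name_iff by blast
    ultimately have "3 - f os [m'] = 0" by (simp add: abs_le_iff)
    thus "\<exists>m. 3 - f os [m] = 0" by blast
    thus "3 - f os [m os] = 0" unfolding m_def by (rule LeastI_ex)
  qed
  have e_pos: "e os [n] > 0" and
    main: "\<bar>inverse (F xs) * 2 ^ n - real (w os [n]) / real (e os [n])\<bar> \<le> 1 / 2"
    if *: "xs \<in> D" "list_all2 dyadic_name os xs" for os xs n
  proof -
    define x k N where "x = F xs" and "k = m os" and "N = n + 2 * k"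
    have x: "x > 0" using pos[OF *(1)] by (simp add: x_def)
    have name: "\<bar>x * 2 ^ j - real (f os [j])\<bar> \<le> 1" for j
      using f(2)[rule_format, OF *] unfolding dyadic_name_iff x_def by blast
    have "real (f os [k]) \<ge> 3" using ex_m[OF *] by (simp add: k_def)
    hence xk: "x * 2 ^ k \<ge> 2" using name[of k] by (simp add: abs_le_iff)
    have "x * 2 ^ N = (x * 2 ^ k) * 2 ^ (n + k)" by (simp add: N_def power_add power2_eq_square mult_2)
    also have "\<dots> \<ge> 2 * 1" using xk by (intro mult_mono) auto
    finally have xN: "x * 2 ^ N \<ge> 2" by simp
    define u where "u = real (f os [N])"
    have u: "\<bar>x * 2 ^ N - u\<bar> \<le> 1" "u \<ge> x * 2 ^ N / 2" "u > 0"
      using name[of N] xN by (auto simp: u_def abs_le_iff)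
    thus "e os [n] > 0" by (simp add: e_def u_def N_def k_def)
    have "inverse x * 2 ^ n - 2 ^ N * 2 ^ n / u = 2 ^ n * (u - x * 2 ^ N) / (x * u)"
      using x u by (simp add: field_simps)
    also have "\<bar>\<dots>\<bar> \<le> 2 ^ n * 1 / (x * (x * 2 ^ N / 2))"
      unfolding abs_divide abs_mult using x u
      by (intro frac_le mult_mono) (auto simp: abs_minus_commute)
    also have "\<dots> = 2 / (x * 2 ^ k) ^ 2"
    proof -
      have "c * 1 / (x * (x * (c * z ^ 2) / 2)) = 2 / (x * z) ^ 2" if "c > 0" "z > 0" for c z :: real
        using that x by (simp add: power2_eq_square field_simps)
      from this[of "2 ^ n" "2 ^ k"] show ?thesis by (simp add: N_def power_add power_even_eq)
    qed
    also have "\<dots> \<le> 2 / 2 ^ 2" using xk by (intro divide_left_mono power_mono) auto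
    finally show "\<bar>inverse (F xs) * 2 ^ n - real (w os [n]) / real (e os [n])\<bar> \<le> 1 / 2"
      by (simp add: w_def e_def u_def N_def k_def x_def)
  qed
  show ?thesis
  proof (rule computable_real_funI)
    have comp: "rel_computable ?X 1 (\<lambda>os ns. f os [N os ns])" if "rel_computable ?X 1 N" for N
      using f(1) that by (rule rel_computable_comp1)
    have "rel_computable ?X 2 (\<lambda>os ns. f os [ns ! 0])"
      by (intro rel_computable_comp1[OF f(1)] rel_computable_proj) simp
    hence "rel_computable ?X (Suc 1) (\<lambda>os ns. 3 - f os [ns ! 0])"
      by (intro rel_computable_diff rel_computable_const) (simp add: numeral_2_eq_2)
    from rel_computable_Least[OF this] ex have m: "rel_computable ?X 1 (\<lambda>os ns. m os)"
      unfolding m_def by auto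
    have "e os ns > 0" if "os \<in> ?X" "length ns = 1" for os ns
      using that e_pos by (auto simp: length_Suc_conv)
    moreover have "rel_computable ?X 1 e" "rel_computable ?X 1 w"
      unfolding w_def e_def
      by (intro rel_computable_add rel_computable_mult rel_computable_pow2
          rel_computable_const comp m rel_computable_proj; simp)+
    ultimately show "rel_computable ?X 1 (\<lambda>os ns. (2 * w os ns + e os ns) div (2 * e os ns))"
      by (intro rel_computable_div rel_computable_add rel_computable_mult rel_computable_const) auto
    fix xs os assume *: "xs \<in> D" "list_all2 dyadic_name os xs"
    show "dyadic_name (\<lambda>n. (2 * w os [n] + e os [n]) div (2 * e os [n])) (inverse (F xs))"
      by (rule dyadic_nameI) (use main[OF *] e_pos[OF *] in auto)
  qed
qed

lemma computable_real_fun_power: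
  assumes "computable_real_fun D F" "\<And>xs. xs \<in> D \<Longrightarrow> 0 \<le> F xs"
  shows "computable_real_fun D (\<lambda>xs. F xs ^ n)"
proof (induction n)
  case 0
  show ?case using computable_real_fun_const[of D 1] by simp
next
  case (Suc n)
  thus ?case using assms by (simp add: computable_real_fun_mult)
qed

section \<open>Integral elements\<close>

interpretation int_module: module "\<lambda>(k::int) (x::complex). of_int k * x"
  by unfold_locales (auto simp: algebra_simps)

interpretation rat_space: vector_space "\<lambda>(q::rat) (x::complex). of_rat q * x"
  by (rule vector_space_rat_complex)

interpretation rat_pair: vector_space_pair "\<lambda>(q::rat) (x::complex). of_rat q * x" "\<lambda>(q::rat) (x::rat). q * x"
  by unfold_locales (auto simp: algebra_simps)

text \<open>Integrality over the integers, by a faithful finitely generated module stable under the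
  element.\<close>

definition integral_elt :: "complex \<Rightarrow> bool" where
  "integral_elt z \<longleftrightarrow> (\<exists>V. finite V \<and> 1 \<in> V \<and> (\<forall>v\<in>V. z * v \<in> int_module.span V))"

lemma int_span_mult_closed:
  assumes "\<And>v. v \<in> V \<Longrightarrow> z * v \<in> int_module.span W" "x \<in> int_module.span V"
  shows "z * x \<in> int_module.span W"
  using assms(2)
proof (induction rule: int_module.span_induct_alt)
  case base
  show ?case by (simp add: int_module.span_zero)
next
  case (step c x y)
  have "z * (of_int c * x + y) = of_int c * (z * x) + z * y" by (simp add: algebra_simps)
  thus ?case using step assms(1) by (simp add: int_module.span_add int_module.span_scale)
qed

text \<open>The products \<open>v * w\<close> generate a module on which the elements of
  \<open>C\<close> act through the factor \<open>v\<close> and the new element \<open>c\<close>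
  through the factor \<open>w\<close>. Sums and products of integral elements are then handled in
  one module.\<close>

lemma common_stable_module:
  assumes "finite C" "\<And>c. c \<in> C \<Longrightarrow> integral_elt c"
  shows "\<exists>V. finite V \<and> 1 \<in> V \<and> (\<forall>c\<in>C. \<forall>v\<in>V. c * v \<in> int_module.span V)"
  using assms
proof (induction C rule: finite_induct)
  case empty
  show ?case by (intro exI[of _ "{1}"]) auto
next
  case (insert c C)
  obtain V where V: "finite V" "1 \<in> V" "\<And>b v. b \<in> C \<Longrightarrow> v \<in> V \<Longrightarrow> b * v \<in> int_module.span V"
    using insert by blast
  obtain W where W: "finite W" "1 \<in> W" "\<And>v. v \<in> W \<Longrightarrow> c * v \<in> int_module.span W"
    using insert.prems[of c] unfolding integral_elt_def by blast
  define U where "U = (\<lambda>(v, w). v * w) ` (V \<times> W)"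
  have U: "v * w \<in> int_module.span U" "w * v \<in> int_module.span U" if "v \<in> V" "w \<in> W" for v w
    using that by (auto simp: U_def mult.commute[of w v] intro!: int_module.span_base)
  have 1: "b * v * w \<in> int_module.span U" if "b \<in> C" "v \<in> V" "w \<in> W" for b v w
  proof -
    have "w * (b * v) \<in> int_module.span U"
      by (rule int_span_mult_closed[OF _ V(3)[OF that(1,2)]])
        (rule U(2)[OF _ that(3)])
    thus ?thesis by (simp add: ac_simps)
  qed
  have 2: "c * (v * w) \<in> int_module.span U" if "v \<in> V" "w \<in> W" for v w
  proof -
    have "v * (c * w) \<in> int_module.span U"
      by (rule int_span_mult_closed[OF _ W(3)[OF that(2)]])
        (rule U(1)[OF that(1)])
    thus ?thesis by (simp add: ac_simps)
  qed
  show ?case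
  proof (intro exI[of _ U] conjI ballI)
    show "finite U" using V W by (simp add: U_def)
    show "1 \<in> U" using V(2) W(2) by (force simp: U_def image_iff)
    fix b u assume "b \<in> insert c C" "u \<in> U"
    thus "b * u \<in> int_module.span U" using 1 2 by (auto simp: U_def mult.assoc)
  qed
qed

lemma integral_elt_of_int: "integral_elt (of_int k)"
  unfolding integral_elt_def
  using int_module.span_scale[OF int_module.span_base[of 1 "{1}"], of k] by (intro exI[of _ "{1}"]) auto

lemma integral_elt_ops:
  assumes "integral_elt x" "integral_elt y"
  shows integral_elt_add: "integral_elt (x + y)"
    and integral_elt_mult: "integral_elt (x * y)"
proof -
  obtain V where V: "finite V" "1 \<in> V" "\<And>c v. c \<in> {x, y} \<Longrightarrow> v \<in> V \<Longrightarrow> c * v \<in> int_module.span V"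
    using common_stable_module[of "{x, y}"] assms by blast
  show "integral_elt (x + y)" unfolding integral_elt_def
    using V by (intro exI[of _ V]) (auto simp: distrib_right intro!: int_module.span_add)
  show "integral_elt (x * y)" unfolding integral_elt_def
  proof (intro exI[of _ V] conjI ballI V(1,2))
    fix v assume "v \<in> V"
    hence "x * (y * v) \<in> int_module.span V" by (intro int_span_mult_closed[OF V(3) V(3)]) auto
    thus "x * y * v \<in> int_module.span V" by (simp add: mult.assoc)
  qed
qed

lemma integral_elt_minus: "integral_elt x \<Longrightarrow> integral_elt (- x)"
  using integral_elt_mult[OF integral_elt_of_int[of "-1"]] by simp

lemma integral_elt_diff: "integral_elt x \<Longrightarrow> integral_elt y \<Longrightarrow> integral_elt (x - y)"
  using integral_elt_add[OF _ integral_elt_minus] by force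

lemma integral_elt_sum: "(\<And>i. i \<in> A \<Longrightarrow> integral_elt (f i)) \<Longrightarrow> integral_elt (sum f A)"
  using integral_elt_of_int[of 0]
  by (induction A rule: infinite_finite_induct) (auto intro: integral_elt_add)

lemma integral_elt_prod: "(\<And>i. i \<in> A \<Longrightarrow> integral_elt (f i)) \<Longrightarrow> integral_elt (prod f A)"
  using integral_elt_of_int[of 1]
  by (induction A rule: infinite_finite_induct) (auto intro: integral_elt_mult)

lemma integral_elt_power: "integral_elt x \<Longrightarrow> integral_elt (x ^ n)"
  using integral_elt_prod[of "{..<n}" "\<lambda>_. x"] by simp

section \<open>Integral rational numbers are integers\<close>

lemma common_denominator:
  fixes f :: "'a \<Rightarrow> rat"
  assumes "finite A"
  obtains N :: int where "N > 0" "\<And>a. a \<in> A \<Longrightarrow> of_int N * f a \<in> \<int>"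
proof
  define N where "N = (\<Prod>a\<in>A. snd (quotient_of (f a)))"
  show "N > 0" unfolding N_def by (intro prod_pos) (simp add: quotient_of_denom_pos')
  fix a assume "a \<in> A"
  hence "N = snd (quotient_of (f a)) * (\<Prod>b\<in>A - {a}. snd (quotient_of (f b)))"
    unfolding N_def using assms by (simp add: prod.remove)
  moreover have "f a = of_int (fst (quotient_of (f a))) / of_int (snd (quotient_of (f a)))"
    by (simp add: quotient_of_div)
  moreover have "snd (quotient_of (f a)) > 0" by (simp add: quotient_of_denom_pos')
  ultimately have "of_int N * f a = of_int (fst (quotient_of (f a)) * (\<Prod>b\<in>A - {a}. snd (quotient_of (f b))))"
    by (simp add: field_simps)
  thus "of_int N * f a \<in> \<int>" by (metis Ints_of_int)
qed

text \<open>If n is the denominator of q in lowest terms, every power of n divides N; for n \<ge> 2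
  this fails already for the N-th power, because 2^N > N.\<close>

lemma rat_powers_bounded_denominator:
  fixes q :: rat and N :: int
  assumes "N > 0" "\<And>k. of_int N * q ^ k \<in> \<int>"
  shows "q \<in> \<int>"
proof -
  obtain m n where mn: "quotient_of q = (m, n)" by force
  have n: "n > 0" "coprime m n" "q = of_int m / of_int n"
    using mn by (auto simp: quotient_of_denom_pos quotient_of_coprime quotient_of_div)
  have "n ^ k dvd N" for k
  proof -
    obtain j where "of_int N * q ^ k = of_int j" using assms(2)[of k] by (auto elim: Ints_cases)
    hence "of_int (N * m ^ k) = (of_int (j * n ^ k) :: rat)"
      using n by (simp add: power_divide field_simps)
    hence "N * m ^ k = j * n ^ k" by (simp only: of_int_eq_iff)
    hence "n ^ k dvd N * m ^ k" by simp
    moreover have "coprime (n ^ k) (m ^ k)" using n(2) by (simp add: coprime_commute)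
    ultimately show ?thesis by (simp add: coprime_dvd_mult_left_iff)
  qed
  hence le: "n ^ k \<le> N" for k using assms(1) by (simp add: zdvd_imp_le)
  have "n = 1"
  proof (rule ccontr)
    assume "n \<noteq> 1"
    hence "2 ^ nat N \<le> n ^ nat N" using n(1) by (intro power_mono) auto
    moreover have "N < 2 ^ nat N"
      using of_nat_less_two_power[of "nat N", where 'a=int] assms(1) by simp
    ultimately show False using le[of "nat N"] by linarith
  qed
  thus ?thesis using n(3) by simp
qed

text \<open>A rational-linear functional fixing 1 turns the finitely generated module containing all
  powers of the element into a set of rationals with bounded denominators.\<close>

lemma integral_elt_Rats_imp_Ints:
  assumes "integral_elt z" "z \<in> \<rat>"
  shows "z \<in> \<int>"
proof -
  obtain q where q: "z = of_rat q" using assms(2) by (auto elim: Rats_cases)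
  obtain V where V: "finite V" "1 \<in> V" "\<And>v. v \<in> V \<Longrightarrow> z * v \<in> int_module.span V"
    using assms(1) unfolding integral_elt_def by blast
  have pow: "z ^ k \<in> int_module.span V" for k
  proof (induction k)
    case (Suc k)
    thus ?case using int_span_mult_closed[OF V(3)] by simp
  qed (simp add: V int_module.span_base)
  have "rat_space.independent {1}"
    using rat_space.dependent_single[of 1] by simp
  from rat_pair.linear_independent_extend[OF this, of "\<lambda>_. 1"]
  obtain g where g: "Vector_Spaces.linear (\<lambda>(q::rat) (x::complex). of_rat q * x) (\<lambda>q x. q * x) g" "g 1 = 1" by auto
  interpret g: Vector_Spaces.linear "\<lambda>q x. of_rat q * x" "\<lambda>q x. q * x" g by (rule g(1))
  note g_scale = g.scale and g_add = g.add
  obtain N where N: "N > 0" "\<And>v. v \<in> V \<Longrightarrow> of_int N * g v \<in> \<int>"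
    using common_denominator[OF V(1)] by metis
  have "of_int N * g x \<in> \<int>" if "x \<in> int_module.span V" for x
    using that
  proof (induction rule: int_module.span_induct_alt)
    case base
    have "g 0 = 0" using g_scale[of 0 0] by simp
    thus ?case by simp
  next
    case (step c x y)
    have "g (of_int c * x) = of_int c * g x" using g_scale[of "of_int c" x] by simp
    hence "of_int N * g (of_int c * x + y) = of_int c * (of_int N * g x) + of_int N * g y"
      by (simp add: g_add algebra_simps)
    thus ?case using step N(2) by simp
  qed
  \<comment> \<open>As z is rational, its powers are rational multiples of 1, which the functional
    fixes.\<close>
  moreover have "g (z ^ k) = q ^ k" for k
    using g_scale[of "q ^ k" 1] g(2) by (simp add: q of_rat_power)
  ultimately have "q \<in> \<int>"
    using rat_powers_bounded_denominator[OF N(1)] pow by metis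
  thus ?thesis unfolding q by (auto elim!: Ints_cases)
qed

text \<open>Generators are the \<open>v * z ^ i\<close> with i < n and v from a module stable under
  all coefficients. Multiplication by z shifts i, and the monic equation folds \<open>z ^ n\<close>
  back into the lower powers.\<close>

lemma integral_elt_root:
  assumes "\<And>i. i < n \<Longrightarrow> integral_elt (c i)" "z ^ n = (\<Sum>i<n. c i * z ^ i)"
  shows "integral_elt z"
proof -
  have "n > 0" using assms(2) by (cases n) auto
  obtain V where V: "finite V" "1 \<in> V" "\<And>i v. i < n \<Longrightarrow> v \<in> V \<Longrightarrow> c i * v \<in> int_module.span V"
    using common_stable_module[of "c ` {..<n}"] assms(1) by (metis (no_types, lifting) finite_imageI finite_lessThan imageE imageI lessThan_iff)
  define W where "W = (\<lambda>(v, i). v * z ^ i) ` (V \<times> {..<n})"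
  have W: "v * z ^ i \<in> W" if "v \<in> V" "i < n" for v i using that by (force simp: W_def)
  show ?thesis
    unfolding integral_elt_def
  proof (intro exI[of _ W] conjI ballI)
    show "finite W" using V by (simp add: W_def)
    show "1 \<in> W" using W[OF V(2) \<open>n > 0\<close>] by simp
    fix w assume "w \<in> W"
    then obtain v i where w: "w = v * z ^ i" "v \<in> V" "i < n" by (auto simp: W_def)
    show "z * w \<in> int_module.span W"
    proof (cases "Suc i < n")
      case True
      moreover have "z * w = v * z ^ Suc i" by (simp add: w)
      ultimately show ?thesis using int_module.span_base[OF W[OF w(2)]] by metis
    next
      case False
      hence "z * w = v * z ^ n" using w by (cases "n = Suc i") (auto simp: ac_simps)
      also have "\<dots> = (\<Sum>j<n. z ^ j * (c j * v))"
        unfolding assms(2) by (simp add: sum_distrib_left ac_simps)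
      also have "\<dots> \<in> int_module.span W"
      proof (rule int_module.span_sum)
        fix j assume j: "j \<in> {..<n}"
        have "z ^ j * u \<in> int_module.span W" if "u \<in> V" for u
          using int_module.span_base[OF W[OF that, of j]] j by (subst mult.commute) simp
        thus "z ^ j * (c j * v) \<in> int_module.span W"
          using w j by (intro int_span_mult_closed[OF _ V(3)]) auto
      qed
      finally show ?thesis .
    qed
  qed
qed

text \<open>With a the leading coefficient and n the degree, multiplying the equation by a^(n-1)
  turns it into a monic equation for a z whose coefficients are still integral.\<close>

lemma integral_lead_coeff_mult_root:
  assumes "\<And>i. integral_elt (coeff p i)" "poly p z = 0" "p \<noteq> 0"
  shows "integral_elt (lead_coeff p * z)"
proof -
  define n where "n = degree p"
  define a where "a = lead_coeff p"
  have "n > 0"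
    using assms(2,3) unfolding n_def by (cases p) (auto split: if_splits)
  have "0 = a ^ (n - 1) * poly p z" using assms(2) by simp
  also have "poly p z = (\<Sum>i<n. coeff p i * z ^ i) + a * z ^ n"
    unfolding poly_altdef n_def a_def by (simp flip: lessThan_Suc_atMost)
  also have "a ^ (n - 1) * \<dots> = (\<Sum>i<n. a ^ (n - 1) * (coeff p i * z ^ i)) + a ^ (n - 1) * a * z ^ n"
    by (simp add: sum_distrib_left algebra_simps)
  also have "a ^ (n - 1) * a = a ^ n" using \<open>n > 0\<close> by (metis power_minus_mult)
  also have "(\<Sum>i<n. a ^ (n - 1) * (coeff p i * z ^ i)) = (\<Sum>i<n. (coeff p i * a ^ (n - 1 - i)) * (a * z) ^ i)"
  proof (rule sum.cong)
    fix i assume "i \<in> {..<n}"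
    hence "a ^ (n - 1) = a ^ (n - 1 - i) * a ^ i" by (simp flip: power_add)
    thus "a ^ (n - 1) * (coeff p i * z ^ i) = (coeff p i * a ^ (n - 1 - i)) * (a * z) ^ i"
      by (simp add: power_mult_distrib)
  qed simp
  finally have "(a * z) ^ n = (\<Sum>i<n. (- (coeff p i * a ^ (n - 1 - i))) * (a * z) ^ i)"
    by (simp add: power_mult_distrib sum_negf eq_neg_iff_add_eq_0 add.commute)
  moreover have "integral_elt a" using assms(1) by (simp add: a_def)
  ultimately show ?thesis
    using assms(1) unfolding a_def[symmetric]
    by (intro integral_elt_root[of n "\<lambda>i. - (coeff p i * a ^ (n - 1 - i))" "a * z"])
      (auto intro!: integral_elt_minus integral_elt_mult integral_elt_power)
qed

text \<open>With c the leading coefficient and k the degree of q, both c and c z are integral.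
  Removing the top term of q changes the product by c X^(k+1) - c z X^k, so integrality of the
  product survives and the degree drops.\<close>

lemma integral_coeffs_divide_root:
  assumes "\<And>i. integral_elt (coeff ([:-z, 1:] * q) i)"
  shows "integral_elt (coeff q i)"
  using assms
proof (induction "degree q" arbitrary: q rule: less_induct)
  case less
  have z0: "integral_elt 0" using integral_elt_of_int[of 0] by simp
  show ?case
  proof (cases "q = 0")
    case False
    define k c where "k = degree q" and "c = lead_coeff q"
    define p where "p = [:-z, 1:] * q"
    have p: "p \<noteq> 0" "lead_coeff p = c" "poly p z = 0"
      using False unfolding p_def c_def by (auto simp: lead_coeff_mult simp del: mult_pCons_left)
    have "integral_elt (c * z)"
      using integral_lead_coeff_mult_root[of p z] p less.prems by (simp add: p_def)
    moreover have c: "integral_elt c" using less.prems p(2) unfolding p_def by metis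
    ultimately have M: "integral_elt (coeff (monom c (Suc k) - monom (c * z) k) i)" for i
      using z0 by (auto simp: integral_elt_minus integral_elt_diff)
    hence *: "integral_elt (coeff ([:-z, 1:] * (q - monom c k)) i)" for i
    proof -
      have "[:-z, 1:] * (q - monom c k) = p - (monom c (Suc k) - monom (c * z) k)"
      proof -
        have "[:-z, 1:] * monom c k = monom c (Suc k) - monom (c * z) k"
          by (simp add: smult_monom monom_Suc minus_monom mult.commute)
        thus ?thesis by (simp only: p_def right_diff_distrib)
      qed
      thus ?thesis
        by (simp only: coeff_diff[of p]) (rule integral_elt_diff[OF less.prems[folded p_def] M])
    qed
    have "integral_elt (coeff (q - monom c k) i)"
    proof (cases "q - monom c k = 0")
      case True
      thus ?thesis using z0 by simp
    next
      case False
      have "degree (q - monom c k) < degree q"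
      proof (rule degree_less_if_less_eqI)
        show "degree (q - monom c k) \<le> degree q"
          unfolding k_def by (intro degree_diff_le) (auto simp: degree_monom_le)
      qed (use False in \<open>auto simp: c_def k_def\<close>)
      thus ?thesis by (rule less.hyps) (rule *)
    qed
    moreover have "integral_elt (coeff (monom c k) i)" using c z0 by (auto)
    ultimately have "integral_elt (coeff (q - monom c k) i + coeff (monom c k) i)" by (rule integral_elt_add)
    thus ?thesis by (simp only: coeff_diff diff_add_cancel)
  qed (simp add: z0)
qed

text \<open>The leading coefficient alone clears the denominator of the product of any part of the
  roots. The roots in \<open>M'\<close> are divided out one by one; up to sign, the constant
  coefficient of what remains is \<open>c * prod_mset M\<close>.\<close>

lemma integral_lead_coeff_mult_prod_roots:
  assumes "\<And>i. integral_elt (coeff (smult c (\<Prod>z\<in>#M + M'. [:-z, 1:])) i)"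
  shows "integral_elt (c * prod_mset M)"
proof -
  have "integral_elt (coeff (smult c (\<Prod>z\<in>#M. [:-z, 1:])) i)" for i
    using assms
  proof (induction M' arbitrary: i)
    case (add x M')
    show ?case
    proof (rule add.IH)
      fix i
      have eq: "smult c (\<Prod>z\<in>#M + add_mset x M'. [:-z, 1:]) = [:-x, 1:] * smult c (\<Prod>z\<in>#M + M'. [:-z, 1:])"
        by (simp del: mult_pCons_left add: ac_simps)
      show "integral_elt (coeff (smult c (\<Prod>z\<in>#M + M'. [:-z, 1:])) i)"
        by (rule integral_coeffs_divide_root[of x]) (use add.prems eq in metis)
    qed
  qed simp
  from this[of 0] have "integral_elt (c * poly (\<Prod>z\<in>#M. [:-z, 1:]) 0)" by (simp add: poly_0_coeff_0)
  moreover have "poly (\<Prod>z\<in>#M. [:-z, 1:]) 0 = (-1) ^ size M * prod_mset M"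
    by (induction M) auto
  ultimately have "integral_elt (c * ((-1) ^ size M * prod_mset M))" by simp
  moreover have "c * prod_mset M = of_int ((-1) ^ size M) * (c * ((-1) ^ size M * prod_mset M))"
    by (simp add: ac_simps flip: power_mult_distrib mult.assoc)
  ultimately show ?thesis using integral_elt_mult[OF integral_elt_of_int] by metis
qed

section \<open>Polynomials over subfields of the complex numbers\<close>

definition polys_over :: "complex set \<Rightarrow> complex poly set" where
  "polys_over F = {p. \<forall>i. coeff p i \<in> F}"

definition is_minpoly :: "complex set \<Rightarrow> complex poly \<Rightarrow> complex \<Rightarrow> bool" where
  "is_minpoly F g z \<longleftrightarrow> g \<in> polys_over F \<and> lead_coeff g = 1 \<and> poly g z = 0 \<and>
     (\<forall>p\<in>polys_over F. p \<noteq> 0 \<longrightarrow> poly p z = 0 \<longrightarrow> degree g \<le> degree p)"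

lemma polys_over_mono: "F \<subseteq> F' \<Longrightarrow> polys_over F \<subseteq> polys_over F'"
  by (auto simp: polys_over_def)

lemma monic_eq_prod_roots:
  "lead_coeff (p :: complex poly) = 1 \<Longrightarrow> p = (\<Prod>x\<in>#proots p. [:-x, 1:])"
  using complex_poly_decompose_multiset[of p] by simp

lemma poly_monic_eq_prod_roots:
  "lead_coeff (p :: complex poly) = 1 \<Longrightarrow> poly p z = (\<Prod>x\<in>#proots p. z - x)"
  by (subst monic_eq_prod_roots, assumption) (simp add: poly_prod_mset)

lemma proots_prod_linear: "proots (\<Prod>x\<in>#M. [:-x, 1:] :: complex poly) = M"
proof (induction M)
  case (add x M)
  have "(\<Prod>x\<in>#M. [:-x, 1:] :: complex poly) \<noteq> 0" by auto
  thus ?case using add by (simp add: proots_mult del: mult_pCons_left)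
qed simp

lemma prod_mset_diff_commute:
  fixes A B :: "complex multiset"
  shows "(\<Prod>x\<in>#A. \<Prod>y\<in>#B. x - y) = (-1) ^ (size A * size B) * (\<Prod>y\<in>#B. \<Prod>x\<in>#A. y - x)"
proof (induction A)
  case (add a A)
  have "(\<Prod>y\<in>#B. a - y) = (-1) ^ size B * (\<Prod>y\<in>#B. y - a)"
    by (induction B) (auto simp: algebra_simps)
  moreover have "(\<Prod>y\<in>#B. \<Prod>x\<in>#add_mset a A. y - x) = (\<Prod>y\<in>#B. y - a) * (\<Prod>y\<in>#B. \<Prod>x\<in>#A. y - x)"
    by (simp add: prod_mset.distrib)
  ultimately show ?case using add by (simp add: power_add)
qed simp

text \<open>Subfields are sets inside the complex numbers, not types, because the primitive element
  argument uses several at once: the rationals, Q(c), Q(a, b) and a finite-dimensional span. Closure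
  under \<open>inverse\<close> at 0 is consistent with \<open>inverse 0 = 0\<close>.\<close>

locale complex_subfield =
  fixes F :: "complex set"
  assumes one: "1 \<in> F"
    and diff: "x \<in> F \<Longrightarrow> y \<in> F \<Longrightarrow> x - y \<in> F"
    and mult: "x \<in> F \<Longrightarrow> y \<in> F \<Longrightarrow> x * y \<in> F"
    and inverse: "x \<in> F \<Longrightarrow> inverse x \<in> F"
begin

lemma zero: "0 \<in> F"
  using diff[OF one one] by simp

lemma uminus: "x \<in> F \<Longrightarrow> - x \<in> F"
  using diff[OF zero] by simp

lemma add: "x \<in> F \<Longrightarrow> y \<in> F \<Longrightarrow> x + y \<in> F"
  using diff[OF _ uminus] by force

lemma divide: "x \<in> F \<Longrightarrow> y \<in> F \<Longrightarrow> x / y \<in> F"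
  by (simp add: divide_inverse inverse mult)

lemma sum: "(\<And>i. i \<in> A \<Longrightarrow> f i \<in> F) \<Longrightarrow> sum f A \<in> F"
  by (induction A rule: infinite_finite_induct) (auto intro: add zero)

lemma power: "x \<in> F \<Longrightarrow> x ^ n \<in> F"
  by (induction n) (auto intro: one mult)

lemma of_nat: "of_nat n \<in> F"
  by (induction n) (auto intro: one add zero)

lemma of_int: "of_int n \<in> F"
  by (cases n) (auto intro: of_nat diff zero one uminus add)

lemma Rats_subset: "\<rat> \<subseteq> F"
proof
  fix x :: complex assume "x \<in> \<rat>"
  then obtain a b :: int where "x = of_int a / of_int b" by (metis Rats_cases')
  thus "x \<in> F" by (auto intro: divide of_int)
qed

lemma polys_zero: "0 \<in> polys_over F"
  by (simp add: polys_over_def zero)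

lemma polys_pCons: "pCons a p \<in> polys_over F \<longleftrightarrow> a \<in> F \<and> p \<in> polys_over F"
  by (auto simp: polys_over_def coeff_pCons split: nat.splits)

lemma polys_one: "1 \<in> polys_over F"
  by (simp add: one_pCons polys_pCons one polys_zero)

lemma polys_add: "p \<in> polys_over F \<Longrightarrow> q \<in> polys_over F \<Longrightarrow> p + q \<in> polys_over F"
  by (simp add: polys_over_def add)

lemma polys_diff: "p \<in> polys_over F \<Longrightarrow> q \<in> polys_over F \<Longrightarrow> p - q \<in> polys_over F"
  by (simp add: polys_over_def diff)

lemma polys_smult: "c \<in> F \<Longrightarrow> p \<in> polys_over F \<Longrightarrow> smult c p \<in> polys_over F"
  by (simp add: polys_over_def mult)

lemma polys_monom: "c \<in> F \<Longrightarrow> monom c n \<in> polys_over F"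
  by (simp add: polys_over_def zero)

lemma polys_mult: "p \<in> polys_over F \<Longrightarrow> q \<in> polys_over F \<Longrightarrow> p * q \<in> polys_over F"
  by (simp add: polys_over_def coeff_mult sum mult)

lemma polys_power: "p \<in> polys_over F \<Longrightarrow> p ^ n \<in> polys_over F"
  by (induction n) (auto intro: polys_one polys_mult)

lemma polys_sum: "(\<And>i. i \<in> A \<Longrightarrow> f i \<in> polys_over F) \<Longrightarrow> sum f A \<in> polys_over F"
  by (induction A rule: infinite_finite_induct) (auto intro: polys_add polys_zero)

lemma polys_pderiv: "p \<in> polys_over F \<Longrightarrow> pderiv p \<in> polys_over F"
  unfolding polys_over_def mem_Collect_eq coeff_pderiv using mult of_nat by blast

lemma polys_pcompose: "p \<in> polys_over F \<Longrightarrow> q \<in> polys_over F \<Longrightarrow> pcompose p q \<in> polys_over F"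
  by (induction p) (auto simp: pcompose_pCons polys_pCons polys_zero intro!: polys_add polys_mult)

lemma polys_eval: "p \<in> polys_over F \<Longrightarrow> x \<in> F \<Longrightarrow> poly p x \<in> F"
  by (induction p) (auto simp: polys_pCons zero intro!: add mult)

lemma polys_division:
  assumes g: "g \<in> polys_over F" "lead_coeff g = 1" and "p \<in> polys_over F"
  shows "\<exists>q\<in>polys_over F. \<exists>r\<in>polys_over F. p = q * g + r \<and> (r = 0 \<or> degree r < degree g)"
  using assms(3)
proof (induction "degree p" arbitrary: p rule: less_induct)
  case less
  show ?case
  proof (cases "p = 0 \<or> degree p < degree g")
    case True
    thus ?thesis using less.prems polys_zero by (intro bexI[of _ 0] bexI[of _ p]) auto
  next
    case False
    show ?thesis
    proof (cases "degree p = 0")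
      case True
      hence "degree g = 0" using False by simp
      hence "g = 1" using g(2) by (metis degree_eq_zeroE lead_coeff_pCons(2) one_pCons)
      thus ?thesis using less.prems polys_zero by (intro bexI[of _ p] bexI[of _ 0]) auto
    next
      case pos: False
      define m where "m = monom (lead_coeff p) (degree p - degree g)"
      have m: "m \<in> polys_over F" using less.prems by (auto simp: m_def polys_over_def zero)
      have deg_m: "degree (m * g) = degree p" and lc_m: "lead_coeff (m * g) = lead_coeff p"
      proof -
        have "m \<noteq> 0" "g \<noteq> 0" using False g(2) by (auto simp: m_def)
        thus "degree (m * g) = degree p" using False by (simp add: degree_mult_eq m_def degree_monom_eq)
        show "lead_coeff (m * g) = lead_coeff p"
          using g(2) False by (simp add: lead_coeff_mult m_def degree_monom_eq)
      qed
      hence "p - m * g = 0 \<or> degree (p - m * g) < degree p"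
        using degree_less_if_less_eqI[of "p - m * g" p] degree_diff_le[of p "degree p" "m * g"] by auto
      hence "degree (p - m * g) < degree p" using pos by auto
      moreover have "p - m * g \<in> polys_over F" using less.prems m g(1) by (intro polys_diff polys_mult)
      ultimately obtain q r where "q \<in> polys_over F" "r \<in> polys_over F" "p - m * g = q * g + r"
        "r = 0 \<or> degree r < degree g"
        using less.hyps by blast
      thus ?thesis using m by (intro bexI[of _ "m + q"] bexI[of _ r]) (auto simp: algebra_simps polys_add)
    qed
  qed
qed

lemma minpoly_exists:
  assumes "p \<in> polys_over F" "p \<noteq> 0" "poly p z = 0"
  shows "\<exists>g. is_minpoly F g z"
proof -
  define P where "P q \<longleftrightarrow> q \<in> polys_over F \<and> q \<noteq> 0 \<and> poly q z = 0" for q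
  obtain q where q: "P q" "\<And>r. P r \<Longrightarrow> degree q \<le> degree r"
    using ex_has_least_nat[of P p degree] assms unfolding P_def by blast
  define c where "c = inverse (lead_coeff q)"
  have "lead_coeff q \<in> F" using q(1) by (auto simp: P_def polys_over_def)
  hence "c \<in> F" "c \<noteq> 0" "c * lead_coeff q = 1" using q(1) by (auto simp: c_def P_def inverse)
  hence "is_minpoly F (smult c q) z"
    using q unfolding is_minpoly_def P_def by (auto simp: polys_smult)
  thus ?thesis ..
qed

lemma minpoly_degree_pos: "is_minpoly F g z \<Longrightarrow> degree g > 0"
  unfolding is_minpoly_def by (metis degree_eq_zeroE gr0I lead_coeff_pCons(2) one_pCons poly_1 zero_neq_one)

lemma minpoly_divides:
  assumes "is_minpoly F g z" "p \<in> polys_over F" "poly p z = 0"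
  shows "\<exists>q\<in>polys_over F. p = q * g"
proof -
  have g: "g \<in> polys_over F" "lead_coeff g = 1" "poly g z = 0"
    using assms(1) by (auto simp: is_minpoly_def)
  obtain q r where qr: "q \<in> polys_over F" "r \<in> polys_over F" "p = q * g + r" "r = 0 \<or> degree r < degree g"
    using polys_division[OF g(1,2) assms(2)] by blast
  have "poly r z = 0" using qr(3) assms(3) g(3) by simp
  hence "r = 0" using qr(2,4) assms(1) unfolding is_minpoly_def by (metis not_less)
  thus ?thesis using qr by auto
qed

text \<open>Write g = q h with h the minimal polynomial of w. By its degree q cannot vanish at z, so
  h does, and minimality of g forces q = 1.\<close>

lemma minpoly_conjugate:
  assumes "is_minpoly F g z" "poly g w = 0"
  shows "is_minpoly F g w"
proof -
  have g: "g \<in> polys_over F" "lead_coeff g = 1" "poly g z = 0" "g \<noteq> 0"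
    using assms(1) by (auto simp: is_minpoly_def)
  obtain h where h: "is_minpoly F h w" using minpoly_exists[OF g(1,4) assms(2)] by blast
  have h': "lead_coeff h = 1" "h \<in> polys_over F" using h by (auto simp: is_minpoly_def)
  obtain q where q: "q \<in> polys_over F" "g = q * h"
    using minpoly_divides[OF h g(1) assms(2)] by blast
  have qh: "q \<noteq> 0" "h \<noteq> 0" using g(4) q(2) by auto
  have "poly h z = 0"
  proof (rule ccontr)
    assume "poly h z \<noteq> 0"
    hence "poly q z = 0" using g(3) q(2) by simp
    hence "degree g \<le> degree q" using assms(1) q(1) qh by (auto simp: is_minpoly_def)
    thus False using q(2) qh minpoly_degree_pos[OF h] by (simp add: degree_mult_eq)
  qed
  hence "degree g \<le> degree h" using assms(1) h' qh by (auto simp: is_minpoly_def)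
  hence "degree q = 0" using q(2) qh by (simp add: degree_mult_eq)
  moreover have "lead_coeff q = 1" using g(2) h'(1) q(2) by (simp add: lead_coeff_mult)
  ultimately have "q = 1" by (metis degree_eq_zeroE lead_coeff_pCons(2) one_pCons)
  thus ?thesis using h q by simp
qed

lemma minpoly_same_zeros:
  assumes "is_minpoly F g z" "poly g w = 0" "p \<in> polys_over F" "poly p w = 0"
  shows "poly p z = 0"
  using minpoly_divides[OF minpoly_conjugate[OF assms(1,2)] assms(3,4)] assms(1)
  by (auto simp: is_minpoly_def)

lemma minpoly_rsquarefree:
  assumes "is_minpoly F g z"
  shows "rsquarefree g"
  unfolding rsquarefree_roots
proof safe
  fix w assume w: "poly g w = 0" "poly (pderiv g) w = 0"
  have "is_minpoly F g w" using assms w(1) by (rule minpoly_conjugate)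
  moreover have "g \<in> polys_over F" using assms by (simp add: is_minpoly_def)
  moreover have "degree (pderiv g) < degree g" "pderiv g \<noteq> 0"
    using minpoly_degree_pos[OF assms] by (auto simp: degree_pderiv pderiv_eq_0_iff)
  ultimately show False using w(2) polys_pderiv unfolding is_minpoly_def by (metis not_less)
qed

text \<open>Interpolation by peeling off one point: after subtracting p(s), the quotient by X - s
  again has values in F on the remaining points. It serves to recognise a polynomial as rational
  when its values at the natural numbers are norms.\<close>

lemma polys_if_values:
  assumes "infinite S" "S \<subseteq> F" "\<And>x. x \<in> S \<Longrightarrow> poly p x \<in> F"
  shows "p \<in> polys_over F"
  using assms
proof (induction "degree p" arbitrary: p S rule: less_induct)
  case less
  obtain s where s: "s \<in> S" using less.prems(1) by fastforce
  have "poly (p - [:poly p s:]) s = 0" by simp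
  then obtain q where q: "p - [:poly p s:] = [:-s, 1:] * q"
    by (metis dvdE poly_eq_0_iff_dvd)
  hence p: "p = [:-s, 1:] * q + [:poly p s:]" by (metis diff_add_cancel)
  have "q \<in> polys_over F"
  proof (cases "q = 0")
    case False
    have "degree ([:-s, 1:] * q) = Suc (degree q)"
      using False by (subst degree_mult_eq) auto
    hence "degree p = Suc (degree q)"
      by (subst p, subst degree_add_eq_left) auto
    hence "degree q < degree p" by simp
    moreover have "infinite (S - {s})" "S - {s} \<subseteq> F" using less.prems by auto
    moreover have "poly q x \<in> F" if "x \<in> S - {s}" for x
    proof -
      have "poly q x = (poly p x - poly p s) / (x - s)"
        using that by (subst p) (simp add: field_simps)
      thus ?thesis using that less.prems s by (auto intro!: divide diff)
    qed
    ultimately show ?thesis by (rule less.hyps)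
  qed (simp add: polys_zero)
  moreover have "s \<in> F" "poly p s \<in> F" using s less.prems by auto
  ultimately show ?case
    by (subst p) (intro polys_add polys_mult; simp add: polys_pCons polys_zero one uminus)
qed

text \<open>The norm of a polynomial expression in a root of \<open>g\<close> is computed in \<open>F\<close> by the Euclidean
  algorithm: by reciprocity the product over the roots of \<open>g\<close> becomes one over the roots of the
  remainder.\<close>

lemma prod_over_roots_in_field:
  assumes "g \<in> polys_over F" "lead_coeff g = 1" "p \<in> polys_over F"
  shows "(\<Prod>x\<in>#proots g. poly p x) \<in> F"
  using assms
proof (induction "degree g" arbitrary: g p rule: less_induct)
  case less
  note g = less.prems(1,2)
  obtain q r where qr: "q \<in> polys_over F" "r \<in> polys_over F" "p = q * g + r" "r = 0 \<or> degree r < degree g"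
    using polys_division[OF less.prems] by blast
  have g0: "g \<noteq> 0" using g by auto
  have eq: "(\<Prod>x\<in>#proots g. poly p x) = (\<Prod>x\<in>#proots g. poly r x)"
    using g0 by (intro arg_cong[of _ _ prod_mset] image_mset_cong) (simp add: qr(3))
  show ?case
  proof (cases "r = 0")
    case True
    thus ?thesis unfolding eq by (cases "proots g") (auto simp: one zero)
  next
    case False
    define c where "c = lead_coeff r"
    define r' where "r' = smult (inverse c) r"
    have c: "c \<in> F" "c \<noteq> 0" using False qr(2) by (auto simp: c_def polys_over_def)
    have r': "r' \<in> polys_over F" "lead_coeff r' = 1" "degree r' < degree g" "r = smult c r'"
      using c qr False by (auto simp: r'_def c_def polys_smult inverse)
    have "(\<Prod>x\<in>#proots g. poly r x) = c ^ size (proots g) * (\<Prod>x\<in>#proots g. poly r' x)"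
      unfolding r'(4) by (simp add: prod_mset.distrib)
    also have "(\<Prod>x\<in>#proots g. poly r' x) = (\<Prod>x\<in>#proots g. \<Prod>y\<in>#proots r'. x - y)"
      using r'(2) by (simp add: poly_monic_eq_prod_roots)
    also have "\<dots> = (-1) ^ (size (proots g) * size (proots r')) * (\<Prod>y\<in>#proots r'. poly g y)"
    proof -
      have "poly g = (\<lambda>y. \<Prod>x\<in>#proots g. y - x)"
        by (rule ext) (rule poly_monic_eq_prod_roots[OF g(2)])
      thus ?thesis by (subst prod_mset_diff_commute) simp
    qed
    finally have "(\<Prod>x\<in>#proots g. poly r x) = c ^ size (proots g) *
      ((-1) ^ (size (proots g) * size (proots r')) * (\<Prod>y\<in>#proots r'. poly g y))" .
    moreover have "(\<Prod>y\<in>#proots r'. poly g y) \<in> F"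
      using less.hyps[OF r'(3,1,2) g(1)] .
    ultimately show ?thesis unfolding eq using c by (auto intro!: mult power uminus one)
  qed
qed

text \<open>Every root of p has g as its minimal polynomial, so a factor g splits off as long as the
  degree is positive.\<close>

lemma monic_eq_minpoly_power:
  assumes "is_minpoly F g z" "p \<in> polys_over F" "lead_coeff p = 1" "\<And>x. poly p x = 0 \<Longrightarrow> poly g x = 0"
  shows "\<exists>e. p = g ^ e"
  using assms(2-)
proof (induction "degree p" arbitrary: p rule: less_induct)
  case less
  show ?case
  proof (cases "degree p = 0")
    case True
    hence "p = 1" using less.prems(2) by (metis degree_eq_zeroE lead_coeff_pCons(2) one_pCons)
    thus ?thesis by (intro exI[of _ 0]) simp
  next
    case False
    hence "\<not> constant (poly p)" by (simp add: constant_degree)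
    then obtain x where x: "poly p x = 0" using fundamental_theorem_of_algebra by blast
    obtain q where q: "q \<in> polys_over F" "p = q * g"
      using minpoly_divides[OF minpoly_conjugate[OF assms(1) less.prems(3)[OF x]] less.prems(1) x] by blast
    have "q \<noteq> 0" "g \<noteq> 0" using q(2) False by auto
    hence "degree q < degree p" using q(2) minpoly_degree_pos[OF assms(1)] by (simp add: degree_mult_eq)
    moreover have "lead_coeff q = 1"
      using q(2) less.prems(2) assms(1) by (auto simp: is_minpoly_def lead_coeff_mult)
    ultimately obtain e where "q = g ^ e" using less.hyps[of q] q less.prems(3) by auto
    thus ?thesis using q(2) by (intro exI[of _ "Suc e"]) (simp add: mult.commute)
  qed
qed

lemma inverse_eq_poly:
  assumes "is_minpoly F g z" "z \<noteq> 0"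
  shows "\<exists>p\<in>polys_over F. inverse z = poly p z"
proof -
  obtain c q where g: "g = pCons c q" by (cases g) auto
  have mp: "g \<in> polys_over F" "poly g z = 0" using assms(1) by (auto simp: is_minpoly_def)
  have cq: "c \<in> F" "q \<in> polys_over F" using mp(1) by (auto simp: g polys_pCons)
  have "c \<noteq> 0"
  proof
    assume "c = 0"
    hence "poly q z = 0" using mp(2) assms(2) by (simp add: g)
    moreover have "q \<noteq> 0" "degree q < degree g" using minpoly_degree_pos[OF assms(1)] by (auto simp: g split: if_splits)
    ultimately show False using assms(1) cq(2) unfolding is_minpoly_def by (metis not_less)
  qed
  hence "z * (- poly q z / c) = 1"
    using mp(2) by (simp add: g add_eq_0_iff2)
  hence "inverse z = poly (smult (- inverse c) q) z"
    by (simp add: inverse_unique divide_inverse mult.commute)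
  thus ?thesis using polys_smult[OF uminus[OF inverse[OF cq(1)]] cq(2)] by blast
qed

end

interpretation rats: complex_subfield "\<rat>"
  by unfold_locales auto

section \<open>Finite-dimensional rational spaces and algebraicity\<close>

lemma rat_span_mult_closed:
  assumes "\<And>v. v \<in> V \<Longrightarrow> z * v \<in> rat_space.span W" "x \<in> rat_space.span V"
  shows "z * x \<in> rat_space.span W"
  using assms(2)
proof (induction rule: rat_space.span_induct_alt)
  case base
  show ?case by (simp add: rat_space.span_zero)
next
  case (step c x y)
  have "z * (of_rat c * x + y) = of_rat c * (z * x) + z * y" by (simp add: algebra_simps)
  thus ?case using step assms(1) by (simp add: rat_space.span_add rat_space.span_scale)
qed

lemma algebraic_if_powers_in_span:
  assumes "finite B" "\<And>i. z ^ i \<in> rat_space.span B"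
  shows "\<exists>p\<in>polys_over \<rat>. p \<noteq> 0 \<and> poly p z = 0 \<and> degree p \<le> card B"
\<comment> \<open>Linear dependence concerns the set of powers, so coinciding powers are treated
  apart: they give the relation X^j - X^i directly.\<close>
proof (cases "inj_on (\<lambda>i. z ^ i) {..card B}")
  case False
  then obtain i j where ij: "i < j" "j \<le> card B" "z ^ i = z ^ j"
    unfolding inj_on_def by (metis atMost_iff linorder_neqE_nat)
  define p where "p = monom 1 j - monom (1::complex) i"
  have "coeff p j = 1" using ij by (simp add: p_def)
  hence "p \<noteq> 0" by auto
  moreover have "degree p \<le> card B" unfolding p_def using ij by (intro degree_diff_le) (auto simp: degree_monom_eq)
  ultimately show ?thesis using ij
    by (intro bexI[of _ p]) (auto simp: p_def poly_monom intro!: rats.polys_diff rats.polys_monom)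
next
  case True
  define S where "S = (\<lambda>i. z ^ i) ` {..card B}"
  have "card S = Suc (card B)" unfolding S_def using True by (simp add: card_image)
  moreover have "S \<subseteq> rat_space.span B" using assms(2) by (auto simp: S_def)
  ultimately have "rat_space.dependent S"
    using rat_space.independent_span_bound[OF assms(1), of S] by auto
  then obtain t u where t: "finite t" "t \<subseteq> S" "(\<Sum>v\<in>t. of_rat (u v) * v) = 0" "\<exists>v\<in>t. u v \<noteq> 0"
    unfolding rat_space.dependent_explicit by blast
  define c where "c = (\<lambda>v. if v \<in> t then u v else 0)"
  define p where "p = (\<Sum>i\<le>card B. monom (complex_of_rat (c (z ^ i))) i)"
  have coeff: "coeff p i = of_rat (c (z ^ i))" if "i \<le> card B" for i
    using that by (simp add: p_def coeff_sum)
  obtain v where v: "v \<in> t" "u v \<noteq> 0" using t(4) by blast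
  then obtain i where "v = z ^ i" "i \<le> card B" using t(2) by (auto simp: S_def)
  hence "coeff p i \<noteq> 0" using coeff v by (simp add: c_def)
  hence "p \<noteq> 0" by auto
  moreover have "poly p z = 0"
  proof -
    have "poly p z = (\<Sum>i\<le>card B. of_rat (c (z ^ i)) * z ^ i)" by (simp add: p_def poly_sum poly_monom)
    also have "\<dots> = (\<Sum>v\<in>S. of_rat (c v) * v)"
      unfolding S_def using True by (simp add: sum.reindex)
    also have "\<dots> = (\<Sum>v\<in>t. of_rat (u v) * v)"
      using t(1,2) by (intro sum.mono_neutral_cong_right) (auto simp: c_def S_def)
    finally show ?thesis using t(3) by simp
  qed
  moreover have "degree p \<le> card B" unfolding p_def
    by (intro degree_sum_le) (auto intro: order.trans[OF degree_monom_le])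
  moreover have "p \<in> polys_over \<rat>" unfolding p_def by (intro rats.polys_sum rats.polys_monom) auto
  ultimately show ?thesis by blast
qed

text \<open>The powers of x stay in a finite-dimensional space, so x is algebraic, and the inverse
  of a non-zero algebraic number is a rational polynomial in it.\<close>

lemma finite_dim_ring_subfield:
  assumes "finite B" "1 \<in> rat_space.span B"
    and mult: "\<And>x y. x \<in> rat_space.span B \<Longrightarrow> y \<in> rat_space.span B \<Longrightarrow> x * y \<in> rat_space.span B"
  shows "complex_subfield (rat_space.span B)"
proof
  fix x assume x: "x \<in> rat_space.span B"
  have pow: "x ^ i \<in> rat_space.span B" for i
    by (induction i) (auto simp: assms x)
  show "inverse x \<in> rat_space.span B"
  proof (cases "x = 0")
    case False
    obtain g where "is_minpoly \<rat> g x"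
      using algebraic_if_powers_in_span[OF assms(1) pow] rats.minpoly_exists by blast
    then obtain p where p: "p \<in> polys_over \<rat>" "inverse x = poly p x"
      using rats.inverse_eq_poly False by blast
    have "coeff p i * x ^ i \<in> rat_space.span B" for i
    proof -
      obtain q where "coeff p i = of_rat q" using p(1) by (auto simp: polys_over_def elim: Rats_cases)
      thus ?thesis using rat_space.span_scale[OF pow] by metis
    qed
    thus ?thesis unfolding p(2) poly_altdef by (intro rat_space.span_sum)
  qed (simp add: rat_space.span_zero)
qed (auto intro: assms rat_space.span_diff)

section \<open>Minimal polynomials, heights and primitive elements\<close>

lemma coeff_of_int_poly [simp]: "coeff (map_poly of_int p :: complex poly) i = of_int (coeff p i)"
  by (simp add: coeff_map_poly)

lemma of_int_poly_mult:
  "(map_poly of_int (p * q) :: complex poly) = map_poly of_int p * map_poly of_int q"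
  by (rule poly_eqI) (simp add: coeff_mult)

lemma of_int_poly_power:
  "(map_poly of_int (p ^ n) :: complex poly) = map_poly of_int p ^ n"
  by (induction n) (simp_all add: of_int_poly_mult map_poly_1)

lemma of_int_poly_smult:
  "(map_poly of_int (smult c p) :: complex poly) = smult (of_int c) (map_poly of_int p)"
  by (rule poly_eqI) simp

lemma degree_of_int_poly [simp]: "degree (map_poly of_int p :: complex poly) = degree p"
  by (rule degree_map_poly) simp

lemma of_int_poly_eq_0_iff [simp]: "(map_poly of_int p :: complex poly) = 0 \<longleftrightarrow> p = 0"
  by (simp add: poly_eq_iff)

lemma of_int_poly_over_Rats: "map_poly of_int p \<in> polys_over \<rat>"
  by (simp add: polys_over_def)

lemma algebraic_imp_minpoly:
  assumes "algebraic z"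
  shows "\<exists>g. is_minpoly \<rat> g z"
proof -
  obtain p where "poly (map_poly of_int p) z = 0" "p \<noteq> 0"
    using algebraicE'[OF assms] by metis
  thus ?thesis using rats.minpoly_exists[OF of_int_poly_over_Rats, of p] by simp
qed

lemma clear_denominators:
  assumes "g \<in> polys_over \<rat>"
  obtains N :: int and r :: "int poly" where "N > 0" "map_poly of_int r = smult (of_int N) g"
proof -
  have "\<forall>i. \<exists>q. coeff g i = of_rat q" using assms by (auto simp: polys_over_def elim: Rats_cases)
  then obtain q where q: "\<And>i. coeff g i = of_rat (q i)" by metis
  obtain N where N: "N > 0" "\<And>i. i \<in> {..degree g} \<Longrightarrow> of_int N * q i \<in> \<int>"
    using common_denominator[of "{..degree g}" q] by auto
  define r where "r = (\<Sum>i\<le>degree g. monom \<lfloor>of_int N * q i\<rfloor> i)"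
  have "coeff (map_poly of_int r) i = of_int N * coeff g i" for i
  proof (cases "i \<le> degree g")
    case True
    then obtain k where "of_int N * q i = of_int k" using N(2) by (auto elim: Ints_cases)
    hence "of_int \<lfloor>of_int N * q i\<rfloor> = of_int N * q i" by simp
    hence "of_rat (of_int \<lfloor>of_int N * q i\<rfloor>) = (of_rat (of_int N * q i) :: complex)" by (simp only:)
    thus ?thesis using True by (simp add: r_def coeff_sum q of_rat_mult)
  next
    case False
    thus ?thesis by (simp add: r_def coeff_sum coeff_eq_0)
  qed
  hence "map_poly of_int r = smult (of_int N) g" by (intro poly_eqI) simp
  thus ?thesis using that N(1) by blast
qed

lemma min_int_poly:
  assumes "algebraic z"
  shows "irreducible (min_int_poly z)" "lead_coeff (min_int_poly z) > 0"
    "poly (map_poly of_int (min_int_poly z)) z = 0"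
  using theI'[OF min_int_poly_ex1[OF assms]] unfolding min_int_poly_def by auto

text \<open>Clearing denominators in g and passing to the primitive part with positive leading
  coefficient gives an irreducible integer polynomial vanishing at z, and
  \<open>min_int_poly\<close> is the only one. This connects heights with the linear algebra over
  the rationals.\<close>

lemma min_int_poly_eq_smult_minpoly:
  assumes g: "is_minpoly \<rat> g z" and alg: "algebraic z"
  shows "map_poly of_int (min_int_poly z) = smult (of_int (lead_coeff (min_int_poly z))) g"
proof -
  have g': "g \<in> polys_over \<rat>" "lead_coeff g = 1" "poly g z = 0" "degree g > 0"
    using g rats.minpoly_degree_pos[OF g] by (auto simp: is_minpoly_def)
  obtain N r0 where N: "N > 0" "map_poly of_int r0 = smult (complex_of_int N) g"
    using clear_denominators[OF g'(1)] by blast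
  define r1 where "r1 = primitive_part r0"
  define r where "r = (if lead_coeff r1 > 0 then r1 else - r1)"
  have "r0 \<noteq> 0" using N g' by auto
  hence "r1 \<noteq> 0" by (simp add: r1_def)
  have "smult (of_int (content r0)) (map_poly of_int r1) = smult (complex_of_int N) g"
    unfolding N(2)[symmetric] r1_def by (simp flip: of_int_poly_smult)
  hence r1: "map_poly of_int r1 = smult (complex_of_int N / of_int (content r0)) g"
    using \<open>r0 \<noteq> 0\<close> by (metis (no_types, lifting) content_eq_zero_iff divide_inverse mult.commute of_int_eq_0_iff smult_smult left_inverse smult_1_left)
  have neg: "map_poly of_int (- r1) = - (map_poly of_int r1 :: complex poly)"
    by (rule poly_eqI) simp
  define c where "c = complex_of_int (lead_coeff r)"
  have "\<exists>c. map_poly of_int r = smult c g"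
    unfolding r_def by (simp add: r1 neg) (metis smult_minus_left)
  then obtain c' where c': "map_poly of_int r = smult c' g" by blast
  have "c = c'"
    using arg_cong[OF c', of lead_coeff] g'(2) by (simp add: c_def)
  with c' have r: "map_poly of_int r = smult c g" by simp
  have lead: "lead_coeff r > 0" using \<open>r1 \<noteq> 0\<close> by (auto simp: r_def not_less order_le_less)
  have "content (- r1) = content r1"
    using content_smult[of "-1" r1] by simp
  hence cont: "content r = 1" using \<open>r0 \<noteq> 0\<close>
    by (simp add: r_def r1_def)
  have deg: "degree r = degree g"
  proof -
    have "c \<noteq> 0" using lead by (auto simp: c_def)
    thus ?thesis using arg_cong[OF r, of degree] by simp
  qed
  \<comment> \<open>The factor vanishing at z already has full degree by minimality of g. The other
    factor is therefore a constant, and it divides the content 1.\<close>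
  have unit: "b dvd 1" if "r = a * b" "poly (map_poly of_int a) z = 0" for a b
  proof -
    have "a \<noteq> 0" "b \<noteq> 0" using that lead by auto
    hence "degree g \<le> degree a"
      using g that(2) of_int_poly_over_Rats[of a] by (auto simp: is_minpoly_def)
    hence "degree b = 0" using deg that(1) \<open>a \<noteq> 0\<close> \<open>b \<noteq> 0\<close> by (simp add: degree_mult_eq)
    then obtain t where t: "b = [:t:]" by (metis degree_eq_zeroE)
    hence "t dvd content r" unfolding that(1) by simp
    thus ?thesis using cont by (simp add: t is_unit_const_poly_iff)
  qed
  have "irreducible r"
  proof (rule irreducibleI)
    show "r \<noteq> 0" using lead by auto
    show "\<not> r dvd 1" using deg g'(4) by (auto simp: is_unit_poly_iff)
    fix a b assume ab: "r = a * b"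
    have "poly (map_poly of_int r) z = 0" by (simp add: r g')
    hence "poly (map_poly of_int a) z = 0 \<or> poly (map_poly of_int b) z = 0"
      unfolding ab of_int_poly_mult by simp
    thus "a dvd 1 \<or> b dvd 1" using unit[of a b] unit[of b a] ab by (auto simp: mult.commute)
  qed
  hence "min_int_poly z = r"
    using min_int_poly_ex1[OF alg] min_int_poly[OF alg] lead r g'(3) by auto
  thus ?thesis using r by (simp add: c_def)
qed

lemma height_power_eq:
  assumes "is_minpoly \<rat> g z" "algebraic z"
  shows "height z ^ degree g =
    of_int (lead_coeff (min_int_poly z)) * (\<Prod>x\<in>#proots g. max 1 (cmod x))"
    and "height z \<ge> 0"
proof -
  define a where "a = lead_coeff (min_int_poly z)"
  have a: "a > 0" using min_int_poly(2)[OF assms(2)] by (simp add: a_def)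
  have p: "map_poly of_int (min_int_poly z) = smult (of_int a) g"
    unfolding a_def by (rule min_int_poly_eq_smult_minpoly[OF assms])
  have deg: "degree (min_int_poly z) = degree g"
    using arg_cong[OF p, of degree] a by simp
  have "(\<Prod>x\<in>#proots g. max 1 (cmod x)) \<ge> 0"
  proof -
    have "(\<Prod>x\<in>#M. max 1 (cmod x)) \<ge> 0" for M by (induction M) auto
    thus ?thesis .
  qed
  hence nonneg: "of_int a * (\<Prod>x\<in>#proots g. max 1 (cmod x)) \<ge> 0" using a by simp
  have height: "height z = root (degree g) (of_int a * (\<Prod>x\<in>#proots g. max 1 (cmod x)))"
  proof -
    have "coeff (min_int_poly z) (degree g) = a" using deg by (simp add: a_def)
    thus ?thesis unfolding height_def Let_def p using a by (simp add: deg)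
  qed
  show "height z ^ degree g = of_int (lead_coeff (min_int_poly z)) * (\<Prod>x\<in>#proots g. max 1 (cmod x))"
    unfolding height a_def[symmetric]
    using rats.minpoly_degree_pos[OF assms(1)] nonneg by (rule real_root_pow_pos2)
  show "height z \<ge> 0" unfolding height by (rule real_root_ge_zero[OF nonneg])
qed

section \<open>The field generated by two algebraic numbers\<close>

lemma rat_adjoin_subset:
  assumes "complex_subfield F" "X \<subseteq> F"
  shows "rat_adjoin X \<subseteq> F"
proof
  interpret complex_subfield F by fact
  fix x assume "x \<in> rat_adjoin X"
  thus "x \<in> F" using assms(2) Rats_subset by induction (auto intro: add uminus mult inverse)
qed

lemma rat_adjoin_subfield: "complex_subfield (rat_adjoin X)"
proof
  show "1 \<in> rat_adjoin X" using rat_adjoin.rat[of 1] by simp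
  show "x - y \<in> rat_adjoin X" if "x \<in> rat_adjoin X" "y \<in> rat_adjoin X" for x y
    using rat_adjoin.add[OF that(1) rat_adjoin.minus[OF that(2)]] by simp
qed (auto intro: rat_adjoin.intros)

lemma power_degree_mult_in_span:
  assumes "p \<in> polys_over \<rat>" "lead_coeff p = 1" "poly p a = 0"
    and "\<And>i. i < degree p \<Longrightarrow> a ^ i * w \<in> rat_space.span B"
  shows "a ^ degree p * w \<in> rat_space.span B"
proof -
  have "0 = poly p a * w" using assms(3) by simp
  also have "poly p a = (\<Sum>i<degree p. coeff p i * a ^ i) + a ^ degree p"
    using assms(2) unfolding poly_altdef by (simp flip: lessThan_Suc_atMost)
  finally have "a ^ degree p * w = - (\<Sum>i<degree p. coeff p i * (a ^ i * w))"
    by (simp add: algebra_simps sum_distrib_left eq_neg_iff_add_eq_0)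
  also have "\<dots> \<in> rat_space.span B"
  proof (intro rat_space.span_neg rat_space.span_sum)
    fix i assume "i \<in> {..<degree p}"
    obtain q where "coeff p i = of_rat q" using assms(1) by (auto simp: polys_over_def elim: Rats_cases)
    thus "coeff p i * (a ^ i * w) \<in> rat_space.span B"
      using rat_space.span_scale[OF assms(4)] \<open>i \<in> _\<close> by (metis lessThan_iff)
  qed
  finally show ?thesis .
qed

text \<open>The monomials \<open>a ^ i * b ^ j\<close> below the two degrees span a ring. It is
  needed only as a finite-dimensional field around Q(a, b), where \<open>dim\<close> has its meaning
  as a degree.\<close>

lemma finite_dim_field_containing:
  assumes "algebraic a" "algebraic b"
  shows "\<exists>B. finite B \<and> complex_subfield (rat_space.span B) \<and> a \<in> rat_space.span B \<and> b \<in> rat_space.span B"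
proof -
  obtain p q where p: "is_minpoly \<rat> p a" and q: "is_minpoly \<rat> q b"
    using assms algebraic_imp_minpoly by blast
  note p' = rats.minpoly_degree_pos[OF p] p[unfolded is_minpoly_def]
  note q' = rats.minpoly_degree_pos[OF q] q[unfolded is_minpoly_def]
  define B where "B = (\<lambda>(i, j). a ^ i * b ^ j) ` ({..<degree p} \<times> {..<degree q})"
  let ?V = "rat_space.span B"
  have base: "a ^ i * b ^ j \<in> ?V" if "i < degree p" "j < degree q" for i j
    using that by (intro rat_space.span_base) (force simp: B_def)
  have B_cases: "\<exists>i j. v = a ^ i * b ^ j \<and> i < degree p \<and> j < degree q" if "v \<in> B" for v
    using that unfolding B_def by (elim imageE SigmaE) auto
  have a: "a * v \<in> ?V" if vB: "v \<in> B" for v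
  proof -
    obtain i j where v: "v = a ^ i * b ^ j" "i < degree p" "j < degree q" using B_cases[OF vB] by blast
    have "a ^ Suc i * b ^ j \<in> ?V"
    proof (cases "Suc i < degree p")
      case False
      hence "Suc i = degree p" using v by simp
      thus ?thesis using power_degree_mult_in_span[of p a "b ^ j"] p' base v by metis
    qed (use v base in blast)
    thus ?thesis by (simp add: v mult.assoc)
  qed
  have b: "b * v \<in> ?V" if vB: "v \<in> B" for v
  proof -
    obtain i j where v: "v = a ^ i * b ^ j" "i < degree p" "j < degree q" using B_cases[OF vB] by blast
    have "b ^ Suc j * a ^ i \<in> ?V"
    proof (cases "Suc j < degree q")
      case False
      hence "Suc j = degree q" using v by simp
      thus ?thesis using power_degree_mult_in_span[of q b "a ^ i"] q' base v by (metis mult.commute)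
    qed (use v base in \<open>metis mult.commute\<close>)
    moreover have "b * v = b ^ Suc j * a ^ i" by (simp add: v)
    ultimately show ?thesis by (simp only:)
  qed
  have powers: "a ^ i * (b ^ j * y) \<in> ?V" if "y \<in> ?V" for i j y
  proof -
    have "b ^ j * y \<in> ?V"
      by (induction j) (use that rat_span_mult_closed[OF b] in \<open>auto simp: mult.assoc\<close>)
    thus ?thesis by (induction i) (use rat_span_mult_closed[OF a] in \<open>auto simp: mult.assoc\<close>)
  qed
  have mult: "x * y \<in> ?V" if "x \<in> ?V" "y \<in> ?V" for x y
  proof -
    have "y * x \<in> ?V"
    proof (rule rat_span_mult_closed[OF _ that(1)])
      fix v assume "v \<in> B"
      then obtain i j where "v = a ^ i * b ^ j" using B_cases by blast
      hence "y * v = a ^ i * (b ^ j * y)" by simp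
      thus "y * v \<in> ?V" using powers[OF that(2)] by (simp only:)
    qed
    thus ?thesis by (simp only: mult.commute)
  qed
  have one: "1 \<in> ?V" using base[of 0 0] p'(1) q'(1) by simp
  have "finite B" by (simp add: B_def)
  moreover have "complex_subfield ?V" using \<open>finite B\<close> one mult by (rule finite_dim_ring_subfield)
  moreover have "a \<in> ?V" "b \<in> ?V" using powers[OF one, of 1 0] powers[OF one, of 0 1] by simp_all
  ultimately show ?thesis by blast
qed

text \<open>Take c = a + m b with m outside a finite set. Over F = Q(c), b is a root of its rational
  minimal polynomial and of \<open>pa(c - m X)\<close>; the choice of m makes it the only common
  root, so b lies in F, and then so does a.\<close>

lemma primitive_element:
  assumes "algebraic a" "algebraic b"
  shows "\<exists>c g p q. is_minpoly \<rat> g c \<and> degree g \<le> degree_over_rat (rat_adjoin {a, b}) \<and>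
    p \<in> polys_over \<rat> \<and> q \<in> polys_over \<rat> \<and> a = poly p c \<and> b = poly q c"
proof -
  obtain B where B: "finite B" "complex_subfield (rat_space.span B)"
    "a \<in> rat_space.span B" "b \<in> rat_space.span B"
    using finite_dim_field_containing[OF assms] by blast
  interpret V: complex_subfield "rat_space.span B" by (rule B(2))
  have minpoly: "\<exists>g. is_minpoly \<rat> g x" if "x \<in> rat_space.span B" for x
    using algebraic_if_powers_in_span[OF B(1) V.power[OF that]] rats.minpoly_exists by blast
  obtain pa pb where pa: "is_minpoly \<rat> pa a" and pb: "is_minpoly \<rat> pb b"
    using assms algebraic_imp_minpoly by blast
  have fin: "finite {x. poly pa x = 0}" "finite {x. poly pb x = 0}"
    using pa pb by (auto simp: is_minpoly_def intro!: poly_roots_finite)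
  \<comment> \<open>The relevant quotients have y \<noteq> b; those with y = b are 0 by the
    convention for division by zero, and keeping them only excludes m = 0.\<close>
  define bad where "bad = (\<lambda>(x, y). (x - a) / (b - y)) ` ({x. poly pa x = 0} \<times> {y. poly pb y = 0})"
  have "finite bad" using fin by (simp add: bad_def)
  hence "\<exists>m::nat. of_nat m \<notin> bad"
    using infinite_UNIV_nat finite_vimageI[OF _ inj_of_nat] by (metis UNIV_eq_I vimageI)
  then obtain m :: nat where m: "of_nat m \<notin> bad" by blast
  define c where "c = a + of_nat m * b"
  have "c \<in> rat_space.span B" unfolding c_def by (intro V.add V.mult V.of_nat B)
  then obtain g where g: "is_minpoly \<rat> g c" using minpoly by blast
  define F where "F = (\<lambda>p. poly p c) ` polys_over \<rat>"
  have F_sub: "F \<subseteq> rat_space.span B"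
    using V.polys_eval[OF _ \<open>c \<in> rat_space.span B\<close>] polys_over_mono[OF V.Rats_subset] by (auto simp: F_def)
  interpret F: complex_subfield F
  proof
    show "1 \<in> F" unfolding F_def by (rule image_eqI[of _ _ 1]) (auto simp: rats.polys_one)
    fix x y assume "x \<in> F" "y \<in> F"
    then obtain p q where pq: "p \<in> polys_over \<rat>" "q \<in> polys_over \<rat>" "x = poly p c" "y = poly q c"
      by (auto simp: F_def)
    show "x - y \<in> F" unfolding F_def using pq by (intro image_eqI[of _ _ "p - q"] rats.polys_diff) auto
    show "x * y \<in> F" unfolding F_def using pq by (intro image_eqI[of _ _ "p * q"] rats.polys_mult) auto
  next
    fix x assume x: "x \<in> F"
    then obtain p where p: "p \<in> polys_over \<rat>" "x = poly p c" by (auto simp: F_def)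
    show "inverse x \<in> F"
    proof (cases "x = 0")
      case False
      obtain h where "is_minpoly \<rat> h x" using minpoly x F_sub by blast
      then obtain s where "s \<in> polys_over \<rat>" "inverse x = poly s x"
        using rats.inverse_eq_poly False by blast
      thus ?thesis unfolding F_def using p
        by (intro image_eqI[of _ _ "pcompose s p"] rats.polys_pcompose) (auto simp: poly_pcompose)
    qed (use x in simp)
  qed
  have "c \<in> F" unfolding F_def
    by (intro image_eqI[of _ _ "[:0, 1:]"]) (auto simp: rats.polys_pCons rats.polys_zero)
  have pb': "pb \<in> polys_over F" "poly pb b = 0" "pb \<noteq> 0" "pa \<in> polys_over F" "poly pa a = 0"
    using pa pb polys_over_mono[OF F.Rats_subset] by (auto simp: is_minpoly_def)
  \<comment> \<open>The minimal polynomial of b over F divides both polynomials having b as a common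
    root. It has no other root and no multiple root, hence degree 1.\<close>
  obtain h where h: "is_minpoly F h b" using F.minpoly_exists[OF pb'(1,3,2)] by blast
  have h': "h \<in> polys_over F" "lead_coeff h = 1" "poly h b = 0" "h \<noteq> 0" using h by (auto simp: is_minpoly_def)
  define s where "s = pcompose pa [:c, - of_nat m:]"
  have s: "s \<in> polys_over F" "poly s b = 0"
    using pb' \<open>c \<in> F\<close> by (auto simp: s_def poly_pcompose c_def F.polys_pCons F.polys_zero F.uminus F.of_nat intro!: F.polys_pcompose)
  have root: "y = b" if "poly h y = 0" for y
  proof (rule ccontr)
    assume "y \<noteq> b"
    have "poly pb y = 0" "poly s y = 0"
      using F.minpoly_divides[OF h pb'(1,2)] F.minpoly_divides[OF h s] that by auto
    hence "poly pb y = 0" "poly pa (c - of_nat m * y) = 0" by (auto simp: s_def poly_pcompose mult.commute)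
    moreover have "(c - of_nat m * y - a) / (b - y) = of_nat m"
      using \<open>y \<noteq> b\<close> by (simp add: c_def field_simps)
    ultimately have "of_nat m \<in> bad" unfolding bad_def by force
    thus False using m by simp
  qed
  have "order y h \<le> 1" for y
    using F.minpoly_rsquarefree[OF h] unfolding rsquarefree_def by (metis le_refl zero_le_one)
  moreover have "order y h = 0" if "y \<noteq> b" for y
    using root[of y] that order_root[of h y] by auto
  ultimately have "count (proots h) y \<le> count {#b#} y" for y
    using h'(4) by auto
  hence "proots h \<subseteq># {#b#}" by (simp add: mset_subset_eqI)
  hence "size (proots h) \<le> 1" using size_mset_mono by fastforce
  hence "degree h = 1" using F.minpoly_degree_pos[OF h] by (simp add: size_proots_complex)
  then obtain t where t: "h = [:t, 1:]" using h'(2)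
    by (metis degree1_coeffs One_nat_def coeff_pCons_0 coeff_pCons_Suc)
  hence "b = - t" "t \<in> F" using h' by (auto simp: F.polys_pCons add_eq_0_iff2 add.commute)
  hence "b \<in> F" by (simp add: F.uminus)
  hence "c - of_nat m * b \<in> F" using \<open>c \<in> F\<close> by (intro F.diff F.mult F.of_nat)
  hence "a \<in> F" by (simp add: c_def)
  let ?K = "rat_adjoin {a, b}"
  interpret K: complex_subfield ?K by (rule rat_adjoin_subfield)
  have "c \<in> ?K" unfolding c_def by (intro K.add K.mult K.of_nat rat_adjoin.incl) auto
  \<comment> \<open>A basis of Q(a, b) has as many elements as the degree of the field. All powers
    of c lie in its span, so the degree of c cannot exceed that number.\<close>
  obtain B' where B': "B' \<subseteq> ?K" "rat_space.independent B'" "?K \<subseteq> rat_space.span B'" "card B' = rat_space.dim ?K"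
    using rat_space.basis_exists by blast
  have "?K \<subseteq> rat_space.span B" by (rule rat_adjoin_subset[OF B(2)]) (use B in auto)
  hence "finite B'" using rat_space.independent_span_bound[OF B(1) B'(2)] B'(1) by blast
  moreover have "c ^ i \<in> rat_space.span B'" for i
    using K.power[OF \<open>c \<in> ?K\<close>] by (rule subsetD[OF B'(3)])
  ultimately obtain p where p: "p \<in> polys_over \<rat>" "p \<noteq> 0" "poly p c = 0" "degree p \<le> card B'"
    using algebraic_if_powers_in_span[of B' c] by auto
  have "degree g \<le> degree p" using g p(1-3) by (simp add: is_minpoly_def)
  hence "degree g \<le> degree_over_rat ?K"
    using p(4) B'(4) unfolding degree_over_rat_def by simp
  thus ?thesis using g \<open>a \<in> F\<close> \<open>b \<in> F\<close> unfolding F_def by blast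
qed

section \<open>Liouville's inequality and Siegel's lemma\<close>

definition bipoly :: "nat \<Rightarrow> (nat \<Rightarrow> nat \<Rightarrow> int) \<Rightarrow> complex \<Rightarrow> complex \<Rightarrow> complex" where
  "bipoly T p x y = (\<Sum>i\<le>T. \<Sum>j\<le>T. of_int (p i j) * x ^ i * y ^ j)"

text \<open>Conjugates of c are indexed so that the conjugates of several polynomial expressions in
  c can be paired by index. Index 0 is reserved for c itself.\<close>

lemma conjugates_enumeration:
  assumes "is_minpoly \<rat> g c"
  shows "\<exists>w. w 0 = c \<and> proots g = image_mset w (mset_set {..<degree g})"
proof -
  have "g \<noteq> 0" "poly g c = 0" using assms by (auto simp: is_minpoly_def)
  hence "c \<in># proots g" by simp
  then obtain M where M: "proots g = add_mset c M" by (metis mset_add)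
  obtain ys where ys: "mset ys = M" using ex_mset by blast
  define zs where "zs = c # ys"
  have mset: "mset zs = proots g" by (simp add: zs_def ys M)
  have len: "length zs = degree g" by (metis mset size_mset size_proots_complex)
  have "mset zs = mset (map ((!) zs) [0..<length zs])" by (simp add: map_nth)
  also have "\<dots> = image_mset ((!) zs) (mset_set {..<length zs})" by (simp add: mset_upt lessThan_atLeast0)
  finally show ?thesis using mset len by (intro exI[of _ "(!) zs"]) (simp add: zs_def)
qed

lemma prod_conjugates_in_Rats:
  assumes "is_minpoly \<rat> g c" "proots g = image_mset w (mset_set {..<degree g})" "p \<in> polys_over \<rat>"
  shows "(\<Prod>i<degree g. poly p (w i)) \<in> \<rat>"
proof -
  have "(\<Prod>i<degree g. poly p (w i)) = (\<Prod>x\<in>#proots g. poly p x)"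
    unfolding assms(2) by (simp add: prod_unfold_prod_mset image_mset.compositionality comp_def)
  thus ?thesis using rats.prod_over_roots_in_field[of g p] assms by (simp add: is_minpoly_def)
qed

lemma conjugate_root:
  assumes "is_minpoly \<rat> g c" "proots g = image_mset w (mset_set {..<degree g})" "i < degree g"
  shows "poly g (w i) = 0"
proof -
  have "w i \<in># proots g" using assms(3) by (auto simp: assms(2))
  moreover have "g \<noteq> 0" using assms(1) by (auto simp: is_minpoly_def)
  ultimately show ?thesis by simp
qed

text \<open>A(c) may generate a smaller field than c, and its conjugates then occur repeatedly among
  the \<open>A(w i)\<close>. Their polynomial is rational since its values at natural numbers are
  norms, and all its roots are roots of h.\<close>

lemma characteristic_poly_eq_power:
  assumes g: "is_minpoly \<rat> g c" "proots g = image_mset w (mset_set {..<degree g})"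
    and A: "A \<in> polys_over \<rat>" and h: "is_minpoly \<rat> h (poly A c)"
  shows "\<exists>e. (\<Prod>i<degree g. [:- poly A (w i), 1:]) = h ^ e"
proof (rule rats.monic_eq_minpoly_power[OF h])
  let ?p = "\<Prod>i<degree g. [:- poly A (w i), 1:]"
  show "lead_coeff ?p = 1" by (simp add: lead_coeff_prod)
  show "?p \<in> polys_over \<rat>"
  proof (rule rats.polys_if_values)
    show "infinite (range of_nat :: complex set)" by (simp add: range_inj_infinite inj_of_nat)
    fix x :: complex assume "x \<in> range of_nat"
    hence x: "x \<in> \<rat>" by auto
    have "poly ?p x = (\<Prod>i<degree g. poly ([:x:] - A) (w i))" by (simp add: poly_prod)
    also have "\<dots> \<in> \<rat>" using x A
      by (intro prod_conjugates_in_Rats[OF g]) (auto intro!: rats.polys_diff simp: rats.polys_pCons rats.polys_zero)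
    finally show "poly ?p x \<in> \<rat>" .
  qed auto
  fix x assume "poly ?p x = 0"
  then obtain i where i: "i < degree g" "x = poly A (w i)" by (auto simp: poly_prod)
  have "poly (pcompose h A) c = 0" "pcompose h A \<in> polys_over \<rat>"
    using h A by (auto simp: poly_pcompose is_minpoly_def intro: rats.polys_pcompose)
  then obtain q where "pcompose h A = q * g" using rats.minpoly_divides[OF g(1)] by blast
  hence "poly (pcompose h A) (w i) = 0" using conjugate_root[OF g i(1)] by simp
  thus "poly h x = 0" by (simp add: i poly_pcompose)
qed

text \<open>Each conjugate of A(c) occurs e times among the \<open>A(w i)\<close>, where e is the
  degree of g divided by that of h. So the integer \<open>a\<close> is the e-th power of the leading
  coefficient of the minimal polynomial of A(c), and the height is raised to the degree of the
  larger field.\<close>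

lemma conjugates_integrality_and_height:
  assumes g: "is_minpoly \<rat> g c" "proots g = image_mset w (mset_set {..<degree g})"
    and A: "A \<in> polys_over \<rat>" and alg: "algebraic (poly A c)"
  shows "\<exists>a::int. a > 0 \<and> (\<forall>I\<subseteq>{..<degree g}. integral_elt (of_int a * (\<Prod>i\<in>I. poly A (w i)))) \<and>
    height (poly A c) ^ degree g = of_int a * (\<Prod>i<degree g. max 1 (cmod (poly A (w i))))"
proof -
  obtain h where h: "is_minpoly \<rat> h (poly A c)" using algebraic_imp_minpoly[OF alg] by blast
  define D where "D = degree g"
  define x where "x i = poly A (w i)" for i
  obtain e where e: "(\<Prod>i<D. [:- x i, 1:]) = h ^ e"
    using characteristic_poly_eq_power[OF g A h] unfolding D_def x_def by blast
  define p where "p = min_int_poly (poly A c)"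
  define a where "a = lead_coeff p"
  have a: "a > 0" using min_int_poly(2)[OF alg] by (simp add: a_def p_def)
  have p: "map_poly of_int p = smult (of_int a) h"
    unfolding a_def p_def by (rule min_int_poly_eq_smult_minpoly[OF h alg])
  have prod_mset: "(\<Prod>i\<in>I. f (x i)) = (\<Prod>z\<in>#image_mset x (mset_set I). f z)"
    for f :: "complex \<Rightarrow> 'b::comm_monoid_mult" and I
    by (simp add: prod_unfold_prod_mset image_mset.compositionality comp_def)
  have "integral_elt (of_int (a ^ e) * (\<Prod>i\<in>I. x i))" if I: "I \<subseteq> {..<D}" for I
  proof -
    let ?M = "image_mset x (mset_set I)" and ?M' = "image_mset x (mset_set ({..<D} - I))"
    have fin: "finite I" using I finite_subset by blast
    have "?M + ?M' = image_mset x (mset_set {..<D})"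
      using mset_set_Union[of I "{..<D} - I"] I fin
      by (metis Diff_disjoint Diff_partition finite_Diff finite_lessThan image_mset_union)
    hence "smult (of_int (a ^ e)) (\<Prod>z\<in>#?M + ?M'. [:-z, 1:]) = smult (of_int a ^ e) (h ^ e)"
      using e prod_mset[of "\<lambda>z. [:-z, 1:]" "{..<D}"] by simp
    also have "\<dots> = map_poly of_int (p ^ e)"
      by (simp add: of_int_poly_power p smult_power)
    finally have "integral_elt (of_int (a ^ e) * prod_mset ?M)"
      by (intro integral_lead_coeff_mult_prod_roots[where M' = ?M']) (simp add: integral_elt_of_int)
    thus ?thesis using prod_mset[of "\<lambda>z. z" I] by simp
  qed
  moreover have "height (poly A c) ^ D = of_int (a ^ e) * (\<Prod>i<D. max 1 (cmod (x i)))"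
  proof -
    have "D = e * degree h"
    proof -
      have "degree (\<Prod>i<D. [:- x i, 1:]) = D" by (subst degree_prod_eq_sum_degree) auto
      moreover have "h \<noteq> 0" using h by (auto simp: is_minpoly_def)
      ultimately show ?thesis unfolding e by (simp add: degree_power_eq)
    qed
    hence "height (poly A c) ^ D = (height (poly A c) ^ degree h) ^ e"
      by (simp add: mult.commute flip: power_mult)
    also have "\<dots> = of_int (a ^ e) * (\<Prod>z\<in>#proots h. max 1 (cmod z)) ^ e"
      by (simp add: height_power_eq[OF h alg] power_mult_distrib a_def p_def)
    also have "(\<Prod>z\<in>#proots h. max 1 (cmod z)) ^ e = (\<Prod>z\<in>#repeat_mset e (proots h). max 1 (cmod z))"
      by (induction e) auto
    also have "repeat_mset e (proots h) = proots (h ^ e)" by (simp add: proots_power)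
    also have "\<dots> = image_mset x (mset_set {..<D})"
      unfolding e[symmetric] using prod_mset[of "\<lambda>z. [:-z, 1:]" "{..<D}"] proots_prod_linear by simp
    finally show ?thesis using prod_mset[of "\<lambda>z. max 1 (cmod z)"] by simp
  qed
  ultimately show ?thesis
    using a unfolding D_def x_def by (intro exI[of _ "a ^ e"]) auto
qed

text \<open>A monomial with all exponents at most T is a product of T square-free layers, and each
  layer costs one factor \<open>a\<close>. Here the first layer consists of the indices with
  positive exponent.\<close>

lemma integral_layers:
  fixes D :: nat
  assumes "\<And>I. I \<subseteq> {..<D} \<Longrightarrow> integral_elt (a * (\<Prod>i\<in>I. x i))" "\<And>i. i < D \<Longrightarrow> k i \<le> T"
  shows "integral_elt (a ^ T * (\<Prod>i<D. x i ^ k i))"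
  using assms(2)
proof (induction T arbitrary: k)
  case 0
  thus ?case using integral_elt_of_int[of 1] by simp
next
  case (Suc T)
  define I where "I = {i\<in>{..<D}. k i > 0}"
  have "(\<Prod>i<D. x i ^ k i) = (\<Prod>i<D. (if k i > 0 then x i else 1) * x i ^ (k i - 1))"
  proof (rule prod.cong)
    fix i show "x i ^ k i = (if k i > 0 then x i else 1) * x i ^ (k i - 1)" by (cases "k i") auto
  qed simp
  also have "\<dots> = (\<Prod>i\<in>I. x i) * (\<Prod>i<D. x i ^ (k i - 1))"
    unfolding I_def prod.distrib by (subst prod.inter_filter) simp_all
  finally have "a ^ Suc T * (\<Prod>i<D. x i ^ k i) = (a * (\<Prod>i\<in>I. x i)) * (a ^ T * (\<Prod>i<D. x i ^ (k i - 1)))"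
    by simp
  moreover have "integral_elt (a ^ T * (\<Prod>i<D. x i ^ (k i - 1)))"
  proof (rule Suc.IH)
    fix i assume "i < D"
    thus "k i - 1 \<le> T" using Suc.prems[of i] by simp
  qed
  moreover have "integral_elt (a * (\<Prod>i\<in>I. x i))" by (rule assms(1)) (auto simp: I_def)
  ultimately show ?case by (metis integral_elt_mult)
qed

text \<open>Expanding the product over all conjugates gives monomials in which every exponent is at
  most T, so the T-th powers of a and b suffice, whatever the number D of factors. Hence only the
  heights to the power T D enter Liouville's inequality.\<close>

lemma prod_bipoly_integral:
  fixes D :: nat
  assumes x: "\<And>I. I \<subseteq> {..<D} \<Longrightarrow> integral_elt (a * (\<Prod>i\<in>I. x i))"
    and y: "\<And>I. I \<subseteq> {..<D} \<Longrightarrow> integral_elt (b * (\<Prod>i\<in>I. y i))"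
  shows "integral_elt (a ^ T * b ^ T * (\<Prod>i<D. bipoly T p (x i) (y i)))"
proof -
  let ?S = "{..T} \<times> {..T}"
  have "bipoly T p u v = (\<Sum>s\<in>?S. of_int (p (fst s) (snd s)) * u ^ fst s * v ^ snd s)" for u v
    unfolding bipoly_def by (subst sum.cartesian_product) (simp add: case_prod_unfold)
  hence "(\<Prod>i<D. bipoly T p (x i) (y i)) =
    (\<Sum>f\<in>PiE {..<D} (\<lambda>_. ?S). \<Prod>i<D. of_int (p (fst (f i)) (snd (f i))) * x i ^ fst (f i) * y i ^ snd (f i))"
    by (simp only:) (subst prod_sum_PiE; simp)
  hence "a ^ T * b ^ T * (\<Prod>i<D. bipoly T p (x i) (y i)) =
    (\<Sum>f\<in>PiE {..<D} (\<lambda>_. ?S). of_int (\<Prod>i<D. p (fst (f i)) (snd (f i))) *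
       ((a ^ T * (\<Prod>i<D. x i ^ fst (f i))) * (b ^ T * (\<Prod>i<D. y i ^ snd (f i)))))"
    by (simp add: sum_distrib_left prod.distrib ac_simps)
  also have "integral_elt \<dots>"
  proof (rule integral_elt_sum, rule integral_elt_mult[OF integral_elt_of_int], rule integral_elt_mult)
    fix f assume "f \<in> PiE {..<D} (\<lambda>_. ?S)"
    hence "f i \<in> ?S" if "i < D" for i using that by auto
    hence f: "fst (f i) \<le> T" "snd (f i) \<le> T" if "i < D" for i using that by (auto simp: mem_Times_iff)
    show "integral_elt (a ^ T * (\<Prod>i<D. x i ^ fst (f i)))" by (rule integral_layers[OF x f(1)])
    show "integral_elt (b ^ T * (\<Prod>i<D. y i ^ snd (f i)))" by (rule integral_layers[OF y f(2)])
  qed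
  finally show ?thesis .
qed

text \<open>The norm of \<open>bipoly T p \<alpha> \<beta>\<close>, multiplied by suitable powers of the leading coefficients of
  the minimal polynomials of \<open>\<alpha>\<close> and \<open>\<beta>\<close>, is a non-zero integer.\<close>

lemma conjugate_pairs:
  assumes "algebraic \<alpha>" "algebraic \<beta>" "degree_over_rat (rat_adjoin {\<alpha>, \<beta>}) \<le> d"
  shows "\<exists>D x y. 0 < D \<and> D \<le> d \<and> x 0 = \<alpha> \<and> y 0 = \<beta> \<and>
    (\<forall>T p. bipoly T p \<alpha> \<beta> \<noteq> 0 \<longrightarrow>
      (\<Prod>i<D. (max 1 (cmod (x i)) * max 1 (cmod (y i))) ^ T) \<le>
      (\<Prod>i<D. cmod (bipoly T p (x i) (y i))) * (height \<alpha> * height \<beta>) ^ (T * D))"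
proof -
  obtain c g A B where g: "is_minpoly \<rat> g c" "degree g \<le> degree_over_rat (rat_adjoin {\<alpha>, \<beta>})"
    and AB: "A \<in> polys_over \<rat>" "B \<in> polys_over \<rat>" "\<alpha> = poly A c" "\<beta> = poly B c"
    using primitive_element[OF assms(1,2)] by blast
  obtain w where w: "w 0 = c" "proots g = image_mset w (mset_set {..<degree g})"
    using conjugates_enumeration[OF g(1)] by blast
  define D where "D = degree g"
  define x y where "x i = poly A (w i)" and "y i = poly B (w i)" for i
  obtain a :: int where a: "a > 0" "\<And>I. I \<subseteq> {..<D} \<Longrightarrow> integral_elt (of_int a * (\<Prod>i\<in>I. x i))"
    "height \<alpha> ^ D = of_int a * (\<Prod>i<D. max 1 (cmod (x i)))"
    using conjugates_integrality_and_height[OF g(1) w(2) AB(1)] assms AB unfolding D_def x_def by auto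
  obtain b :: int where b: "b > 0" "\<And>I. I \<subseteq> {..<D} \<Longrightarrow> integral_elt (of_int b * (\<Prod>i\<in>I. y i))"
    "height \<beta> ^ D = of_int b * (\<Prod>i<D. max 1 (cmod (y i)))"
    using conjugates_integrality_and_height[OF g(1) w(2) AB(2)] assms AB unfolding D_def y_def by auto
  have "(\<Prod>i<D. (max 1 (cmod (x i)) * max 1 (cmod (y i))) ^ T) \<le>
      (\<Prod>i<D. cmod (bipoly T p (x i) (y i))) * (height \<alpha> * height \<beta>) ^ (T * D)"
    if nz: "bipoly T p \<alpha> \<beta> \<noteq> 0" for T p
  proof -
    define R where "R = (\<Sum>i\<le>T. \<Sum>j\<le>T. smult (of_int (p i j)) (A ^ i * B ^ j))"
    have R: "R \<in> polys_over \<rat>" unfolding R_def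
      using AB by (intro rats.polys_sum rats.polys_smult rats.polys_mult rats.polys_power) auto
    have eval: "poly R z = bipoly T p (poly A z) (poly B z)" for z
      by (simp add: R_def bipoly_def poly_sum mult.assoc)
    define P where "P = (\<Prod>i<D. bipoly T p (x i) (y i))"
    have "P \<in> \<rat>" using prod_conjugates_in_Rats[OF g(1) w(2) R] by (simp add: P_def D_def x_def y_def eval)
    hence "of_int (a ^ T * b ^ T) * P \<in> \<rat>" by simp
    moreover have "integral_elt (of_int (a ^ T * b ^ T) * P)"
      using prod_bipoly_integral[OF a(2) b(2)] by (simp add: P_def)
    ultimately have "of_int (a ^ T * b ^ T) * P \<in> \<int>" by (rule integral_elt_Rats_imp_Ints[rotated])
    then obtain N :: int where N: "of_int (a ^ T * b ^ T) * P = of_int N" by (auto elim: Ints_cases)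
    have "bipoly T p (x i) (y i) \<noteq> 0" if "i < D" for i
    proof
      assume "bipoly T p (x i) (y i) = 0"
      hence "poly R (w i) = 0" by (simp add: eval x_def y_def)
      hence "poly R c = 0"
        using rats.minpoly_same_zeros[OF g(1) conjugate_root[OF g(1) w(2)] R] that by (simp add: D_def)
      thus False using nz by (simp add: eval AB)
    qed
    hence "P \<noteq> 0" by (simp add: P_def)
    hence "N \<noteq> 0" using N a b by auto
    hence "1 \<le> cmod (of_int N)" by (simp add: norm_of_int)
    also have "\<dots> = of_int (a ^ T * b ^ T) * cmod P"
      unfolding N[symmetric] using a b by (simp add: norm_mult norm_power)
    finally have N1: "1 \<le> of_int (a ^ T * b ^ T) * cmod P" .
    let ?X = "\<Prod>i<D. max 1 (cmod (x i))" and ?Y = "\<Prod>i<D. max 1 (cmod (y i))"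
    have XY: "0 \<le> ?X" "0 \<le> ?Y" by (auto intro!: prod_nonneg)
    have "(\<Prod>i<D. (max 1 (cmod (x i)) * max 1 (cmod (y i))) ^ T) = (?X * ?Y) ^ T"
      by (simp add: prod.distrib flip: prod_power_distrib)
    also have "\<dots> \<le> (?X * ?Y) ^ T * (of_int (a ^ T * b ^ T) * cmod P)"
      using mult_left_mono[OF N1, of "(?X * ?Y) ^ T"] XY by simp
    also have "\<dots> = cmod P * ((height \<alpha> ^ D) * (height \<beta> ^ D)) ^ T"
      unfolding a(3) b(3) by (simp add: power_mult_distrib)
    also have "(height \<alpha> ^ D * height \<beta> ^ D) ^ T = (height \<alpha> * height \<beta>) ^ (T * D)"
      by (simp add: mult.commute flip: power_mult_distrib power_mult)
    finally show ?thesis by (simp add: P_def prod_norm)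
  qed
  moreover have "0 < D" "D \<le> d"
    using rats.minpoly_degree_pos[OF g(1)] g(2) assms(3) by (auto simp: D_def)
  moreover have "x 0 = \<alpha>" "y 0 = \<beta>" using w(1) AB by (auto simp: x_def y_def)
  ultimately show ?thesis by (intro exI[of _ D] exI[of _ x] exI[of _ y]) auto
qed

section \<open>Normalised values and Liouville's inequality\<close>

lemma bipoly_diff: "bipoly T (\<lambda>i j. p i j - q i j) x y = bipoly T p x y - bipoly T q x y"
  by (simp add: bipoly_def sum_subtractf algebra_simps)

lemma cmod_bipoly_le:
  assumes "\<And>i j. i \<le> T \<Longrightarrow> j \<le> T \<Longrightarrow> \<bar>p i j\<bar> \<le> int B"
  shows "cmod (bipoly T p x y) \<le> (real T + 1)\<^sup>2 * real B * (max 1 (cmod x) * max 1 (cmod y)) ^ T"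
proof -
  have "cmod (bipoly T p x y) \<le> (\<Sum>i\<le>T. \<Sum>j\<le>T. real B * (max 1 (cmod x) ^ T * max 1 (cmod y) ^ T))"
    unfolding bipoly_def
  proof (intro order.trans[OF norm_sum] sum_mono)
    fix i j assume ij: "i \<in> {..T}" "j \<in> {..T}"
    have pow: "cmod u ^ k \<le> max 1 (cmod u) ^ T" if "k \<le> T" for u k
      using power_mono[of "cmod u" "max 1 (cmod u)" k] power_increasing[OF that, of "max 1 (cmod u)"] by simp
    have "\<bar>real_of_int (p i j)\<bar> \<le> real B" using assms[of i j] ij
      by (metis atMost_iff of_int_abs of_int_le_iff of_int_of_nat_eq)
    thus "cmod (of_int (p i j) * x ^ i * y ^ j) \<le> real B * (max 1 (cmod x) ^ T * max 1 (cmod y) ^ T)"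
      using pow[of i x] pow[of j y] ij
      unfolding norm_mult norm_power mult.assoc by (intro mult_mono) auto
  qed
  also have "\<dots> = (real T + 1)\<^sup>2 * real B * (max 1 (cmod x) * max 1 (cmod y)) ^ T"
    by (simp add: power2_eq_square power_mult_distrib algebra_simps)
  finally show ?thesis .
qed

text \<open>The denominator makes the value bounded at all pairs (x, y), however large the
  conjugates are. The product of these denominators over all conjugates is what the heights account
  for.\<close>

definition normalized_value :: "nat \<Rightarrow> (nat \<Rightarrow> nat \<Rightarrow> int) \<Rightarrow> complex \<Rightarrow> complex \<Rightarrow> complex" where
  "normalized_value T p x y = bipoly T p x y / of_real ((max 1 (cmod x) * max 1 (cmod y)) ^ T)"

lemma normalized_value_diff:
  "normalized_value T (\<lambda>i j. p i j - q i j) x y = normalized_value T p x y - normalized_value T q x y"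
  by (simp add: normalized_value_def bipoly_diff diff_divide_distrib)

lemma cmod_normalized_value_le:
  assumes "\<And>i j. i \<le> T \<Longrightarrow> j \<le> T \<Longrightarrow> \<bar>p i j\<bar> \<le> int B"
  shows "cmod (normalized_value T p x y) \<le> (real T + 1)\<^sup>2 * real B"
proof -
  have "(max 1 (cmod x) * max 1 (cmod y)) ^ T > 0" by simp
  thus ?thesis using cmod_bipoly_le[OF assms]
    unfolding normalized_value_def norm_divide norm_of_real by (simp add: pos_divide_le_eq)
qed

text \<open>The pairs are chosen before T and p: \<open>siegel\<close> first imposes conditions at
  all of them and only then finds p. If every factor of the product is below 1, the value at the
  original pair must vanish.\<close>

lemma normalized_conjugate_pairs:
  assumes "algebraic \<alpha>" "algebraic \<beta>" "degree_over_rat (rat_adjoin {\<alpha>, \<beta>}) \<le> d"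
    and "height \<alpha> \<le> H" "height \<beta> \<le> H"
  shows "\<exists>D x y. 0 < D \<and> D \<le> d \<and> x 0 = \<alpha> \<and> y 0 = \<beta> \<and>
    (\<forall>T p. bipoly T p \<alpha> \<beta> \<noteq> 0 \<longrightarrow>
      1 \<le> (\<Prod>i<D. cmod (normalized_value T p (x i) (y i)) * H ^ (2 * T)))"
proof -
  obtain D x y where Dxy: "0 < D" "D \<le> d" "x 0 = \<alpha>" "y 0 = \<beta>"
    and main: "\<And>T p. bipoly T p \<alpha> \<beta> \<noteq> 0 \<Longrightarrow>
      (\<Prod>i<D. (max 1 (cmod (x i)) * max 1 (cmod (y i))) ^ T) \<le>
      (\<Prod>i<D. cmod (bipoly T p (x i) (y i))) * (height \<alpha> * height \<beta>) ^ (T * D)"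
    using conjugate_pairs[OF assms(1-3)] by blast
  have "1 \<le> (\<Prod>i<D. cmod (normalized_value T p (x i) (y i)) * H ^ (2 * T))"
    if nz: "bipoly T p \<alpha> \<beta> \<noteq> 0" for T p
  proof -
    let ?m = "\<lambda>i. (max 1 (cmod (x i)) * max 1 (cmod (y i))) ^ T"
    have h: "0 \<le> height \<alpha>" "0 \<le> height \<beta>"
      using height_power_eq(2) algebraic_imp_minpoly assms(1,2) by blast+
    have pos: "(\<Prod>i<D. ?m i) > 0" by (intro prod_pos) simp
    have "(\<Prod>i<D. ?m i) \<le> (\<Prod>i<D. cmod (bipoly T p (x i) (y i))) * (height \<alpha> * height \<beta>) ^ (T * D)"
      by (rule main[OF nz])
    also have "\<dots> \<le> (\<Prod>i<D. cmod (bipoly T p (x i) (y i))) * (H * H) ^ (T * D)"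
      using h assms(4,5) by (intro mult_left_mono power_mono mult_mono prod_nonneg) auto
    also have "\<dots> = (\<Prod>i<D. cmod (bipoly T p (x i) (y i)) * H ^ (2 * T))"
      by (simp add: prod.distrib power_mult power2_eq_square)
    finally have "1 \<le> (\<Prod>i<D. cmod (bipoly T p (x i) (y i)) * H ^ (2 * T)) / (\<Prod>i<D. ?m i)"
      using pos by simp
    also have "\<dots> = (\<Prod>i<D. cmod (bipoly T p (x i) (y i)) * H ^ (2 * T) / ?m i)"
      by (simp add: prod_dividef)
    also have "\<dots> = (\<Prod>i<D. cmod (normalized_value T p (x i) (y i)) * H ^ (2 * T))"
      by (simp add: normalized_value_def norm_divide norm_power norm_mult flip: of_real_mult of_real_power)
    finally show ?thesis .
  qed
  thus ?thesis using Dxy by (intro exI[of _ D] exI[of _ x] exI[of _ y]) auto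
qed

text \<open>In the product over the conjugates, factor 0 is at most the modulus of the value itself,
  and every other factor is at most M.\<close>

lemma liouville:
  assumes "algebraic \<alpha>" "algebraic \<beta>" "degree_over_rat (rat_adjoin {\<alpha>, \<beta>}) \<le> d"
    and "height \<alpha> \<le> H" "height \<beta> \<le> H" "1 \<le> H" "1 \<le> M"
    and M: "\<And>x y. cmod (normalized_value T p x y) \<le> M" and nz: "bipoly T p \<alpha> \<beta> \<noteq> 0"
  shows "1 \<le> cmod (bipoly T p \<alpha> \<beta>) * M ^ d * H ^ (2 * T * d)"
proof -
  obtain D x y where D: "0 < D" "D \<le> d" "x 0 = \<alpha>" "y 0 = \<beta>"
    and main: "1 \<le> (\<Prod>i<D. cmod (normalized_value T p (x i) (y i)) * H ^ (2 * T))"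
    using normalized_conjugate_pairs[OF assms(1-5)] nz by blast
  have "(\<Prod>i<D. cmod (normalized_value T p (x i) (y i))) =
      cmod (normalized_value T p \<alpha> \<beta>) * (\<Prod>i\<in>{..<D} - {0}. cmod (normalized_value T p (x i) (y i)))"
    using D by (subst prod.remove[of _ 0]) auto
  also have "\<dots> \<le> cmod (bipoly T p \<alpha> \<beta>) * (\<Prod>i\<in>{..<D} - {0}. M)"
  proof (intro mult_mono prod_mono prod_nonneg)
    have "1 * 1 \<le> max 1 (cmod \<alpha>) * max 1 (cmod \<beta>)" by (intro mult_mono) auto
    hence "1 \<le> (max 1 (cmod \<alpha>) * max 1 (cmod \<beta>)) ^ T" by simp
    thus "cmod (normalized_value T p \<alpha> \<beta>) \<le> cmod (bipoly T p \<alpha> \<beta>)"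
      unfolding normalized_value_def norm_divide norm_of_real
      by (subst abs_of_nonneg) (auto simp: divide_le_eq mult_le_cancel_left1)
  qed (use M in auto)
  also have "(\<Prod>i\<in>{..<D} - {0}. M) \<le> M ^ d"
    using \<open>1 \<le> M\<close> D by (simp add: power_increasing)
  finally have 1: "(\<Prod>i<D. cmod (normalized_value T p (x i) (y i))) \<le> cmod (bipoly T p \<alpha> \<beta>) * M ^ d"
    by (simp add: mult_left_mono)
  have "H ^ (2 * T * D) \<le> H ^ (2 * T * d)" using assms(6) D by (intro power_increasing) auto
  with 1 have "(\<Prod>i<D. cmod (normalized_value T p (x i) (y i))) * H ^ (2 * T * D) \<le>
      cmod (bipoly T p \<alpha> \<beta>) * M ^ d * H ^ (2 * T * d)"
    using \<open>1 \<le> M\<close> \<open>1 \<le> H\<close> by (intro mult_mono) auto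
  thus ?thesis using main by (simp add: prod.distrib power_mult)
qed

text \<open>The pigeonhole principle is applied to all conjugates at once, so that each point costs at
  most \<open>2 * d\<close> real conditions; a small value at all conjugates vanishes by
  \<open>normalized_conjugate_pairs\<close>.\<close>

lemma siegel:
  fixes f :: "complex \<Rightarrow> complex" and B d T :: nat and H :: real
  assumes Z: "finite Z" "Z \<noteq> {}" "4 * d * card Z \<le> (T + 1)\<^sup>2"
    and alg: "\<And>\<alpha>. \<alpha> \<in> Z \<Longrightarrow> algebraic \<alpha>" "\<And>\<alpha>. \<alpha> \<in> Z \<Longrightarrow> algebraic (f \<alpha>)"
      "\<And>\<alpha>. \<alpha> \<in> Z \<Longrightarrow> degree_over_rat (rat_adjoin {\<alpha>, f \<alpha>}) \<le> d"
      "\<And>\<alpha>. \<alpha> \<in> Z \<Longrightarrow> height \<alpha> \<le> H" "\<And>\<alpha>. \<alpha> \<in> Z \<Longrightarrow> height (f \<alpha>) \<le> H"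
    and H: "1 \<le> H" and B: "8 * (real T + 1)\<^sup>2 * H ^ (2 * T) \<le> real B + 1" "B \<ge> 1"
  shows "\<exists>p. (\<forall>i\<le>T. \<forall>j\<le>T. \<bar>p i j\<bar> \<le> int B) \<and> (\<exists>i\<le>T. \<exists>j\<le>T. p i j \<noteq> 0) \<and>
    (\<forall>\<alpha>\<in>Z. bipoly T p \<alpha> (f \<alpha>) = 0)"
proof -
  define Q where "Q \<alpha> D x y \<longleftrightarrow> 0 < D \<and> D \<le> d \<and> x 0 = \<alpha> \<and> y 0 = f \<alpha> \<and>
    (\<forall>T p. bipoly T p \<alpha> (f \<alpha>) \<noteq> 0 \<longrightarrow>
      1 \<le> (\<Prod>i<D. cmod (normalized_value T p (x i) (y i)) * H ^ (2 * T)))" for \<alpha> D x y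
  have "\<forall>\<alpha>\<in>Z. \<exists>D x y. Q \<alpha> D x y"
    unfolding Q_def by (intro ballI normalized_conjugate_pairs alg)
  then obtain D x y where Q: "\<And>\<alpha>. \<alpha> \<in> Z \<Longrightarrow> Q \<alpha> (D \<alpha>) (x \<alpha>) (y \<alpha>)" by metis
  have D: "0 < D \<alpha>" "D \<alpha> \<le> d" if "\<alpha> \<in> Z" for \<alpha>
    using Q[OF that] unfolding Q_def by blast+
  have main: "1 \<le> (\<Prod>i<D \<alpha>. cmod (normalized_value T p (x \<alpha> i) (y \<alpha> i)) * H ^ (2 * T))"
    if "\<alpha> \<in> Z" "bipoly T p \<alpha> (f \<alpha>) \<noteq> 0" for \<alpha> T p
    using Q[OF that(1)] that(2) unfolding Q_def by blast
  \<comment> \<open>Two scaled values in the same unit square differ by less than 2, so the unscaled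
    ones differ by less than \<open>1 / H ^ (2 * T)\<close>, the threshold of the norm
    inequality.\<close>
  define s where "s = 2 * H ^ (2 * T)"
  have s: "s \<ge> 2" unfolding s_def using H by simp
  define M where "M = (real T + 1)\<^sup>2 * real B"
  define K where "K = nat \<lceil>M * s\<rceil>"
  define P :: "(nat \<times> nat \<Rightarrow> nat) set" where "P = PiE ({..T} \<times> {..T}) (\<lambda>_. {..B})"
  define J where "J = Sigma Z (\<lambda>\<alpha>. {..<D \<alpha>})"
  define L where "L q t = of_real s * normalized_value T (\<lambda>i j. int (q (i, j))) (x (fst t) (snd t)) (y (fst t) (snd t))"
    for q :: "nat \<times> nat \<Rightarrow> nat" and t :: "complex \<times> nat"
  define \<Phi> where "\<Phi> q = (\<lambda>t\<in>J. (\<lfloor>Re (L q t)\<rfloor>, \<lfloor>Im (L q t)\<rfloor>))" for q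
  let ?box = "{- int K - 1..int K} \<times> {- int K - 1..int K}"
  have finJ: "finite J" unfolding J_def using Z by auto
  have cardJ: "card J \<le> d * card Z"
  proof -
    have "card J = (\<Sum>\<alpha>\<in>Z. D \<alpha>)" unfolding J_def using Z by (simp add: card_SigmaI)
    also have "\<dots> \<le> (\<Sum>\<alpha>\<in>Z. d)" using D by (intro sum_mono) auto
    finally show ?thesis by (simp add: mult.commute)
  qed
  have "\<Phi> ` P \<subseteq> PiE J (\<lambda>_. ?box)"
  proof (rule image_subsetI)
    fix q assume q: "q \<in> P"
    have "(\<lfloor>Re (L q t)\<rfloor>, \<lfloor>Im (L q t)\<rfloor>) \<in> ?box" for t
    proof -
      have "cmod (L q t) \<le> s * M"
        unfolding L_def norm_mult norm_of_real M_def using s q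
        by (auto simp: P_def PiE_iff intro!: mult_left_mono cmod_normalized_value_le)
      hence "\<bar>Re (L q t)\<bar> \<le> real K" "\<bar>Im (L q t)\<bar> \<le> real K"
        using abs_Re_le_cmod[of "L q t"] abs_Im_le_cmod[of "L q t"] unfolding K_def
        by (auto simp: mult.commute) linarith+
      thus ?thesis by (auto simp: floor_le_iff le_floor_iff abs_le_iff)
    qed
    thus "\<Phi> q \<in> PiE J (\<lambda>_. ?box)" unfolding \<Phi>_def by (auto simp: restrict_def)
  qed
  hence "card (\<Phi> ` P) \<le> card (PiE J (\<lambda>_. ?box))"
    using finJ by (intro card_mono finite_PiE) auto
  also have "\<dots> = ((2 * K + 2)\<^sup>2) ^ card J"
  proof -
    have "int K - (- int K - 1) + 1 = int (2 * K + 2)" by simp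
    hence "card {- int K - 1..int K} = 2 * K + 2" by (simp only: card_atLeastAtMost_int nat_int)
    thus ?thesis using finJ by (simp add: card_PiE card_cartesian_product power2_eq_square del: card_atLeastAtMost_int)
  qed
  also have "\<dots> \<le> ((2 * K + 2)\<^sup>2) ^ (d * card Z)"
    using cardJ by (intro power_increasing) auto
  \<comment> \<open>The lower bound on B gives \<open>2 * K + 2 < (B + 1)\<^sup>2\<close>, so each
    conjugate pair, having a real and an imaginary part, costs less than the fourth power of B + 1.
    This is the origin of the factor 4 in the condition on \<open>card Z\<close>.\<close>
  also have "\<dots> < (((B + 1)\<^sup>2)\<^sup>2) ^ (d * card Z)"
  proof (rule power_strict_mono)
    have "real (2 * K + 2) < (real B + 1)\<^sup>2"
    proof -
      have "M \<ge> 1" using B(2) one_le_power[of "real T + 1" 2] mult_mono[of 1 "(real T + 1)\<^sup>2" 1 "real B"]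
        by (simp add: M_def)
      hence "M * H ^ (2 * T) \<ge> 1" using H mult_mono[of 1 M 1 "H ^ (2 * T)"] by simp
      moreover have "M * s \<ge> 0" using \<open>M \<ge> 1\<close> s by simp
      hence "real K \<le> M * s + 1" unfolding K_def by linarith
      ultimately have "real (2 * K + 2) \<le> 8 * (M * H ^ (2 * T))" by (simp add: s_def)
      also have "\<dots> = (8 * (real T + 1)\<^sup>2 * H ^ (2 * T)) * real B" by (simp add: M_def)
      also have "\<dots> \<le> (real B + 1) * real B" using B(1) by (intro mult_right_mono) auto
      also have "\<dots> < (real B + 1)\<^sup>2" by (simp add: power2_eq_square algebra_simps)
      finally show ?thesis .
    qed
    thus "(2 * K + 2)\<^sup>2 < ((B + 1)\<^sup>2)\<^sup>2"
      by (intro power_strict_mono) (metis of_nat_Suc of_nat_less_iff of_nat_power Suc_eq_plus1 add.commute, auto)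
    have "d > 0" using D Z(2) by fastforce
    thus "d * card Z > 0" using Z by (simp add: card_gt_0_iff)
  qed auto
  also have "\<dots> = (B + 1) ^ (4 * d * card Z)" by (simp add: mult.assoc flip: power_mult)
  also have "\<dots> \<le> (B + 1) ^ ((T + 1)\<^sup>2)" using Z(3) by (intro power_increasing) auto
  also have "\<dots> = card P" unfolding P_def by (simp add: card_PiE power2_eq_square)
  finally have "\<not> inj_on \<Phi> P" by (rule pigeonhole)
  then obtain q q' where q: "q \<in> P" "q' \<in> P" "q \<noteq> q'" "\<Phi> q = \<Phi> q'" by (auto simp: inj_on_def)
  define p where "p i j = int (q (i, j)) - int (q' (i, j))" for i j
  have "\<bar>p i j\<bar> \<le> int B" if "i \<le> T" "j \<le> T" for i j
    using q(1,2) that by (force simp: p_def P_def PiE_iff)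
  moreover have "\<exists>i\<le>T. \<exists>j\<le>T. p i j \<noteq> 0"
  proof -
    obtain t where "t \<in> {..T} \<times> {..T}" "q t \<noteq> q' t"
      using q(1-3) unfolding P_def by (metis PiE_ext)
    thus ?thesis unfolding p_def by (cases t) force
  qed
  moreover have "bipoly T p \<alpha> (f \<alpha>) = 0" if \<alpha>: "\<alpha> \<in> Z" for \<alpha>
  proof (rule ccontr)
    assume "bipoly T p \<alpha> (f \<alpha>) \<noteq> 0"
    hence ge: "1 \<le> (\<Prod>i<D \<alpha>. cmod (normalized_value T p (x \<alpha> i) (y \<alpha> i)) * H ^ (2 * T))"
      by (rule main[OF \<alpha>])
    let ?v = "\<lambda>i. cmod (normalized_value T p (x \<alpha> i) (y \<alpha> i)) * H ^ (2 * T)"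
    have small: "0 \<le> ?v i \<and> ?v i < 1" if i: "i < D \<alpha>" for i
    proof -
      define t where "t = (\<alpha>, i)"
      have "t \<in> J" using \<alpha> i by (simp add: t_def J_def)
      hence "\<lfloor>Re (L q t)\<rfloor> = \<lfloor>Re (L q' t)\<rfloor>" "\<lfloor>Im (L q t)\<rfloor> = \<lfloor>Im (L q' t)\<rfloor>"
        using fun_cong[OF q(4), of t] by (auto simp: \<Phi>_def)
      hence "\<bar>Re (L q t - L q' t)\<bar> < 1" "\<bar>Im (L q t - L q' t)\<bar> < 1"
        by (simp; linarith)+
      hence "cmod (L q t - L q' t) < 2" using cmod_le[of "L q t - L q' t"] by linarith
      moreover have "L q t - L q' t = of_real s * normalized_value T p (x \<alpha> i) (y \<alpha> i)"
        by (simp add: L_def t_def p_def[abs_def] normalized_value_diff right_diff_distrib)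
      ultimately have "s * cmod (normalized_value T p (x \<alpha> i) (y \<alpha> i)) < 2"
        using s by (simp add: norm_mult)
      thus ?thesis using H by (simp add: s_def mult.commute)
    qed
    have "(\<Prod>i<D \<alpha>. ?v i) < (\<Prod>i<D \<alpha>. 1)"
      using D(1)[OF \<alpha>] small by (intro prod_mono_strict[of 0]) (auto intro: less_imp_le)
    thus False using ge by simp
  qed
  ultimately show ?thesis by (intro exI[of _ p]) auto
qed

section \<open>Blaschke products\<close>

lemma cmod_blaschke_identity:
  "(cmod (1 - cnj w * z))\<^sup>2 - (cmod (z - w))\<^sup>2 = (1 - (cmod z)\<^sup>2) * (1 - (cmod w)\<^sup>2)"
  unfolding cmod_power2 by (simp add: power2_eq_square) algebra

lemma blaschke_denominator_nonzero:
  assumes "cmod z < 1" "cmod w < 1"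
  shows "1 - cnj w * z \<noteq> 0"
proof
  assume "1 - cnj w * z = 0"
  hence "cmod (cnj w * z) = 1" by (metis eq_iff_diff_eq_0 norm_one)
  moreover have "cmod w * cmod z < 1"
    using assms mult_strict_mono[of "cmod w" 1 "cmod z" 1] by simp
  ultimately show False by (simp add: norm_mult)
qed

lemma cmod_blaschke_less_1:
  assumes "cmod z < 1" "cmod w < 1"
  shows "cmod ((z - w) / (1 - cnj w * z)) < 1"
proof -
  have "(1 - (cmod z)\<^sup>2) * (1 - (cmod w)\<^sup>2) > 0"
    using assms by (intro mult_pos_pos) (simp_all add: power_less_one_iff)
  hence "(cmod (z - w))\<^sup>2 < (cmod (1 - cnj w * z))\<^sup>2" using cmod_blaschke_identity[of w z] by linarith
  hence "cmod (z - w) < cmod (1 - cnj w * z)" by (rule power_less_imp_less_base) simp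
  thus ?thesis using blaschke_denominator_nonzero[OF assms] by (simp add: norm_divide)
qed

text \<open>By the identity, the squared modulus is 1 minus a quotient with denominator at most 4
  and numerator at least (1 - |z|)(1 - |w|). The constant 8 is 4 doubled by taking the square
  root.\<close>

lemma cmod_blaschke_le_exp:
  assumes "cmod z < 1" "cmod w < 1"
  shows "cmod ((z - w) / (1 - cnj w * z)) \<le> exp (- ((1 - cmod z) * (1 - cmod w) / 8))"
proof -
  define t where "t = (1 - cmod z) * (1 - cmod w)"
  define m where "m = (cmod (1 - cnj w * z))\<^sup>2"
  have m: "m > 0" unfolding m_def using blaschke_denominator_nonzero[OF assms] by simp
  have "cmod (1 - cnj w * z) \<le> 1 + cmod w * cmod z"
    using norm_triangle_ineq4[of 1 "cnj w * z"] by (simp add: norm_mult)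
  also have "\<dots> \<le> 1 + 1 * 1" using assms by (intro add_mono mult_mono) auto
  finally have "m \<le> 2\<^sup>2" unfolding m_def by (intro power_mono) auto
  hence m4: "m \<le> 4" by simp
  have "t * 1 \<le> t * ((1 + cmod z) * (1 + cmod w))"
    using assms mult_mono[of 1 "1 + cmod z" 1 "1 + cmod w"] by (intro mult_left_mono) (auto simp: t_def)
  also have "\<dots> = (1 - (cmod z)\<^sup>2) * (1 - (cmod w)\<^sup>2)"
    by (simp add: t_def power2_eq_square algebra_simps)
  finally have t_le: "t \<le> m - (cmod (z - w))\<^sup>2"
    using cmod_blaschke_identity[of w z] by (simp add: m_def)
  have "t \<ge> 0" using assms by (simp add: t_def)
  have "(cmod ((z - w) / (1 - cnj w * z)))\<^sup>2 = (cmod (z - w))\<^sup>2 / m"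
    by (simp add: norm_divide power_divide m_def)
  also have "\<dots> \<le> (m - t) / m" using t_le m by (intro divide_right_mono) auto
  also have "\<dots> = 1 - t / m" using m by (simp add: diff_divide_distrib)
  also have "\<dots> \<le> 1 - t / 4" using m m4 \<open>t \<ge> 0\<close> divide_left_mono[of m 4 t] by simp
  also have "\<dots> \<le> exp (- (t / 4))" using exp_ge_add_one_self[of "- (t / 4)"] by simp
  also have "\<dots> = (exp (- (t / 8)))\<^sup>2" by (simp flip: exp_double)
  finally have "cmod ((z - w) / (1 - cnj w * z)) \<le> exp (- (t / 8))"
    by (rule power2_le_imp_le) simp
  thus ?thesis by (simp add: t_def)
qed

text \<open>Schwarz's lemma for G composed with the disk automorphism taking 0 to w. Schwarz's lemma
  asks for a strict bound, whereas G is only bounded by M, so G is divided by M' > M and M' tends to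
  M.\<close>

lemma bounded_zero_le_blaschke:
  assumes hol: "G holomorphic_on ball 0 1" and bound: "\<And>z. cmod z < 1 \<Longrightarrow> cmod (G z) \<le> M" and "M > 0"
    and w: "cmod w < 1" "G w = 0" and z: "cmod z < 1"
  shows "cmod (G z) \<le> M * cmod ((z - w) / (1 - cnj w * z))"
proof -
  define \<psi> where "\<psi> = (\<lambda>\<zeta>. (\<zeta> + w) / (1 + cnj w * \<zeta>))"
  define \<zeta> where "\<zeta> = (z - w) / (1 - cnj w * z)"
  have nz: "1 + cnj w * u \<noteq> 0" if "cmod u < 1" for u
    using blaschke_denominator_nonzero[of u "- w"] that w by simp
  have \<psi>: "cmod (\<psi> u) < 1" if "cmod u < 1" for u
    using cmod_blaschke_less_1[of u "- w"] that w by (simp add: \<psi>_def)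
  have \<zeta>: "cmod \<zeta> < 1" unfolding \<zeta>_def by (rule cmod_blaschke_less_1[OF z w(1)])
  have "\<psi> \<zeta> = z"
  proof -
    have d: "1 - cnj w * z \<noteq> 0" by (rule blaschke_denominator_nonzero[OF z w(1)])
    have "\<zeta> + w = z * (1 - cnj w * w) / (1 - cnj w * z)"
      using d by (simp add: \<zeta>_def field_simps)
    moreover have "1 + cnj w * \<zeta> = (1 - cnj w * w) / (1 - cnj w * z)"
      using d by (simp add: \<zeta>_def field_simps)
    moreover have "1 - cnj w * w \<noteq> 0" by (rule blaschke_denominator_nonzero[OF w(1) w(1)])
    ultimately show ?thesis using d by (simp add: \<psi>_def)
  qed
  have "cmod (G z) \<le> M' * cmod \<zeta>" if M': "M' > M" for M'
  proof -
    have "cmod (G (\<psi> \<zeta>) / of_real M') \<le> cmod \<zeta>"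
    proof (rule Schwarz_Lemma(1)[where f = "\<lambda>u. G (\<psi> u) / of_real M'"])
      have "\<psi> holomorphic_on ball 0 1" unfolding \<psi>_def using nz by (intro holomorphic_intros) auto
      hence "(G \<circ> \<psi>) holomorphic_on ball 0 1"
        by (rule holomorphic_on_compose_gen[OF _ hol]) (use \<psi> in auto)
      thus "(\<lambda>u. G (\<psi> u) / of_real M') holomorphic_on ball 0 1"
        using M' \<open>M > 0\<close> by (intro holomorphic_intros) (auto simp: comp_def)
      show "G (\<psi> 0) / of_real M' = 0" using w by (simp add: \<psi>_def)
      show "cmod (G (\<psi> u) / of_real M') < 1" if "cmod u < 1" for u
        using bound[OF \<psi>[OF that]] M' \<open>M > 0\<close> by (simp add: norm_divide)
    qed (rule \<zeta>)
    thus ?thesis using M' \<open>M > 0\<close> \<open>\<psi> \<zeta> = z\<close> by (simp add: norm_divide field_simps)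
  qed
  hence *: "cmod (G z) \<le> (M + e) * cmod \<zeta>" if "e > 0" for e using that by simp
  have "cmod (G z) \<le> M * cmod \<zeta> + e" if "e > 0" for e
  proof -
    have "e * cmod \<zeta> \<le> e * 1" using that \<zeta> by (intro mult_left_mono) auto
    thus ?thesis using *[OF that] by (simp add: distrib_right)
  qed
  hence "cmod (G z) \<le> M * cmod \<zeta>" by (rule field_le_epsilon)
  thus ?thesis by (simp add: \<zeta>_def)
qed

text \<open>Off w the quotient inherits the bound M because G is at most M times the Blaschke factor
  there; at w, where the singularity is removed by the derivative, the bound follows by
  continuity.\<close>

lemma blaschke_factor:
  assumes hol: "G holomorphic_on ball 0 1" and bound: "\<And>z. cmod z < 1 \<Longrightarrow> cmod (G z) \<le> M" and "M > 0"
    and w: "cmod w < 1" "G w = 0"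
  shows "\<exists>G'. G' holomorphic_on ball 0 1 \<and> (\<forall>z. cmod z < 1 \<longrightarrow> cmod (G' z) \<le> M) \<and>
    (\<forall>z. cmod z < 1 \<longrightarrow> G z = (z - w) / (1 - cnj w * z) * G' z)"
proof -
  define G' where "G' = (\<lambda>z. (if z = w then deriv G w else (G z - G w) / (z - w)) * (1 - cnj w * z))"
  have hol': "G' holomorphic_on ball 0 1"
    unfolding G'_def using w by (intro holomorphic_intros pole_lemma[OF hol]) auto
  have eq: "G z = (z - w) / (1 - cnj w * z) * G' z" if "cmod z < 1" for z
    using blaschke_denominator_nonzero[OF that w(1)] w by (simp add: G'_def)
  have le: "cmod (G' z) \<le> M" if "cmod z < 1" "z \<noteq> w" for z
  proof -
    let ?b = "cmod ((z - w) / (1 - cnj w * z))"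
    have "?b > 0" using that blaschke_denominator_nonzero[OF that(1) w(1)] by simp
    moreover have "?b * cmod (G' z) \<le> M * ?b"
      using bounded_zero_le_blaschke[OF hol bound \<open>M > 0\<close> w that(1)] eq[OF that(1)] by (metis norm_mult)
    ultimately show ?thesis by (simp add: mult.commute[of ?b])
  qed
  have "cmod (G' w) \<le> M"
  proof (rule tendsto_upperbound)
    have "isCont G' w"
      using holomorphic_on_imp_continuous_on[OF hol'] w continuous_on_interior[of "ball 0 1" G' w] by simp
    thus "((\<lambda>z. cmod (G' z)) \<longlongrightarrow> cmod (G' w)) (at w)" by (simp add: isCont_def tendsto_norm)
    have "\<forall>\<^sub>F z in at w. z \<in> ball 0 1"
      using w by (intro eventually_at_in_open') auto
    moreover have "\<forall>\<^sub>F z in at w. z \<noteq> w" by (simp add: eventually_at_filter)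
    ultimately show "\<forall>\<^sub>F z in at w. cmod (G' z) \<le> M" by eventually_elim (auto intro: le)
  qed simp
  thus ?thesis using hol' eq le by (intro exI[of _ G']) metis
qed

lemma bounded_le_blaschke_product:
  assumes "finite Z" "G holomorphic_on ball 0 1" "\<And>z. cmod z < 1 \<Longrightarrow> cmod (G z) \<le> M" "M > 0"
    and "\<And>w. w \<in> Z \<Longrightarrow> cmod w < 1" "\<And>w. w \<in> Z \<Longrightarrow> G w = 0" and z: "cmod z < 1"
  shows "cmod (G z) \<le> M * (\<Prod>w\<in>Z. cmod ((z - w) / (1 - cnj w * z)))"
  using assms(1-6)
proof (induction Z arbitrary: G rule: finite_induct)
  case (insert w Z)
  obtain G' where G': "G' holomorphic_on ball 0 1" "\<And>z. cmod z < 1 \<Longrightarrow> cmod (G' z) \<le> M"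
    "\<And>z. cmod z < 1 \<Longrightarrow> G z = (z - w) / (1 - cnj w * z) * G' z"
    using blaschke_factor[of G M w] insert.prems by auto
  have "G' v = 0" if "v \<in> Z" for v
    using G'(3)[of v] insert.prems(4)[of v] insert.prems(4)[of w] insert.prems(5)[of v] insert.hyps that
      blaschke_denominator_nonzero[of v w] by auto
  hence "cmod (G' z) \<le> M * (\<Prod>w\<in>Z. cmod ((z - w) / (1 - cnj w * z)))"
    using insert.prems G' by (intro insert.IH) auto
  hence "cmod ((z - w) / (1 - cnj w * z)) * cmod (G' z) \<le>
      cmod ((z - w) / (1 - cnj w * z)) * (M * (\<Prod>w\<in>Z. cmod ((z - w) / (1 - cnj w * z))))"
    by (intro mult_left_mono) auto
  moreover have "cmod (G z) = cmod ((z - w) / (1 - cnj w * z)) * cmod (G' z)"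
    unfolding G'(3)[OF z] by (rule norm_mult)
  ultimately show ?case using insert.hyps by (simp add: mult.left_commute)
qed (use z in auto)

text \<open>It is used in two ways: many zeros make G tiny at a given point, and a lower bound for G
  at one point limits the number of zeros.\<close>

lemma bounded_le_exp_card_zeros:
  assumes "finite Z" "G holomorphic_on ball 0 1" "\<And>z. cmod z < 1 \<Longrightarrow> cmod (G z) \<le> M" "M > 0"
    and "\<And>w. w \<in> Z \<Longrightarrow> \<theta> \<le> 1 - cmod w" "\<theta> > 0" "\<And>w. w \<in> Z \<Longrightarrow> G w = 0" and z: "cmod z < 1"
  shows "cmod (G z) \<le> M * exp (- (real (card Z) * (1 - cmod z) * \<theta> / 8))"
proof -
  have w: "cmod w < 1" if "w \<in> Z" for w using assms(5)[OF that] \<open>\<theta> > 0\<close> by linarith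
  have "cmod (G z) \<le> M * (\<Prod>w\<in>Z. cmod ((z - w) / (1 - cnj w * z)))"
    using assms w by (intro bounded_le_blaschke_product) auto
  also have "(\<Prod>w\<in>Z. cmod ((z - w) / (1 - cnj w * z))) \<le> (\<Prod>w\<in>Z. exp (- ((1 - cmod z) * \<theta> / 8)))"
  proof (rule prod_mono)
    fix v assume v: "v \<in> Z"
    have "cmod ((z - v) / (1 - cnj v * z)) \<le> exp (- ((1 - cmod z) * (1 - cmod v) / 8))"
      using z w[OF v] by (rule cmod_blaschke_le_exp)
    also have "\<dots> \<le> exp (- ((1 - cmod z) * \<theta> / 8))"
      using assms(5)[OF v] z by (simp add: mult_left_mono)
    finally show "0 \<le> cmod ((z - v) / (1 - cnj v * z)) \<and>
      cmod ((z - v) / (1 - cnj v * z)) \<le> exp (- ((1 - cmod z) * \<theta> / 8))" by simp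
  qed
  also have "\<dots> = exp (- (real (card Z) * (1 - cmod z) * \<theta> / 8))"
    by (simp add: mult.assoc flip: exp_of_nat_mult)
  finally show ?thesis using \<open>M > 0\<close> by simp
qed

text \<open>Among \<open>T + 1\<close> equally spaced points one stays away from all the roots.\<close>

lemma poly_large_at_point:
  fixes q :: "complex poly"
  assumes "degree q \<le> T" "1 \<le> cmod (lead_coeff q)" "0 < \<eta>" "\<eta> \<le> 1"
  shows "\<exists>s. 1 - \<eta> \<le> s \<and> s \<le> 1 - \<eta> / 2 \<and> (\<eta> / (4 * (real T + 1))) ^ T \<le> cmod (poly q (of_real s))"
proof -
  \<comment> \<open>T + 1 points with this spacing fit between 1 - \<eta> and 1 - \<eta>/2. The open
    disks of radius h/2 around them are disjoint, so at most T of them contain a root.\<close>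
  define h where "h = \<eta> / (2 * (real T + 1))"
  define s where "s i = 1 - \<eta> + real i * h" for i
  have h: "h > 0" using assms by (simp add: h_def)
  have "h / 2 \<le> 1" using assms by (simp add: h_def divide_le_eq)
  have "q \<noteq> 0" using assms(2) by auto
  have "\<exists>i\<le>T. \<forall>x. poly q x = 0 \<longrightarrow> h / 2 \<le> cmod (of_real (s i) - x)"
  proof (rule ccontr)
    assume "\<not> ?thesis"
    then obtain x where x: "\<And>i. i \<le> T \<Longrightarrow> poly q (x i) = 0 \<and> cmod (of_real (s i) - x i) < h / 2"
      by (metis not_le)
    have "inj_on x {..T}"
    proof (rule inj_onI)
      fix i j assume ij: "i \<in> {..T}" "j \<in> {..T}" "x i = x j"
      have "cmod (of_real (s i) - of_real (s j)) \<le> cmod (of_real (s i) - x i) + cmod (of_real (s j) - x j)"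
        using norm_triangle_ineq4[of "of_real (s i) - x i" "of_real (s j) - x j"] ij(3) by simp
      also have "\<dots> < h" using x[of i] x[of j] ij by simp
      finally have "\<bar>s i - s j\<bar> < h" by (metis norm_of_real of_real_diff)
      moreover have "s i - s j = (real i - real j) * h" by (simp add: s_def algebra_simps)
      ultimately have "\<bar>real i - real j\<bar> * h < 1 * h" using h by (simp add: abs_mult)
      hence "\<bar>real i - real j\<bar> < 1" using h by (simp only: mult_less_cancel_right)
      thus "i = j" by linarith
    qed
    hence "card (x ` {..T}) = T + 1" by (simp add: card_image)
    moreover have "card (x ` {..T}) \<le> card {x. poly q x = 0}"
      using x \<open>q \<noteq> 0\<close> by (intro card_mono poly_roots_finite) auto
    moreover have "card {x. poly q x = 0} \<le> degree q" using \<open>q \<noteq> 0\<close> by (rule card_poly_roots_bound)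
    ultimately show False using assms(1) by simp
  qed
  then obtain i where i: "i \<le> T" "\<And>x. poly q x = 0 \<Longrightarrow> h / 2 \<le> cmod (of_real (s i) - x)" by blast
  \<comment> \<open>Since h/2 \<le> 1, a degree below T only improves the lower bound.\<close>
  have "(h / 2) ^ T \<le> (h / 2) ^ degree q"
    using h \<open>h / 2 \<le> 1\<close> assms(1) by (intro power_decreasing) auto
  also have "\<dots> = (\<Prod>x\<in>#proots q. h / 2)" by (simp add: size_proots_complex)
  also have "\<dots> \<le> (\<Prod>x\<in>#proots q. cmod (of_real (s i) - x))"
  proof -
    have "(\<Prod>x\<in>#A. h / 2) \<le> (\<Prod>x\<in>#A. cmod (of_real (s i) - x))" if "set_mset A \<subseteq> {x. poly q x = 0}" for A
      using that
    proof (induction A)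
      case (add a A)
      have "(h / 2) * (\<Prod>x\<in>#A. h / 2) \<le> cmod (of_real (s i) - a) * (\<Prod>x\<in>#A. cmod (of_real (s i) - x))"
        using add i(2)[of a] h by (intro mult_mono) auto
      thus ?case by simp
    qed simp
    thus ?thesis using \<open>q \<noteq> 0\<close> by simp
  qed
  also have "\<dots> \<le> cmod (lead_coeff q) * (\<Prod>x\<in>#proots q. cmod (of_real (s i) - x))"
  proof -
    have "0 \<le> (\<Prod>x\<in>#A. cmod (of_real (s i) - x))" for A by (induction A) auto
    thus ?thesis using mult_right_mono[OF assms(2)] by fastforce
  qed
  also have "\<dots> = cmod (poly q (of_real (s i)))"
  proof -
    have norm: "cmod (\<Prod>x\<in>#A. of_real (s i) - x) = (\<Prod>x\<in>#A. cmod (of_real (s i) - x))" for A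
      by (induction A) (auto simp: norm_mult)
    have "poly q (of_real (s i)) = lead_coeff q * (\<Prod>x\<in>#proots q. of_real (s i) - x)"
      using arg_cong[OF complex_poly_decompose_multiset[of q], of "\<lambda>p. poly p (of_real (s i))"]
      by (simp add: poly_prod_mset)
    thus ?thesis by (simp add: norm_mult norm)
  qed
  finally have "(\<eta> / (4 * (real T + 1))) ^ T \<le> cmod (poly q (of_real (s i)))" by (simp add: h_def mult.commute)
  moreover have "real i * h \<le> \<eta> / 2"
  proof -
    have "real i * h \<le> (real T + 1) * h" using i(1) h by (intro mult_right_mono) auto
    also have "\<dots> = \<eta> / 2" by (simp add: h_def field_simps)
    finally show ?thesis .
  qed
  ultimately show ?thesis using h by (intro exI[of _ "s i"]) (auto simp: s_def)
qed

section \<open>Zeros of the auxiliary function\<close>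

lemma bipoly_holomorphic:
  "f holomorphic_on A \<Longrightarrow> (\<lambda>z. bipoly T p z (f z)) holomorphic_on A"
  unfolding bipoly_def by (intro holomorphic_intros)

text \<open>Two demands on the number n of prescribed zeros must be compatible: n must exceed a
  multiple of T d l/\<theta>^2 for the values elsewhere to contradict Liouville's inequality, yet 4
  d n must not exceed (T + 1)^2 for the pigeonhole argument. This dictates the lower bound on
  T.\<close>

lemma vanishing_poly:
  fixes f :: "complex \<Rightarrow> complex" and d T :: nat and H :: real
  assumes f: "f holomorphic_on ball 0 1" "\<And>z. cmod z < 1 \<Longrightarrow> cmod (f z) \<le> 1"
    and Z: "finite Z" "Z \<noteq> {}"
    and alg: "\<And>\<alpha>. \<alpha> \<in> Z \<Longrightarrow> algebraic \<alpha>" "\<And>\<alpha>. \<alpha> \<in> Z \<Longrightarrow> algebraic (f \<alpha>)"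
      "\<And>\<alpha>. \<alpha> \<in> Z \<Longrightarrow> degree_over_rat (rat_adjoin {\<alpha>, f \<alpha>}) \<le> d"
      "\<And>\<alpha>. \<alpha> \<in> Z \<Longrightarrow> height \<alpha> \<le> H" "\<And>\<alpha>. \<alpha> \<in> Z \<Longrightarrow> height (f \<alpha>) \<le> H"
    and \<theta>: "0 < \<theta>" "\<And>\<alpha>. \<alpha> \<in> Z \<Longrightarrow> \<theta> \<le> 1 - cmod \<alpha>"
    and H: "exp 1 \<le> H" and d: "1 \<le> d" and T: "580 * real d ^ 2 * ln H / \<theta>\<^sup>2 \<le> real T"
  shows "\<exists>p B. (\<forall>i\<le>T. \<forall>j\<le>T. \<bar>p i j\<bar> \<le> int B) \<and> (\<exists>i\<le>T. \<exists>j\<le>T. p i j \<noteq> 0) \<and> B \<ge> 1 \<and>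
    (\<forall>\<alpha>\<in>Z. bipoly T p \<alpha> (f \<alpha>) = 0) \<and> (real T + 1)\<^sup>2 * real B \<le> exp (8 * real T * ln H)"
proof -
  define l where "l = ln H"
  have H1: "1 < H" "H > 0" using H exp_gt_one[of 1] by linarith+
  have l: "l \<ge> 1" unfolding l_def using H H1 by (simp add: ln_ge_iff)
  have H_eq: "H = exp l" using H1 by (simp add: l_def)
  have \<theta>1: "\<theta> \<le> 1" using \<theta>(2) Z(2) by (metis all_not_in_conv diff_le_eq le_add_same_cancel1 norm_ge_zero order_trans)
  have "\<theta>\<^sup>2 \<le> 1" using \<theta>(1) \<theta>1 by (simp add: power_le_one)
  have dl: "1 \<le> real d ^ 2 * l" "1 \<le> real d * l"
    using d l mult_mono[of 1 "real d ^ 2" 1 l] mult_mono[of 1 "real d" 1 l] by (simp_all add: one_le_power)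
  have T580: "580 \<le> real T"
  proof -
    have "580 * 1 / 1 \<le> 580 * (real d ^ 2 * l) / \<theta>\<^sup>2"
      using dl \<theta>(1) \<open>\<theta>\<^sup>2 \<le> 1\<close> by (intro frac_le mult_left_mono) auto
    thus ?thesis using T by (simp add: l_def mult.assoc)
  qed
  \<comment> \<open>The smallest bound \<open>siegel\<close> works with, up to rounding. It makes M
    at most \<open>9 * (T + 1) ^ 4 * H ^ (2 * T)\<close>, and the polynomial factors are absorbed
    into \<open>exp (6 * T * l)\<close> because l \<ge> 1.\<close>
  define B where "B = nat \<lceil>8 * (real T + 1)\<^sup>2 * H ^ (2 * T)\<rceil>"
  have HT: "H ^ (2 * T) = exp (2 * real T * l)" unfolding H_eq by (simp add: mult.assoc flip: exp_of_nat_mult)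
  have big: "1 \<le> (real T + 1)\<^sup>2 * H ^ (2 * T)"
    using mult_mono[of 1 "(real T + 1)\<^sup>2" 1 "H ^ (2 * T)"] H1 by (simp add: one_le_power)
  have B: "8 * (real T + 1)\<^sup>2 * H ^ (2 * T) \<le> real B" "real B \<le> 9 * ((real T + 1)\<^sup>2 * H ^ (2 * T))"
    unfolding B_def using big by linarith+
  have "real B \<ge> 8" using B(1) big by linarith
  hence "B \<ge> 1" by simp
  define M where "M = (real T + 1)\<^sup>2 * real B"
  have M_le: "M \<le> exp (8 * real T * l)"
  proof -
    have eT: "real T + 1 \<le> exp (real T)" using exp_ge_add_one_self[of "real T"] by linarith
    have "M \<le> (real T + 1)\<^sup>2 * (9 * ((real T + 1)\<^sup>2 * H ^ (2 * T)))"
      unfolding M_def using B by (intro mult_left_mono) auto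
    also have "\<dots> = 9 * (real T + 1) ^ 4 * exp (2 * real T * l)" by (simp add: HT power2_eq_square power4_eq_xxxx)
    also have "\<dots> \<le> (real T + 1)\<^sup>2 * (real T + 1) ^ 4 * exp (2 * real T * l)"
      using T580 power_mono[of 3 "real T + 1" 2] by (intro mult_right_mono) auto
    also have "\<dots> = (real T + 1) ^ 6 * exp (2 * real T * l)" by (simp flip: power_add)
    also have "\<dots> \<le> exp (real T) ^ 6 * exp (2 * real T * l)"
      using eT by (intro mult_right_mono power_mono) auto
    also have "\<dots> = exp (6 * real T * 1 + 2 * real T * l)" by (simp add: exp_add flip: exp_of_nat_mult)
    also have "\<dots> \<le> exp (6 * real T * l + 2 * real T * l)" using l by (intro iffD2[OF exp_le_cancel_iff] add_mono mult_left_mono) auto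
    finally show ?thesis by (simp add: algebra_simps)
  qed
  have M1: "M \<ge> 1" unfolding M_def using \<open>real B \<ge> 8\<close> mult_mono[of 1 "(real T + 1)\<^sup>2" 1 "real B"] by (simp add: one_le_power)
  \<comment> \<open>144 = 8 (16 + 2): Liouville loses at most 16 T d l from M^(d+1) and 2 T d l from
    the heights, and the Blaschke product gains n \<theta>^2/8. The added 1 makes the inequality
    strict; since the main term is at least 144, n is at most 145/144 of it, and 580 = 4 *
    145.\<close>
  define n where "n = nat \<lfloor>144 * real T * real d * l / \<theta>\<^sup>2\<rfloor> + 1"
  have n_gt: "144 * real T * real d * l / \<theta>\<^sup>2 < real n" and n_le: "real n \<le> 144 * real T * real d * l / \<theta>\<^sup>2 + 1"
  proof -
    have "144 * real T * real d * l / \<theta>\<^sup>2 \<ge> 0" using l by simp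
    thus "144 * real T * real d * l / \<theta>\<^sup>2 < real n" "real n \<le> 144 * real T * real d * l / \<theta>\<^sup>2 + 1"
      unfolding n_def by linarith+
  qed
  have "4 * real d * real n \<le> real T * real T"
  proof -
    define X where "X = real T * (real d * l) / \<theta>\<^sup>2"
    have "1 \<le> X" unfolding X_def
      using T580 dl \<theta>(1) \<open>\<theta>\<^sup>2 \<le> 1\<close> mult_mono[of 1 "real T" 1 "real d * l"] by (simp add: le_divide_eq)
    moreover have "real n \<le> 144 * X + 1" using n_le by (simp add: X_def mult.assoc)
    ultimately have "real n \<le> 145 * X" by linarith
    hence "4 * real d * real n \<le> 4 * real d * (145 * X)"
      by (intro mult_left_mono) auto
    also have "\<dots> = real T * (580 * real d ^ 2 * ln H / \<theta>\<^sup>2)" by (simp add: X_def l_def power2_eq_square)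
    also have "\<dots> \<le> real T * real T" using T by (intro mult_left_mono) auto
    finally show ?thesis .
  qed
  also have "\<dots> \<le> real ((T + 1)\<^sup>2)" by (simp add: power2_eq_square algebra_simps)
  finally have "real (4 * d * n) \<le> real ((T + 1)\<^sup>2)" by simp
  hence n_sq: "4 * d * n \<le> (T + 1)\<^sup>2" by (simp only: of_nat_le_iff)
  \<comment> \<open>If Z has at most n points, all of them are prescribed zeros; otherwise exactly n
    are, and the others are reached by extrapolation.\<close>
  obtain Z0 where Z0: "Z0 \<subseteq> Z" "card Z0 = min n (card Z)"
    using obtain_subset_with_card_n[of "min n (card Z)" Z] by auto
  have "finite Z0" using Z0(1) Z(1) finite_subset by blast
  have "card Z0 > 0" using Z0(2) Z by (simp add: n_def card_gt_0_iff)
  hence "Z0 \<noteq> {}" by auto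
  have "4 * d * card Z0 \<le> 4 * d * n" using Z0(2) by simp
  hence card_sq: "4 * d * card Z0 \<le> (T + 1)\<^sup>2" using n_sq by linarith
  have B': "8 * (real T + 1)\<^sup>2 * H ^ (2 * T) \<le> real B + 1" using B(1) by linarith
  have "\<exists>p. (\<forall>i\<le>T. \<forall>j\<le>T. \<bar>p i j\<bar> \<le> int B) \<and> (\<exists>i\<le>T. \<exists>j\<le>T. p i j \<noteq> 0) \<and>
      (\<forall>\<alpha>\<in>Z0. bipoly T p \<alpha> (f \<alpha>) = 0)"
    by (rule siegel[OF \<open>finite Z0\<close> \<open>Z0 \<noteq> {}\<close> card_sq alg[OF subsetD[OF Z0(1)]] _ B' \<open>B \<ge> 1\<close>])
      (use H1 in auto)
  then obtain p where p: "\<forall>i\<le>T. \<forall>j\<le>T. \<bar>p i j\<bar> \<le> int B" "\<exists>i\<le>T. \<exists>j\<le>T. p i j \<noteq> 0"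
    "\<And>\<alpha>. \<alpha> \<in> Z0 \<Longrightarrow> bipoly T p \<alpha> (f \<alpha>) = 0"
    by blast
  have "bipoly T p \<alpha> (f \<alpha>) = 0" if \<alpha>: "\<alpha> \<in> Z" for \<alpha>
  proof (cases "card Z \<le> n")
    case True
    hence "Z0 = Z" using Z0 Z(1) by (simp add: card_subset_eq)
    thus ?thesis using p(3) \<alpha> by simp
  next
    case False
    hence card: "card Z0 = n" using Z0(2) by simp
    show ?thesis
    proof (rule ccontr)
      assume nz: "bipoly T p \<alpha> (f \<alpha>) \<noteq> 0"
      have disk: "cmod \<gamma> < 1" if "\<gamma> \<in> Z" for \<gamma> using \<theta>(1) \<theta>(2)[OF that] by linarith
      have "cmod (bipoly T p \<alpha> (f \<alpha>)) \<le> M * exp (- (real (card Z0) * (1 - cmod \<alpha>) * \<theta> / 8))"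
      proof (rule bounded_le_exp_card_zeros[where G = "\<lambda>z. bipoly T p z (f z)"])
        fix z :: complex assume "cmod z < 1"
        hence "max 1 (cmod z) = 1" "max 1 (cmod (f z)) = 1" using f(2) by auto
        thus "cmod (bipoly T p z (f z)) \<le> M"
          using cmod_bipoly_le[of T p B z "f z"] p(1) by (simp add: M_def)
      qed (use \<open>finite Z0\<close> M1 \<theta> Z0(1) p(3) disk \<alpha> in \<open>auto intro: bipoly_holomorphic[OF f(1)]\<close>)
      also have "\<dots> \<le> M * exp (- (real n * \<theta>\<^sup>2 / 8))"
      proof -
        have "real n * \<theta> * \<theta> \<le> real n * (1 - cmod \<alpha>) * \<theta>"
          using \<theta>(1) \<theta>(2)[OF \<alpha>] by (intro mult_right_mono mult_left_mono) auto
        thus ?thesis using M1 by (simp add: card power2_eq_square mult.assoc)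
      qed
      finally have small: "cmod (bipoly T p \<alpha> (f \<alpha>)) \<le> M * exp (- (real n * \<theta>\<^sup>2 / 8))" .
      have "1 \<le> cmod (bipoly T p \<alpha> (f \<alpha>)) * M ^ d * H ^ (2 * T * d)"
        using alg \<alpha> H1 M1 nz p(1) by (intro liouville) (auto simp: M_def intro: cmod_normalized_value_le)
      also have "\<dots> \<le> (M * exp (- (real n * \<theta>\<^sup>2 / 8))) * M ^ d * H ^ (2 * T * d)"
        using small H1 M1 by (intro mult_right_mono) auto
      also have "\<dots> = M ^ (d + 1) * exp (2 * real T * real d * l) * exp (- (real n * \<theta>\<^sup>2 / 8))"
        unfolding H_eq by (simp flip: exp_of_nat_mult)
      also have "\<dots> \<le> exp (8 * real T * l) ^ (d + 1) * exp (2 * real T * real d * l) * exp (- (real n * \<theta>\<^sup>2 / 8))"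
        using M_le M1 by (intro mult_right_mono power_mono) auto
      also have "\<dots> = exp (real (d + 1) * (8 * real T * l) + 2 * real T * real d * l - real n * \<theta>\<^sup>2 / 8)"
        by (simp only: exp_of_nat_mult exp_add exp_diff exp_minus divide_inverse)
      finally have "0 \<le> real (d + 1) * (8 * real T * l) + 2 * real T * real d * l - real n * \<theta>\<^sup>2 / 8" by simp
      moreover have "real (d + 1) * (8 * real T * l) \<le> (2 * real d) * (8 * real T * l)"
        using d l by (intro mult_right_mono) auto
      ultimately have "real n * \<theta>\<^sup>2 \<le> 144 * real T * real d * l" by (simp add: algebra_simps)
      moreover have "144 * real T * real d * l < real n * \<theta>\<^sup>2"
        using n_gt \<theta>(1) by (simp add: divide_less_eq)
      ultimately show False by simp
    qed
  qed
  thus ?thesis using p(1,2) M_le \<open>B \<ge> 1\<close> unfolding M_def l_def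
    by (intro exI[of _ p] exI[of _ B]) auto
qed

text \<open>At the chosen s, 1 - s lies between 1/(2 L) and 1/L. The condition on L is implicit: the
  lower bound \<delta> for the polynomial in z alone shrinks as L grows, but W involves L only
  through T ln L, whereas f decays like b^(-L). Hence a large L satisfies it, and the terms
  containing f are then at most \<delta>/2.\<close>

lemma card_zeros_le:
  fixes f :: "complex \<Rightarrow> complex"
  assumes f: "f holomorphic_on ball 0 1" "\<And>z. cmod z < 1 \<Longrightarrow> cmod (f z) \<le> 1"
    and small: "\<And>s. 0 < s \<Longrightarrow> s < 1 \<Longrightarrow> cmod (f (of_real s)) \<le> a * b powr (- (1 / (1 - s)))"
    and ab: "0 < a" "1 < b"
    and p: "\<And>i j. i \<le> T \<Longrightarrow> j \<le> T \<Longrightarrow> \<bar>p i j\<bar> \<le> int B" "\<exists>i\<le>T. \<exists>j\<le>T. p i j \<noteq> 0"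
    and B: "1 \<le> B" "(real T + 1)\<^sup>2 * real B \<le> exp w"
    and Z: "finite Z" "\<And>\<alpha>. \<alpha> \<in> Z \<Longrightarrow> f \<alpha> \<noteq> 0" "\<And>\<alpha>. \<alpha> \<in> Z \<Longrightarrow> bipoly T p \<alpha> (f \<alpha>) = 0"
    and \<theta>: "0 < \<theta>" "\<And>\<alpha>. \<alpha> \<in> Z \<Longrightarrow> \<theta> \<le> 1 - cmod \<alpha>"
    and L: "1 < L" "a + (w + ln 2 + real T * ln (4 * (real T + 1) * L)) \<le> L * ln b"
  shows "real (card Z) * \<theta> \<le> 16 * L * (w + ln 2 + real T * ln (4 * (real T + 1) * L))"
proof -
  define W where "W = w + ln 2 + real T * ln (4 * (real T + 1) * L)"
  define M where "M = (real T + 1)\<^sup>2 * real B"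
  define \<delta> where "\<delta> = (1 / L / (4 * (real T + 1))) ^ T"
  have M: "M \<ge> 1" "M \<le> exp w" unfolding M_def using B mult_mono[of 1 "(real T + 1)\<^sup>2" 1 "real B"] by (simp_all add: one_le_power)
  have \<delta>: "\<delta> > 0" using L by (simp add: \<delta>_def)
  have W: "2 * exp w / \<delta> = exp W"
  proof -
    have "1 / \<delta> = (4 * (real T + 1) * L) ^ T" using L(1) by (simp add: \<delta>_def power_divide power_mult_distrib field_simps)
    also have "\<dots> = exp (real T * ln (4 * (real T + 1) * L))" using L(1) by (simp add: exp_of_nat_mult)
    finally have "2 * exp w * (1 / \<delta>) = exp W" by (simp add: W_def exp_add)
    thus ?thesis by simp
  qed
  \<comment> \<open>The exact power of Y dividing P(X, Y). Dividing by it loses no zeros at the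
    points of Z, where f does not vanish, and leaves a non-zero polynomial at Y = 0.\<close>
  define k where "k = (LEAST j. j \<le> T \<and> (\<exists>i\<le>T. p i j \<noteq> 0))"
  have k: "k \<le> T" "\<exists>i\<le>T. p i k \<noteq> 0"
    using LeastI_ex[of "\<lambda>j. j \<le> T \<and> (\<exists>i\<le>T. p i j \<noteq> 0)"] p(2) unfolding k_def by blast+
  have k_least: "p i j = 0" if "j < k" "i \<le> T" for i j
    using not_less_Least[of j "\<lambda>j. j \<le> T \<and> (\<exists>i\<le>T. p i j \<noteq> 0)"] that k(1) unfolding k_def[symmetric] by auto
  define Q where "Q j z = (\<Sum>i\<le>T. of_int (p i j) * z ^ i)" for j and z :: complex
  define G where "G z = (\<Sum>j\<in>{k..T}. Q j z * f z ^ (j - k))" for z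
  have factor: "bipoly T p z (f z) = f z ^ k * G z" for z
  proof -
    have "bipoly T p z (f z) = (\<Sum>j\<le>T. Q j z * f z ^ j)"
      unfolding bipoly_def Q_def sum_distrib_right by (rule sum.swap)
    also have "\<dots> = (\<Sum>j\<in>{k..T}. Q j z * f z ^ j)"
    proof (rule sum.mono_neutral_right)
      show "\<forall>j\<in>{..T} - {k..T}. Q j z * f z ^ j = 0" using k_least by (auto simp: Q_def)
    qed auto
    also have "\<dots> = f z ^ k * G z"
      unfolding G_def sum_distrib_left
    proof (rule sum.cong)
      fix j assume "j \<in> {k..T}"
      hence "f z ^ j = f z ^ k * f z ^ (j - k)" by (simp flip: power_add)
      thus "Q j z * f z ^ j = f z ^ k * (Q j z * f z ^ (j - k))" by simp
    qed simp
    finally show ?thesis .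
  qed
  have Q_le: "cmod (Q j z) \<le> (real T + 1) * real B" if "cmod z < 1" "j \<le> T" for j z
  proof -
    have "cmod (Q j z) \<le> (\<Sum>i\<le>T. real B)"
      unfolding Q_def
    proof (intro order.trans[OF norm_sum] sum_mono)
      fix i assume "i \<in> {..T}"
      hence "\<bar>real_of_int (p i j)\<bar> \<le> real B" using p(1)[of i j] that
        by (metis atMost_iff of_int_abs of_int_le_iff of_int_of_nat_eq)
      thus "cmod (of_int (p i j) * z ^ i) \<le> real B"
        using that power_le_one[of "cmod z" i] mult_mono[of "\<bar>real_of_int (p i j)\<bar>" "real B" "cmod z ^ i" 1]
        by (simp add: norm_mult norm_power)
    qed
    thus ?thesis by (simp add: add.commute)
  qed
  have sum_le: "(\<Sum>j\<in>J. cmod (Q j z * f z ^ (j - k))) \<le> M * c"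
    if z: "cmod z < 1" and J: "J \<subseteq> {..T}" and c: "\<And>j. j \<in> J \<Longrightarrow> cmod (f z) ^ (j - k) \<le> c" "c \<ge> 0" for J z c
  proof -
    have "(\<Sum>j\<in>J. cmod (Q j z * f z ^ (j - k))) \<le> (\<Sum>j\<in>J. (real T + 1) * real B * c)"
      using Q_le[OF z] J c by (intro sum_mono) (auto simp: norm_mult norm_power intro!: mult_mono)
    also have "\<dots> = real (card J) * ((real T + 1) * real B * c)" by simp
    also have "\<dots> \<le> (real T + 1) * ((real T + 1) * real B * c)"
      using card_mono[OF _ J] c(2) by (intro mult_right_mono) auto
    finally show ?thesis by (simp add: M_def power2_eq_square)
  qed
  have G_hol: "G holomorphic_on ball 0 1"
    unfolding G_def Q_def by (intro holomorphic_intros f(1))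
  have G_le: "cmod (G z) \<le> M" if "cmod z < 1" for z
  proof -
    have "cmod (G z) \<le> (\<Sum>j\<in>{k..T}. cmod (Q j z * f z ^ (j - k)))"
      unfolding G_def by (rule norm_sum)
    also have "\<dots> \<le> M * 1" using f(2)[OF that] by (intro sum_le[OF that]) (auto simp: power_le_one)
    finally show ?thesis by simp
  qed
  define q where "q = (\<Sum>i\<le>T. monom (of_int (p i k) :: complex) i)"
  have coeff_q: "coeff q i = (if i \<le> T then of_int (p i k) else 0)" for i
    by (simp add: q_def coeff_sum)
  have "q \<noteq> 0" using k(2) coeff_q by (metis coeff_0 of_int_eq_0_iff)
  have "degree q \<le> T" by (rule degree_le) (simp add: coeff_q)
  have "lead_coeff q \<noteq> 0" using \<open>q \<noteq> 0\<close> by simp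
  hence lead: "1 \<le> cmod (lead_coeff q)" by (auto simp: coeff_q norm_of_int simp flip: of_int_abs split: if_splits)
  have "0 < 1 / L" "1 / L < 1" using L(1) by auto
  then obtain s where s: "1 - 1 / L \<le> s" "s \<le> 1 - 1 / L / 2" and q_ge: "\<delta> \<le> cmod (poly q (of_real s))"
    using poly_large_at_point[OF \<open>degree q \<le> T\<close> lead, of "1 / L"] unfolding \<delta>_def by auto
  have "0 < 1 / L / 2" using L(1) by simp
  hence s01: "0 < s" "s < 1" using s \<open>1 / L < 1\<close> by linarith+
  have disk: "cmod (of_real s) < 1" using s01 by simp
  have poly_q: "poly q z = Q k z" for z by (simp add: q_def Q_def poly_sum poly_monom)
  have f_s: "cmod (f (of_real s)) \<le> a * b powr (- L)"
  proof -
    have "L \<le> 1 / (1 - s)" using s s01 L(1) by (simp add: field_simps)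
    hence "b powr (- (1 / (1 - s))) \<le> b powr (- L)" using ab by (intro powr_mono) auto
    thus ?thesis using small[OF s01] ab by (meson mult_left_mono less_imp_le order.trans)
  qed
  have "cmod (G (of_real s)) \<ge> \<delta> / 2"
  proof -
    have "G (of_real s) = Q k (of_real s) + (\<Sum>j\<in>{k<..T}. Q j (of_real s) * f (of_real s) ^ (j - k))"
      unfolding G_def using k(1) by (subst sum.head) auto
    hence "cmod (Q k (of_real s)) - cmod (G (of_real s)) \<le> cmod (\<Sum>j\<in>{k<..T}. Q j (of_real s) * f (of_real s) ^ (j - k))"
      by (metis add_diff_cancel_left' norm_minus_commute norm_triangle_ineq2)
    also have "\<dots> \<le> (\<Sum>j\<in>{k<..T}. cmod (Q j (of_real s) * f (of_real s) ^ (j - k)))" by (rule norm_sum)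
    also have "\<dots> \<le> M * (a * b powr (- L))"
    proof (rule sum_le[OF disk])
      fix j assume "j \<in> {k<..T}"
      hence "cmod (f (of_real s)) ^ (j - k) \<le> cmod (f (of_real s)) ^ 1"
        using f(2)[OF disk] by (intro power_decreasing) auto
      thus "cmod (f (of_real s)) ^ (j - k) \<le> a * b powr (- L)" using f_s by simp
    qed (use ab in auto)
    also have "\<dots> \<le> exp w * (exp a * exp (- (L * ln b)))"
    proof -
      have "a \<le> exp a" using exp_ge_add_one_self[of a] by linarith
      thus ?thesis using M ab by (intro mult_mono) (auto simp: powr_def)
    qed
    also have "\<dots> = exp w * exp (a - L * ln b)" by (simp add: exp_diff exp_minus divide_inverse)
    also have "\<dots> \<le> exp w * exp (- W)" using L(2) by (simp add: W_def)
    also have "\<dots> = \<delta> / 2" using \<delta> by (simp add: exp_minus W[symmetric] field_simps)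
    finally show ?thesis using q_ge by (simp add: poly_q)
  qed
  also have "cmod (G (of_real s)) \<le> M * exp (- (real (card Z) * (1 - cmod (of_real s)) * \<theta> / 8))"
  proof (rule bounded_le_exp_card_zeros[OF Z(1) G_hol G_le])
    show "G \<alpha> = 0" if "\<alpha> \<in> Z" for \<alpha> using factor[of \<alpha>] Z(2,3)[OF that] by simp
  qed (use \<theta> M disk in auto)
  \<comment> \<open>16 is the 8 of the Blaschke bound times the 2 in 1 - s \<ge> 1/(2 L).\<close>
  also have "\<dots> \<le> exp w * exp (- (real (card Z) * \<theta> / (16 * L)))"
  proof (intro mult_mono)
    have "1 / (2 * L) \<le> 1 - s" using s(2) by simp
    hence "real (card Z) * (1 / (2 * L)) * \<theta> \<le> real (card Z) * (1 - s) * \<theta>"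
      using \<theta>(1) by (intro mult_right_mono mult_left_mono) auto
    thus "exp (- (real (card Z) * (1 - cmod (of_real s)) * \<theta> / 8)) \<le> exp (- (real (card Z) * \<theta> / (16 * L)))"
      using s01 by (simp add: mult.commute)
  qed (use M in auto)
  finally have "\<delta> * exp (real (card Z) * \<theta> / (16 * L)) \<le> 2 * exp w"
    by (simp add: exp_minus field_simps)
  hence "exp (real (card Z) * \<theta> / (16 * L)) \<le> exp W" unfolding W[symmetric] using \<delta> by (simp add: field_simps)
  hence "real (card Z) * \<theta> / (16 * L) \<le> W" by simp
  thus ?thesis using L(1) unfolding W_def[symmetric] by (simp add: divide_le_eq mult.commute)
qed

text \<open>Solves the implicit condition on L. The main order is Y = T l ln d; v collects the
  dependence on a, b and F, and u stands for a bound of 1/ln b. F enters because W contains ln T,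
  hence ln \<Theta>, and the only upper bound for \<Theta> is F d l. In place of optimal logarithms,
  ln F \<le> F and ln l \<le> l are enough, since E = F l ln d dominates both up to a
  constant.\<close>

lemma parameter_estimates:
  fixes u a l \<Theta> F :: real and d T :: nat
  assumes "1 \<le> u" "0 < a" "2 \<le> d" "1 \<le> l" "1 \<le> \<Theta>" "1 \<le> F" "\<Theta> \<le> F * real d * l"
    and T: "580 * real d ^ 2 * l * \<Theta>\<^sup>2 \<le> real T" "real T \<le> 580 * real d ^ 2 * l * \<Theta>\<^sup>2 + 1"
  defines "v \<equiv> u * (1 + a) * F"
  defines "L \<equiv> 100 * v\<^sup>2 * (real T * ln (real d) * l)"
  defines "W \<equiv> 8 * real T * l + ln 2 + real T * ln (4 * (real T + 1) * L)"
  shows "1 < L" "u * (a + W) \<le> L"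
    "16 * \<Theta> * L\<^sup>2 \<le> 160000 * 581\<^sup>2 * v ^ 4 * \<Theta> ^ 5 * real d ^ 4 * (ln (real d))\<^sup>2 * l ^ 4"
proof -
  define D where "D = ln (real d)"
  have "ln 2 \<le> D" using assms(3) by (simp add: D_def)
  hence D: "2 / 3 \<le> D" "ln 2 \<le> D" using ln2_ge_two_thirds by linarith+
  have X: "1 \<le> real d ^ 2 * l * \<Theta>\<^sup>2"
  proof -
    have "1 * 1 * 1 \<le> real d ^ 2 * l * \<Theta>\<^sup>2"
      using assms(3-5) by (intro mult_mono) (auto simp: one_le_power)
    thus ?thesis by simp
  qed
  \<comment> \<open>Rounding T up and passing to T + 1 each cost at most one more multiple of d^2 l
    \<Theta>^2, which is at least 1.\<close>
  have T1: "1 \<le> real T" "real T \<le> 581 * (real d ^ 2 * l * \<Theta>\<^sup>2)" "real T + 1 \<le> 582 * (real d ^ 2 * l * \<Theta>\<^sup>2)"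
    using T X by (simp_all add: mult.assoc)
  define Y where "Y = real T * D * l"
  define E where "E = F * D * l"
  have pos: "0 < D" "0 < l" "0 < F" "0 < u" "0 < \<Theta>" "0 < real T" "0 < real d" using D assms T1 by linarith+
  have E: "D \<le> E" "F \<le> 3 / 2 * E" "l \<le> 3 / 2 * E"
  proof -
    have "1 * D * 1 \<le> F * D * l" using assms pos by (intro mult_mono) auto
    thus "D \<le> E" by (simp add: E_def)
    have "F * (2 / 3) * 1 \<le> F * D * l" using assms D pos by (intro mult_mono) auto
    thus "F \<le> 3 / 2 * E" by (simp add: E_def)
    have "1 * (2 / 3) * l \<le> F * D * l" using assms D pos by (intro mult_mono) auto
    thus "l \<le> 3 / 2 * E" by (simp add: E_def)
  qed
  have Y: "real T * l \<le> 3 / 2 * Y" "real T \<le> 3 / 2 * Y" "1 \<le> 3 / 2 * Y"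
  proof -
    have "real T * (2 / 3) * l \<le> real T * D * l" using D pos by (intro mult_mono) auto
    thus 1: "real T * l \<le> 3 / 2 * Y" by (simp add: Y_def)
    have "real T * 1 \<le> real T * l" using assms(4) by (intro mult_left_mono) auto
    thus 2: "real T \<le> 3 / 2 * Y" using 1 by simp
    thus "1 \<le> 3 / 2 * Y" using T1(1) by linarith
  qed
  have v: "1 \<le> v" "u \<le> v" "u * a \<le> v" "u * F + u * a \<le> v"
  proof -
    have "u * 1 * 1 \<le> u * (1 + a) * F" using assms by (intro mult_mono) auto
    thus "u \<le> v" by (simp add: v_def)
    thus "1 \<le> v" using assms(1) by linarith
    have "u * a * 1 \<le> u * a * F" using assms by (intro mult_left_mono) auto
    thus "u * F + u * a \<le> v" by (simp add: v_def algebra_simps)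
    thus "u * a \<le> v" using mult_nonneg_nonneg[of u F] pos by linarith
  qed
  have L: "L = 100 * v\<^sup>2 * Y" by (simp add: L_def Y_def D_def)
  have v2: "v \<le> v\<^sup>2" using v(1) by (simp add: self_le_power)
  show "1 < L"
  proof -
    have "100 * 1 * (2 / 3) \<le> 100 * v\<^sup>2 * Y"
      using v(1) v2 Y(3) by (intro mult_mono) auto
    thus ?thesis unfolding L by linarith
  qed
  \<comment> \<open>4 * 582 = 2328 is rounded up to a power of 2, so that its logarithm is at most
    12 ln d. The total 12 D + 2 F + 4 D + 3 l is at most 23.5 E.\<close>
  have ln4T: "ln (4 * (real T + 1)) \<le> 24 * E"
  proof -
    have "\<Theta>\<^sup>2 \<le> (F * real d * l)\<^sup>2" using assms(5,7) by (intro power_mono) auto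
    hence "real T + 1 \<le> 582 * (real d ^ 2 * l * (F * real d * l)\<^sup>2)"
      using T1(3) pos by (intro order.trans[OF T1(3)] mult_left_mono) auto
    hence "4 * (real T + 1) \<le> 2328 * (real d ^ 2 * l * (F * real d * l)\<^sup>2)" by simp
    also have "\<dots> \<le> 2 ^ 12 * (real d ^ 2 * l * (F * real d * l)\<^sup>2)" using pos by (intro mult_right_mono) auto
    also have "\<dots> = 2 ^ 12 * F ^ 2 * real d ^ 4 * l ^ 3" by (simp add: power2_eq_square power3_eq_cube power4_eq_xxxx)
    finally have "ln (4 * (real T + 1)) \<le> ln (2 ^ 12 * F ^ 2 * real d ^ 4 * l ^ 3)"
      by (intro ln_mono) auto
    also have "\<dots> = 12 * ln 2 + 2 * ln F + 4 * D + 3 * ln l"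
    proof -
      have "ln (c ^ 12 * F ^ 2 * real d ^ 4 * l ^ 3) = 12 * ln c + 2 * ln F + 4 * D + 3 * ln l" if "0 < c" for c
        using pos that by (simp add: ln_mult ln_realpow D_def)
      from this[of 2] show ?thesis by simp
    qed
    also have "\<dots> \<le> 12 * D + 2 * F + 4 * D + 3 * l"
      using D(2) ln_le_minus_one[of F] ln_le_minus_one[of l] pos by linarith
    also have "\<dots> \<le> 24 * E" using E D by linarith
    finally show ?thesis .
  qed
  have lnL: "ln L \<le> 20 * v + 27 * E"
  proof -
    have "ln L = ln ((10 * v)\<^sup>2) + ln (real T) + ln D + ln l"
      unfolding L Y_def using pos v(1) by (simp add: ln_mult power_mult_distrib)
    also have "ln ((10 * v)\<^sup>2) = 2 * ln (10 * v)" by (subst ln_realpow) (use v(1) in auto)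
    also have "ln (10 * v) \<le> 10 * v" using ln_le_minus_one[of "10 * v"] v(1) by linarith
    also have "ln (real T) \<le> 24 * E"
    proof -
      have "ln (real T) \<le> ln (4 * (real T + 1))" using pos by (intro ln_mono) auto
      thus ?thesis using ln4T by linarith
    qed
    also have "ln D \<le> E" using ln_le_minus_one[of D] pos E by linarith
    also have "ln l \<le> 3 / 2 * E" using ln_le_minus_one[of l] pos E by linarith
    finally show ?thesis using E(1) pos by linarith
  qed
  have "ln (4 * (real T + 1) * L) = ln (4 * (real T + 1)) + ln L"
    using \<open>1 < L\<close> by (intro ln_mult_pos) auto
  also have "\<dots> \<le> 20 * v + 51 * E" using ln4T lnL by linarith
  finally have "real T * ln (4 * (real T + 1) * L) \<le> real T * (20 * v + 51 * E)"
    by (intro mult_left_mono) auto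
  also have "\<dots> = 20 * v * real T + 51 * (F * Y)" by (simp add: E_def Y_def algebra_simps)
  also have "\<dots> \<le> 20 * v * (3 / 2 * Y) + 51 * (F * Y)" using mult_left_mono[OF Y(2), of "20 * v"] v(1) by simp
  finally have ln_part: "real T * ln (4 * (real T + 1) * L) \<le> 30 * v * Y + 51 * (F * Y)" by (simp add: mult_ac)
  have Y0: "0 \<le> Y" "1 * Y \<le> F * Y" using Y(3) assms(6) by (auto intro!: mult_right_mono)
  have "ln 2 \<le> 3 / 2 * Y" using Y(3) ln_2_less_1 by linarith
  \<comment> \<open>The constant 100 in L comes from here: 12 + 3/2 + 51 is at most 65, the terms
    with v contribute 30, and 65 + 30 is below 100.\<close>
  hence "W \<le> 8 * (3 / 2 * Y) + 3 / 2 * Y + (30 * v * Y + 51 * (F * Y))"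
    unfolding W_def using Y(1) ln_part by linarith
  hence "W \<le> 65 * (F * Y) + 30 * v * Y" using Y0 by linarith
  moreover have "a \<le> 3 / 2 * (a * Y)" using mult_left_mono[OF Y(3), of a] assms(2) by simp
  ultimately have "a + W \<le> (3 / 2 * a + 65 * F + 30 * v) * Y" by (simp add: algebra_simps)
  hence "u * (a + W) \<le> u * ((3 / 2 * a + 65 * F + 30 * v) * Y)" using pos by (intro mult_left_mono) auto
  also have "\<dots> = (3 / 2 * (u * a) + 65 * (u * F) + 30 * (u * v)) * Y" by (simp add: algebra_simps)
  also have "\<dots> \<le> (65 * v\<^sup>2 + 30 * v\<^sup>2) * Y"
  proof (intro mult_right_mono add_mono)
    have "0 \<le> u * a" "0 \<le> u * F" using pos assms(2) by auto
    thus "3 / 2 * (u * a) + 65 * (u * F) \<le> 65 * v\<^sup>2" using v(4) v2 by linarith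
    have "u * v \<le> v * v" using v by (intro mult_right_mono) auto
    thus "30 * (u * v) \<le> 30 * v\<^sup>2" by (simp add: power2_eq_square)
  qed (use Y0 in auto)
  also have "\<dots> \<le> 100 * v\<^sup>2 * Y" using Y0 by (simp flip: distrib_right)
  finally show "u * (a + W) \<le> L" by (simp add: L)
  have "L\<^sup>2 = 10000 * v ^ 4 * D\<^sup>2 * l\<^sup>2 * (real T)\<^sup>2"
    unfolding L Y_def by (simp add: power_mult_distrib flip: power_mult)
  also have "\<dots> \<le> 10000 * v ^ 4 * D\<^sup>2 * l\<^sup>2 * (581 * (real d ^ 2 * l * \<Theta>\<^sup>2))\<^sup>2"
    using T1(2) by (intro mult_left_mono power_mono) auto
  finally have "16 * \<Theta> * L\<^sup>2 \<le> 16 * \<Theta> * (10000 * v ^ 4 * D\<^sup>2 * l\<^sup>2 * (581 * (real d ^ 2 * l * \<Theta>\<^sup>2))\<^sup>2)"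
    using pos by (intro mult_left_mono) auto
  \<comment> \<open>160000 = 16 * 100^2, and 581^2 stems from the square of T; the fifth power of
    \<Theta> is one explicit factor times the square of \<Theta>^2.\<close>
  also have "\<dots> = 160000 * 581\<^sup>2 * v ^ 4 * \<Theta> ^ 5 * real d ^ 4 * D\<^sup>2 * l ^ 4"
    by (simp add: power_mult_distrib power2_eq_square power4_eq_xxxx eval_nat_numeral)
  finally show "16 * \<Theta> * L\<^sup>2 \<le> 160000 * 581\<^sup>2 * v ^ 4 * \<Theta> ^ 5 * real d ^ 4 * (ln (real d))\<^sup>2 * l ^ 4"
    by (simp add: D_def)
qed

text \<open>From ln b \<ge> 1 - 1/b. The factor is the computable substitute for 1/ln b.\<close>

lemma inverse_ln_le:
  fixes b :: real
  assumes "1 < b"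
  shows "1 \<le> (1 + inverse (b - 1)) * ln b"
proof -
  have "- ln b \<le> inverse b - 1"
    using ln_le_minus_one[of "inverse b"] assms by (simp add: ln_inverse)
  hence "(b - 1) / b \<le> ln b" using assms by (simp add: field_simps)
  moreover have "1 + inverse (b - 1) = b / (b - 1)" using assms by (simp add: field_simps)
  moreover have "b / (b - 1) * ((b - 1) / b) = 1" using assms by simp
  ultimately show ?thesis using mult_left_mono[of "(b - 1) / b" "ln b" "b / (b - 1)"] assms by simp
qed

text \<open>Finite subsets are counted because finiteness of \<open>alg_points\<close> is itself to
  be proved, and \<Theta> is left free because it is all that distinguishes the two bounds. F
  compensates for \<Theta> against d ln H: it will be a constant in the first bound and \<Theta>
  itself in the second.\<close>

lemma card_alg_points_subset_le:
  fixes f :: "complex \<Rightarrow> complex" and a b H \<Theta> F :: real and d :: nat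
  assumes ab: "0 < a" "1 < b"
    and S: "S \<subseteq> ball 0 1" "complex_of_real ` {0<..<1} \<subseteq> S"
    and f: "f analytic_on ball 0 1" "\<forall>z\<in>ball 0 1. cmod (f z) \<le> 1"
    and small: "\<forall>z\<in>S. cmod (f z) < a * b powr (- disk_phi z)"
    and dH: "2 \<le> d" "exp 1 \<le> H"
    and Z: "finite Z" "Z \<subseteq> alg_points f S d H" "\<And>\<alpha>. \<alpha> \<in> Z \<Longrightarrow> 1 / \<Theta> \<le> 1 - cmod \<alpha>"
    and \<Theta>: "1 \<le> \<Theta>" "1 \<le> F" "\<Theta> \<le> F * real d * ln H"
  shows "real (card Z) \<le> 160000 * 581\<^sup>2 * ((1 + inverse (b - 1)) * (1 + a) * F) ^ 4 * \<Theta> ^ 5 *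
    real d ^ 4 * (ln (real d))\<^sup>2 * (ln H) ^ 4"
proof (cases "Z = {}")
  case True
  thus ?thesis using \<Theta>(1) by simp
next
  case False
  have hol: "f holomorphic_on ball 0 1" using f(1) by (rule analytic_imp_holomorphic)
  have f_le: "cmod (f z) \<le> 1" if "cmod z < 1" for z using f(2) that by simp
  have H: "1 < H" using dH(2) exp_gt_one[of 1] by linarith
  have l: "1 \<le> ln H" using dH(2) H by (simp add: ln_ge_iff)
  define u where "u = 1 + inverse (b - 1)"
  have u: "1 \<le> u" "1 \<le> u * ln b" using ab inverse_ln_le[of b] by (auto simp: u_def)
  define T where "T = nat \<lceil>580 * real d ^ 2 * ln H * \<Theta>\<^sup>2\<rceil>"
  have T: "580 * real d ^ 2 * ln H * \<Theta>\<^sup>2 \<le> real T" "real T \<le> 580 * real d ^ 2 * ln H * \<Theta>\<^sup>2 + 1"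
  proof -
    have "0 \<le> 580 * real d ^ 2 * ln H * \<Theta>\<^sup>2" using l by simp
    thus "580 * real d ^ 2 * ln H * \<Theta>\<^sup>2 \<le> real T" "real T \<le> 580 * real d ^ 2 * ln H * \<Theta>\<^sup>2 + 1"
      unfolding T_def by linarith+
  qed
  define L where "L = 100 * (u * (1 + a) * F)\<^sup>2 * (real T * ln (real d) * ln H)"
  define W where "W = 8 * real T * ln H + ln 2 + real T * ln (4 * (real T + 1) * L)"
  have L: "1 < L" "u * (a + W) \<le> L"
    and bound: "16 * \<Theta> * L\<^sup>2 \<le> 160000 * 581\<^sup>2 * (u * (1 + a) * F) ^ 4 * \<Theta> ^ 5 * real d ^ 4 * (ln (real d))\<^sup>2 * (ln H) ^ 4"
    using parameter_estimates[OF u(1) ab(1) dH(1) l \<Theta> T] unfolding L_def W_def by auto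
  have alg: "algebraic \<alpha>" "algebraic (f \<alpha>)" "degree_over_rat (rat_adjoin {\<alpha>, f \<alpha>}) \<le> d"
    "height \<alpha> \<le> H" "height (f \<alpha>) \<le> H" "f \<alpha> \<noteq> 0" if "\<alpha> \<in> Z" for \<alpha>
    using Z(2) that by (auto simp: alg_points_def)
  have "580 * real d ^ 2 * ln H / (1 / \<Theta>)\<^sup>2 \<le> real T" using T(1) by (simp add: power_divide)
  moreover have "0 < 1 / \<Theta>" "1 \<le> d" using \<Theta>(1) dH(1) by auto
  ultimately obtain p B where p: "\<And>i j. i \<le> T \<Longrightarrow> j \<le> T \<Longrightarrow> \<bar>p i j\<bar> \<le> int B" "\<exists>i\<le>T. \<exists>j\<le>T. p i j \<noteq> 0" "1 \<le> B"
    "\<And>\<alpha>. \<alpha> \<in> Z \<Longrightarrow> bipoly T p \<alpha> (f \<alpha>) = 0" "(real T + 1)\<^sup>2 * real B \<le> exp (8 * real T * ln H)"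
    using vanishing_poly[OF hol f_le Z(1) False alg(1-5) _ Z(3) dH(2), of T] by blast
  have small': "cmod (f (of_real s)) \<le> a * b powr (- (1 / (1 - s)))" if "0 < s" "s < 1" for s
  proof -
    have "of_real s \<in> S" using S(2) that by auto
    thus ?thesis using small that by (auto simp: disk_phi_def intro: less_imp_le)
  qed
  have "1 * 1 \<le> 4 * (real T + 1) * L" using L(1) by (intro mult_mono) auto
  hence W0: "0 \<le> W" unfolding W_def using l H by (intro add_nonneg_nonneg mult_nonneg_nonneg ln_ge_zero) auto
  have "a + W \<le> (u * (a + W)) * ln b"
    using mult_right_mono[OF u(2), of "a + W"] W0 ab by (simp add: ac_simps)
  also have "\<dots> \<le> L * ln b" using L(2) ab by (intro mult_right_mono) auto
  finally have "real (card Z) * (1 / \<Theta>) \<le> 16 * L * W"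
    unfolding W_def using alg(6) p Z \<Theta>(1) L(1)
    by (intro card_zeros_le[OF hol f_le small' ab p(1,2,3,5) Z(1)]) auto
  \<comment> \<open>Replacing W by L costs only a constant, as both have the same order, and leaves
    a single parameter to estimate.\<close>
  also have "W \<le> L"
  proof -
    have "1 * (a + W) \<le> u * (a + W)" using u(1) W0 ab by (intro mult_right_mono) auto
    hence "a + W \<le> L" using L(2) by (metis mult_1 order.trans)
    thus ?thesis using ab by linarith
  qed
  finally have "real (card Z) * (1 / \<Theta>) \<le> 16 * L * L" using L(1) by simp
  hence "real (card Z) \<le> 16 * \<Theta> * L\<^sup>2" using \<Theta>(1) by (simp add: divide_le_eq power2_eq_square ac_simps)
  thus ?thesis using bound unfolding u_def by linarith
qed

text \<open>The lower bound H^(-2 d) for |f \<alpha>| is compared with the growth condition: b^(1/t)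
  with t = 1 - |\<alpha>| cannot exceed a H^(2 d), so 1/t is at most of order d ln H.\<close>

lemma alg_points_away_from_circle:
  fixes f :: "complex \<Rightarrow> complex" and a b H :: real and d :: nat
  assumes ab: "0 < a" "1 < b" and S: "S \<subseteq> ball 0 1"
    and small: "\<forall>z\<in>S. cmod (f z) < a * b powr (- disk_phi z)"
    and dH: "2 \<le> d" "exp 1 \<le> H" and \<alpha>: "\<alpha> \<in> alg_points f S d H"
  shows "1 / (2 * ((1 + inverse (b - 1)) * (1 + a)) * real d * ln H) \<le> 1 - cmod \<alpha>"
proof -
  have alg: "algebraic \<alpha>" "algebraic (f \<alpha>)" "degree_over_rat (rat_adjoin {\<alpha>, f \<alpha>}) \<le> d"
    "height \<alpha> \<le> H" "height (f \<alpha>) \<le> H" "f \<alpha> \<noteq> 0" "\<alpha> \<in> S"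
    using \<alpha> by (auto simp: alg_points_def)
  have H: "1 < H" using dH(2) exp_gt_one[of 1] by linarith
  have l: "1 \<le> ln H" using dH(2) H by (simp add: ln_ge_iff)
  define u where "u = 1 + inverse (b - 1)"
  have u: "1 \<le> u" "1 \<le> u * ln b" using ab inverse_ln_le[of b] by (auto simp: u_def)
  \<comment> \<open>The polynomial Y, of degree at most 1 in each variable. Its normalised values
    are at most 1, so Liouville's inequality applies with M = 1.\<close>
  define p where "p = (\<lambda>(i::nat) (j::nat). if i = 0 \<and> j = 1 then 1 else 0 :: int)"
  have p: "bipoly 1 p x y = y" for x y by (simp add: bipoly_def p_def)
  have "1 \<le> cmod (bipoly 1 p \<alpha> (f \<alpha>)) * 1 ^ d * H ^ (2 * 1 * d)"
  proof (rule liouville[OF alg(1-5)])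
    show "cmod (normalized_value 1 p x y) \<le> 1" for x y
    proof -
      have "cmod y \<le> max 1 (cmod y)" by simp
      also have "\<dots> \<le> max 1 (cmod x) * max 1 (cmod y)"
        using mult_right_mono[of 1 "max 1 (cmod x)" "max 1 (cmod y)"] by simp
      finally have "cmod y \<le> max 1 (cmod x) * max 1 (cmod y)" .
      moreover have "0 < max 1 (cmod x) * max 1 (cmod y)" by simp
      ultimately show ?thesis unfolding normalized_value_def p norm_divide norm_of_real by (simp add: divide_le_eq)
    qed
  qed (use H alg(6) p in auto)
  then have ge: "1 \<le> cmod (f \<alpha>) * exp (2 * real d * ln H)"
  proof -
    have "exp (2 * real d * ln H) = H ^ (2 * 1 * d)"
      using exp_of_nat_mult[of "2 * d" "ln H"] H by simp
    thus ?thesis using \<open>1 \<le> cmod (bipoly 1 p \<alpha> (f \<alpha>)) * 1 ^ d * H ^ (2 * 1 * d)\<close> unfolding p by simp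
  qed
  define t where "t = 1 - cmod \<alpha>"
  have t: "0 < t" using S alg(7) by (auto simp: t_def)
  have "1 \<le> cmod (f \<alpha>) * exp (2 * real d * ln H)" by (rule ge)
  also have "\<dots> \<le> (a * b powr (- (1 / t))) * exp (2 * real d * ln H)"
    using small alg(7) by (intro mult_right_mono) (auto simp: disk_phi_def t_def intro: less_imp_le)
  also have "\<dots> \<le> (exp a * b powr (- (1 / t))) * exp (2 * real d * ln H)"
  proof -
    have "a \<le> exp a" using exp_ge_add_one_self[of a] by linarith
    thus ?thesis by (intro mult_right_mono) auto
  qed
  also have "\<dots> = exp (a - ln b / t + 2 * real d * ln H)"
    using ab by (simp add: powr_def exp_add exp_diff exp_minus divide_inverse)
  finally have "ln b / t \<le> a + 2 * real d * ln H" by simp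
  hence "u * (ln b / t) \<le> u * (a + 2 * real d * ln H)" using u by (intro mult_left_mono) auto
  moreover have "1 / t \<le> u * (ln b / t)" using u(2) t by (simp add: divide_right_mono)
  moreover have "a + 2 * real d * ln H \<le> 2 * (1 + a) * (real d * ln H)"
  proof -
    have "1 * 1 \<le> real d * ln H" using dH l by (intro mult_mono) auto
    hence "a * 1 \<le> a * (real d * ln H)" using ab by (intro mult_left_mono) auto
    thus ?thesis using ab mult_nonneg_nonneg[of a "real d * ln H"] dH l by (simp add: algebra_simps)
  qed
  ultimately have "1 / t \<le> u * (2 * (1 + a) * (real d * ln H))"
    using u by (meson mult_left_mono order.trans zero_le_one)
  moreover have "0 < u * (2 * (1 + a) * (real d * ln H))"
    using u ab dH l by (intro mult_pos_pos) auto
  ultimately have "1 / (u * (2 * (1 + a) * (real d * ln H))) \<le> t"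
    using t by (simp add: divide_le_eq mult.commute)
  moreover have "u * (2 * (1 + a) * (real d * ln H)) = 2 * (u * (1 + a)) * real d * ln H" by simp
  ultimately show ?thesis unfolding t_def u_def by (simp only:)
qed

theorem theorem1p1:
  "\<exists>c c' :: real list \<Rightarrow> real.
     computable_real_fun {[a, b] | a b. 0 < a \<and> 1 < b} c \<and>
     computable_real_fun {[a, b, r] | a b r. 0 < a \<and> 1 < b \<and> 0 < r \<and> r < 1} c' \<and>
     (\<forall>a b :: real. 0 < a \<and> 1 < b \<longrightarrow>
        c [a, b] > 0 \<and>
        (\<forall>r. 0 < r \<and> r < 1 \<longrightarrow> c' [a, b, r] > 0) \<and>
        (\<forall>(S :: complex set) (f :: complex \<Rightarrow> complex).
           S \<subseteq> ball 0 1 \<and> complex_of_real ` {0<..<1} \<subseteq> S \<and>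
           f analytic_on ball 0 1 \<and> (\<forall>z\<in>ball 0 1. cmod (f z) \<le> 1) \<and>
           (\<forall>z\<in>S. cmod (f z) < a * b powr (- disk_phi z)) \<longrightarrow>
           (\<forall>(d :: nat) (H :: real). d \<ge> 2 \<and> H \<ge> exp 1 \<longrightarrow>
              finite (alg_points f S d H) \<and>
              real (card (alg_points f S d H))
                \<le> c [a, b] * real d ^ 9 * (ln (real d))\<^sup>2 * (ln H) ^ 9 \<and>
              (\<forall>r. 0 < r \<and> r < 1 \<longrightarrow>
                 real (card {\<alpha> \<in> alg_points f S d H. cmod \<alpha> \<le> r})
                   \<le> c' [a, b, r] * real d ^ 4 * (ln (real d))\<^sup>2 * (ln H) ^ 4))))"
proof -
  define K :: nat where "K = 160000 * 581\<^sup>2"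
  \<comment> \<open>The forms \<open>real 1\<close> and \<open>xs ! i\<close> match the
    computability lemmas for constants and projections; the subtraction is legitimate since b >
    1.\<close>
  define E :: "real list \<Rightarrow> real" where "E xs = (real 1 + inverse (xs ! 1 - real 1)) * (real 1 + xs ! 0)" for xs
  \<comment> \<open>Here \<Theta> = 2 e d l and F = 2 e, where e is the value of \<open>E\<close>.
    Then (e * 2 e)^4 \<Theta>^5 = 16 * 32 e^13 d^5 l^5, which accounts for 512 and the exponent
    13.\<close>
  define c :: "real list \<Rightarrow> real" where "c xs = real (512 * K) * E xs ^ 13" for xs
  \<comment> \<open>Here F = \<Theta> = 1/(1 - r), so the power 9 arises as 4 from F and 5 from
    \<Theta>.\<close>
  define c' :: "real list \<Rightarrow> real" where "c' xs = real K * E xs ^ 4 * inverse (real 1 - xs ! 2) ^ 9" for xs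
  have E_comp: "computable_real_fun X E"
    if "\<And>xs. xs \<in> X \<Longrightarrow> 1 < length xs" "\<And>xs. xs \<in> X \<Longrightarrow> 0 < xs ! 0 \<and> 1 < xs ! 1" for X
    unfolding E_def using that
    by (intro computable_real_fun_mult computable_real_fun_add computable_real_fun_inverse
        computable_real_fun_diff computable_real_fun_const computable_real_fun_proj)
      (fastforce intro: less_imp_le add_nonneg_nonneg)+
  have E_pos: "0 < E xs" if "0 < xs ! 0" "1 < xs ! 1" for xs
    unfolding E_def using that by (intro mult_pos_pos add_pos_pos) auto
  have c_comp: "computable_real_fun {[a, b] | a b. 0 < a \<and> 1 < b} c"
    unfolding c_def
    by (intro computable_real_fun_mult computable_real_fun_power computable_real_fun_const E_comp)
      (auto intro!: zero_le_power less_imp_le[OF E_pos])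
  have c'_comp: "computable_real_fun {[a, b, r] | a b r. 0 < a \<and> 1 < b \<and> 0 < r \<and> r < 1} c'"
    unfolding c'_def
    by (intro computable_real_fun_mult computable_real_fun_power computable_real_fun_const E_comp
        computable_real_fun_inverse computable_real_fun_diff computable_real_fun_proj)
      (auto intro!: mult_nonneg_nonneg zero_le_power less_imp_le[OF E_pos])
  have c_pos: "c [a, b] > 0" if "0 < a" "1 < b" for a b
    unfolding c_def using that by (intro mult_pos_pos zero_less_power E_pos) (auto simp: K_def)
  have c'_pos: "c' [a, b, r] > 0" if "0 < a" "1 < b" "0 < r" "r < 1" for a b r
    unfolding c'_def using that by (intro mult_pos_pos zero_less_power E_pos) (auto simp: K_def)
  have main: "finite (alg_points f S d H) \<and>
      real (card (alg_points f S d H)) \<le> c [a, b] * real d ^ 9 * (ln (real d))\<^sup>2 * (ln H) ^ 9 \<and>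
      (\<forall>r. 0 < r \<and> r < 1 \<longrightarrow> real (card {\<alpha> \<in> alg_points f S d H. cmod \<alpha> \<le> r})
        \<le> c' [a, b, r] * real d ^ 4 * (ln (real d))\<^sup>2 * (ln H) ^ 4)"
    if ab: "0 < a" "1 < b"
      and S: "S \<subseteq> ball 0 1" "complex_of_real ` {0<..<1} \<subseteq> S"
      and f: "f analytic_on ball 0 1" "\<forall>z\<in>ball 0 1. cmod (f z) \<le> 1"
      and small: "\<forall>z\<in>S. cmod (f z) < a * b powr (- disk_phi z)"
      and dH: "2 \<le> d" "exp 1 \<le> H" for a b S f and d :: nat and H :: real
  proof -
    have H: "1 < H" using dH(2) exp_gt_one[of 1] by linarith
    have l: "1 \<le> ln H" using dH(2) H by (simp add: ln_ge_iff)
    define e where "e = (1 + inverse (b - 1)) * (1 + a)"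
    have e: "1 \<le> e" using ab mult_mono[of 1 "1 + inverse (b - 1)" 1 "1 + a"] by (simp add: e_def)
    have dl: "1 \<le> real d * ln H" using dH(1) l mult_mono[of 1 "real d" 1 "ln H"] by simp
    let ?A = "alg_points f S d H"
    have subset_le: "real (card Z) \<le> c [a, b] * real d ^ 9 * (ln (real d))\<^sup>2 * (ln H) ^ 9"
      if Z: "finite Z" "Z \<subseteq> ?A" for Z
    proof -
      define \<Theta> where "\<Theta> = 2 * e * real d * ln H"
      have "1 \<le> \<Theta>" using mult_mono[of 1 "2 * e" 1 "real d * ln H"] e dl by (simp add: \<Theta>_def mult.assoc)
      hence "real (card Z) \<le> 160000 * 581\<^sup>2 * (e * (2 * e)) ^ 4 * \<Theta> ^ 5 * real d ^ 4 * (ln (real d))\<^sup>2 * (ln H) ^ 4"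
        using card_alg_points_subset_le[OF ab S f small dH Z, of \<Theta> "2 * e"] e
          alg_points_away_from_circle[OF ab S(1) small dH] Z(2) unfolding \<Theta>_def e_def by auto
      also have "\<dots> = real (512 * K) * e ^ 13 * real d ^ 9 * (ln (real d))\<^sup>2 * (ln H) ^ 9"
      proof -
        have "(e * (2 * e)) ^ 4 * \<Theta> ^ 5 * real d ^ 4 * (ln H) ^ 4 = 512 * e ^ 13 * real d ^ 9 * (ln H) ^ 9"
          by (simp add: \<Theta>_def power_mult_distrib eval_nat_numeral)
        hence "160000 * 581\<^sup>2 * (ln (real d))\<^sup>2 * ((e * (2 * e)) ^ 4 * \<Theta> ^ 5 * real d ^ 4 * (ln H) ^ 4) =
          160000 * 581\<^sup>2 * (ln (real d))\<^sup>2 * (512 * e ^ 13 * real d ^ 9 * (ln H) ^ 9)"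
          by (simp only:)
        thus ?thesis by (simp add: K_def mult_ac)
      qed
      finally show ?thesis by (simp add: c_def E_def e_def)
    qed
    \<comment> \<open>A bound common to all finite subsets yields finiteness of the whole set
      together with the same bound.\<close>
    have fin: "finite ?A \<and> card ?A \<le> nat \<lfloor>c [a, b] * real d ^ 9 * (ln (real d))\<^sup>2 * (ln H) ^ 9\<rfloor>"
      by (rule finite_if_finite_subsets_card_bdd) (use subset_le in \<open>simp add: le_nat_floor\<close>)
    have "real (card {\<alpha> \<in> ?A. cmod \<alpha> \<le> r}) \<le> c' [a, b, r] * real d ^ 4 * (ln (real d))\<^sup>2 * (ln H) ^ 4"
      if r: "0 < r" "r < 1" for r
    proof -
      define \<Theta> where "\<Theta> = inverse (1 - r)"
      have \<Theta>: "1 \<le> \<Theta>" using r by (simp add: \<Theta>_def one_le_inverse_iff)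
      have "\<Theta> * 1 \<le> \<Theta> * (real d * ln H)" using \<Theta> dl by (intro mult_left_mono) auto
      hence "real (card {\<alpha> \<in> ?A. cmod \<alpha> \<le> r}) \<le> 160000 * 581\<^sup>2 * (e * \<Theta>) ^ 4 * \<Theta> ^ 5 * real d ^ 4 * (ln (real d))\<^sup>2 * (ln H) ^ 4"
        unfolding e_def using fin \<Theta>
        by (intro card_alg_points_subset_le[OF ab S f small dH]) (auto simp: \<Theta>_def divide_inverse mult.assoc)
      also have "\<dots> = real K * e ^ 4 * \<Theta> ^ 9 * real d ^ 4 * (ln (real d))\<^sup>2 * (ln H) ^ 4"
      proof -
        have "(e * \<Theta>) ^ 4 * \<Theta> ^ 5 = e ^ 4 * \<Theta> ^ 9"
          by (simp add: power_mult_distrib mult.assoc flip: power_add)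
        hence "160000 * 581\<^sup>2 * ((e * \<Theta>) ^ 4 * \<Theta> ^ 5) = 160000 * 581\<^sup>2 * (e ^ 4 * \<Theta> ^ 9)"
          by (simp only:)
        thus ?thesis by (simp add: K_def mult_ac)
      qed
      finally show ?thesis by (simp add: c'_def E_def e_def \<Theta>_def)
    qed
    thus ?thesis using fin subset_le by blast
  qed
  have goal: "0 < c [a, b] \<and> (\<forall>r. 0 < r \<and> r < 1 \<longrightarrow> 0 < c' [a, b, r]) \<and> X"
    if "0 < a \<and> 1 < b" "0 < a \<Longrightarrow> 1 < b \<Longrightarrow> X" for a b X
    using that c_pos c'_pos by auto
  show ?thesis
  proof (rule exI[of _ c], rule exI[of _ c'], intro conjI[OF c_comp] conjI[OF c'_comp] allI impI goal)
    fix a b S f and d :: nat and H :: real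
    assume ab: "0 < a" "1 < b" and d: "2 \<le> d \<and> exp 1 \<le> H"
      and S: "S \<subseteq> ball 0 1 \<and> complex_of_real ` {0<..<1} \<subseteq> S \<and>
           f analytic_on ball 0 1 \<and> (\<forall>z\<in>ball 0 1. cmod (f z) \<le> 1) \<and>
           (\<forall>z\<in>S. cmod (f z) < a * b powr (- disk_phi z))"
    show "finite (alg_points f S d H) \<and>
      real (card (alg_points f S d H)) \<le> c [a, b] * real d ^ 9 * (ln (real d))\<^sup>2 * (ln H) ^ 9 \<and>
      (\<forall>r. 0 < r \<and> r < 1 \<longrightarrow> real (card {\<alpha> \<in> alg_points f S d H. cmod \<alpha> \<le> r})
        \<le> c' [a, b, r] * real d ^ 4 * (ln (real d))\<^sup>2 * (ln H) ^ 4)"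
      by (rule main[OF ab]) (use S d in simp_all)
  qed
qed

end
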